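(* Let $n\ge2$ and let $\Omega\subset\mathbb{R}^n_x\times\mathbb{R}_t$ be a bounded open domain. There exists $(v,p)\in L^\infty(\mathbb{R}^n_x\times\mathbb{R}_t;\mathbb{R}^n\times\mathbb{R})$ solving, in the sense of distributions on $\mathbb{R}^n_x\times\mathbb{R}_t$, the Euler equations $$\partial_tv+\operatorname{div}(v\otimes v)+\nabla p=0,\qquad \operatorname{div}v=0,$$ such that \begin{itemize} \item $|v(x,t)|=1$ for a.e. $(x,t)\in\Omega$; \item $v(x,t)=0$ and $p(x,t)=0$ for a.e. $(x,t)\in(\mathbb{R}^n_x\times\mathbb{R}_t)\setminus\Omega$. \end{itemize} Moreover, there exists a sequence of functions $(v_k,p_k,f_k)\in C^\infty_c(\Omega;\mathbb{R}^n\times\mathbb{R}\times\mathbb{R}^n)$ such that $$\partial_tv_k+\operatorname{div}(v_k\otimes v_k)+\nabla p_k=f_k,\qquad \operatorname{div}v_k=0,$$ and \begin{itemize} \item $f_k$ converges to $0$ in $H^{-1}$; \item $\|v_k\|_\infty+\|p_k\|_\infty$ is uniformly bounded; \item $(v_k,p_k)\to(v,p)$ in $L^r$ for every $r<\infty$ ($r\ge1$). \end{itemize}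
   Context: Here $\operatorname{div}$ and $\nabla$ are taken in the space variable $x\in\mathbb{R}^n$ only; $v\otimes v$ is the matrix with entries $v_iv_j$ and $(\operatorname{div}(v\otimes v))_i=\sum_j\partial_{x_j}(v_iv_j)$. $H^{-1}$ and $L^r$ are over space-time $\mathbb{R}^n_x\times\mathbb{R}_t$. *)

theory Defs
  imports "HOL-Analysis.Analysis" "HOL-Probability.Essential_Supremum"
begin

section \<open>Smooth functions and differential operators\<close>

definition dird :: "'a::real_normed_vector \<Rightarrow> ('a \<Rightarrow> 'b::real_normed_vector) \<Rightarrow> 'a \<Rightarrow> 'b"
  where "dird b f z = frechet_derivative f (at z) b"

primrec Ck :: "nat \<Rightarrow> ('a::euclidean_space \<Rightarrow> 'b::real_normed_vector) \<Rightarrow> bool"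
  where
    "Ck 0 f \<longleftrightarrow> continuous_on UNIV f"
  | "Ck (Suc k) f \<longleftrightarrow> (\<forall>z. f differentiable (at z)) \<and> (\<forall>b\<in>Basis. Ck k (dird b f))"

text \<open>Elements of $C^\infty_c(\Omega)$ are represented by their extension by zero to the
  whole space.\<close>

definition Cc_infty :: "'a::euclidean_space set \<Rightarrow> ('a \<Rightarrow> 'b::real_normed_vector) \<Rightarrow> bool"
  where "Cc_infty \<Omega> f \<longleftrightarrow>
    (\<forall>k. Ck k f) \<and> compact (closure {z. f z \<noteq> 0}) \<and> closure {z. f z \<noteq> 0} \<subseteq> \<Omega>"

type_synonym 'n spacetime = "(real ^ 'n) \<times> real"

abbreviation e_t :: "('n::finite) spacetime"
  where "e_t \<equiv> (0, 1)"

abbreviation e_x :: "'n::finite \<Rightarrow> 'n spacetime"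
  where "e_x j \<equiv> (axis j 1, 0)"

definition div_x :: "(('n::finite) spacetime \<Rightarrow> real ^ 'n) \<Rightarrow> 'n spacetime \<Rightarrow> real"
  where "div_x w z = (\<Sum>j\<in>UNIV. dird (e_x j) (\<lambda>y. w y $ j) z)"

definition grad_x :: "(('n::finite) spacetime \<Rightarrow> real) \<Rightarrow> 'n spacetime \<Rightarrow> real ^ 'n"
  where "grad_x q z = (\<chi> i. dird (e_x i) q z)"

definition Div_x :: "(('n::finite) spacetime \<Rightarrow> real ^ 'n ^ 'n) \<Rightarrow> 'n spacetime \<Rightarrow> real ^ 'n"
  where "Div_x M z = (\<chi> i. div_x (\<lambda>y. M y $ i) z)"

definition otimes :: "real ^ 'n \<Rightarrow> real ^ 'n \<Rightarrow> real ^ 'n ^ 'n"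
  where "otimes a b = (\<chi> i j. a $ i * b $ j)"

section \<open>Distributional derivatives\<close>

text \<open>The action on a test function of the derivative, in direction \<open>b\<close>, of the distribution
  given by a locally integrable \<open>u\<close>.\<close>

definition distr_dird ::
    "'a::euclidean_space \<Rightarrow> ('a \<Rightarrow> real) \<Rightarrow> ('a \<Rightarrow> real) \<Rightarrow> real"
  where "distr_dird b u \<phi> = - (\<integral>z. u z * dird b \<phi> z \<partial>lborel)"

definition euler_distr ::
    "(('n::finite) spacetime \<Rightarrow> real ^ 'n) \<Rightarrow> ('n spacetime \<Rightarrow> real) \<Rightarrow> bool"
  where "euler_distr v p \<longleftrightarrow>
    (\<forall>\<phi>. Cc_infty UNIV \<phi> \<longrightarrow>
      (\<forall>i. distr_dird e_t (\<lambda>z. v z $ i) \<phi>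
           + (\<Sum>j\<in>UNIV. distr_dird (e_x j) (\<lambda>z. otimes (v z) (v z) $ i $ j) \<phi>)
           + distr_dird (e_x i) p \<phi> = 0) \<and>
      (\<Sum>j\<in>UNIV. distr_dird (e_x j) (\<lambda>z. v z $ j) \<phi>) = 0)"

section \<open>Function spaces\<close>

definition Linf_norm :: "('a::euclidean_space \<Rightarrow> 'b::real_normed_vector) \<Rightarrow> ereal"
  where "Linf_norm f = esssup lborel (\<lambda>z. ereal (norm (f z)))"

definition Linf :: "('a::euclidean_space \<Rightarrow> 'b::real_normed_vector) \<Rightarrow> bool"
  where "Linf f \<longleftrightarrow> f \<in> borel_measurable lborel \<and> Linf_norm f < \<infinity>"

definition Lr_norm :: "real \<Rightarrow> ('a::euclidean_space \<Rightarrow> 'b::real_normed_vector) \<Rightarrow> real"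
  where "Lr_norm r f = (\<integral>z. norm (f z) powr r \<partial>lborel) powr (1 / r)"

definition Lr :: "real \<Rightarrow> ('a::euclidean_space \<Rightarrow> 'b::real_normed_vector) \<Rightarrow> bool"
  where "Lr r f \<longleftrightarrow>
    f \<in> borel_measurable lborel \<and> integrable lborel (\<lambda>z. norm (f z) powr r)"

definition tendsto_Lr ::
    "real \<Rightarrow> (nat \<Rightarrow> 'a::euclidean_space \<Rightarrow> 'b::real_normed_vector) \<Rightarrow> ('a \<Rightarrow> 'b) \<Rightarrow> bool"
  where "tendsto_Lr r F f \<longleftrightarrow>
    (\<forall>k. Lr r (F k)) \<and> Lr r f \<and> (\<lambda>k. Lr_norm r (\<lambda>z. F k z - f z)) \<longlonglongrightarrow> 0"

text \<open>\<open>H1 u g\<close>: the function \<open>u\<close> is in $H^1$ and \<open>g b\<close> is its weak partial derivative in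
  direction \<open>b\<close>, for each basis vector \<open>b\<close>; these are unique up to null sets.\<close>

definition H1 ::
    "('a::euclidean_space \<Rightarrow> 'b::euclidean_space) \<Rightarrow> ('a \<Rightarrow> 'a \<Rightarrow> 'b) \<Rightarrow> bool"
  where "H1 u g \<longleftrightarrow> Lr 2 u \<and>
    (\<forall>b\<in>Basis. Lr 2 (g b) \<and>
      (\<forall>\<phi>. Cc_infty UNIV \<phi> \<longrightarrow>
        (\<forall>c\<in>Basis. (\<integral>z. (g b z \<bullet> c) * \<phi> z \<partial>lborel) = distr_dird b (\<lambda>z. u z \<bullet> c) \<phi>)))"

definition H1_norm ::
    "('a::euclidean_space \<Rightarrow> 'b::euclidean_space) \<Rightarrow> ('a \<Rightarrow> 'a \<Rightarrow> 'b) \<Rightarrow> real"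
  where "H1_norm u g = sqrt ((Lr_norm 2 u)\<^sup>2 + (\<Sum>b\<in>Basis. (Lr_norm 2 (g b))\<^sup>2))"

text \<open>The norm of \<open>f\<close> in $H^{-1} = (H^1)^*$, for \<open>f\<close> acting through the $L^2$ pairing; it is
  only meant for \<open>f\<close> in $L^2$, so that all the integrals converge.\<close>

definition Hm1_norm :: "('a::euclidean_space \<Rightarrow> 'b::euclidean_space) \<Rightarrow> ennreal"
  where "Hm1_norm f =
    Sup {ennreal \<bar>\<integral>z. f z \<bullet> u z \<partial>lborel\<bar> | u g. H1 u g \<and> H1_norm u g \<le> 1}"

end

theory Submission
  imports Defs "HOL-Computational_Algebra.Polynomial"
begin

text \<open>
  Convex integration by an explicit iteration. A pair \<open>(v, W)\<close> with \<open>W\<close> symmetric, \<open>div v = 0\<close> and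
  \<open>\<partial>\<^sub>t v + div W = 0\<close> is a strict subsolution if
  \<open>W - (tr W/n) I + I/n - v \<otimes> v\<close> is positive definite everywhere. That matrix has trace
  \<open>1 - |v|\<^sup>2\<close>, so it dominates the Reynolds term, which vanishes once \<open>|v| = 1\<close>.

  Around each point, a rapidly oscillating localized plane wave can be added to a strict subsolution
  without leaving the class; its energy is at least a constant multiple of the local integral of
  \<open>(1 - |v|\<^sup>2)\<^sup>2\<close>, while its trace and its pairings with finitely many given fields are as
  small as we like. A Vitali covering of \<open>\<Omega>\<close> by disjoint balls makes the gain global. Iterating
  from 0, with each increment almost orthogonal to all previous velocities, the energies increase up to
  a summable error and are bounded by the measure of \<open>\<Omega>\<close>, so the velocities are Cauchy in
  \<open>L\<^sup>2\<close> and the integrals of \<open>(1 - |v|\<^sup>2)\<^sup>2\<close> tend to 0. An almost everywhere convergent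
  subsequence and dominated convergence give the rest.
\<close>

section \<open>Calculus of smooth functions\<close>

text \<open>Strong convergence is needed because v \<otimes> v is not weakly continuous: a weak
  limit of subsolutions is in general no solution. Near-orthogonality supplies it by making the
  squared L2 distance of two iterates comparable to the difference of their energies. The defect is
  squared because the room left inside the convex set allows an amplitude proportional to 1 - |v|^2,
  and energy is quadratic in the amplitude.

  The pressure is no separate unknown but is read off the trace of \<open>W\<close>. Adding a
  multiple of the identity to \<open>W\<close> does not change the form, so the convex set gives no
  control of the trace. Hence the separate demand that the trace increments be summable, which makes
  the traces bounded and convergent at every point.

  The increments follow directions (e, e \<otimes> m + m \<otimes> e) with m orthogonal to the unit
  vector e. Each is the direction of a plane wave with space-time frequency (\<xi>, - m \<bullet>
  \<xi>), for any \<xi> orthogonal to e; a nonzero such \<xi> exists because the dimension is at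
  least 2.\<close>

lemma dird_eq: "(f has_derivative D) (at z) \<Longrightarrow> dird b f z = D b"
  by (metis dird_def frechet_derivative_at)

lemma differentiable_has_derivative_dird:
  "f differentiable (at z) \<Longrightarrow> (f has_derivative (\<lambda>h. dird h f z)) (at z)"
  unfolding dird_def by (simp add: frechet_derivative_works[symmetric] eta_contract_eq)

lemma Ck_imp_continuous: "Ck k f \<Longrightarrow> continuous_on UNIV f"
  by (cases k) (auto simp: continuous_on_eq_continuous_within differentiable_imp_continuous_within)

lemma Ck_lower: "Ck (Suc k) f \<Longrightarrow> Ck k f"
proof (induction k arbitrary: f)
  case 0
  then show ?case using Ck_imp_continuous by fastforce
next
  case (Suc k)
  then show ?case by auto
qed

lemma dird_bounded_linear:
  assumes "bounded_linear T" "f differentiable (at z)"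
  shows "dird b (\<lambda>z. T (f z)) z = T (dird b f z)"
  by (rule dird_eq, rule bounded_linear.has_derivative[OF assms(1)],
      rule differentiable_has_derivative_dird[OF assms(2)])

lemma dird_add:
  assumes "f differentiable (at z)" "g differentiable (at z)"
  shows "dird b (\<lambda>z. f z + g z) z = dird b f z + dird b g z"
  by (rule dird_eq, intro has_derivative_add differentiable_has_derivative_dird assms)

lemma dird_bounded_bilinear:
  assumes "bounded_bilinear mul" "f differentiable (at z)" "g differentiable (at z)"
  shows "dird b (\<lambda>z. mul (f z) (g z)) z = mul (f z) (dird b g z) + mul (dird b f z) (g z)"
  by (rule dird_eq[where D="\<lambda>h. mul (f z) (dird h g z) + mul (dird h f z) (g z)"],
      intro bounded_bilinear.FDERIV[OF assms(1)] differentiable_has_derivative_dird assms)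

lemma dird_compose:
  fixes h :: "real \<Rightarrow> real"
  assumes "h differentiable (at (g z))" "g differentiable (at z)"
  shows "dird b (\<lambda>z. h (g z)) z = dird 1 h (g z) * dird b g z"
proof -
  have "(h has_derivative (\<lambda>t. dird t h (g z))) (at (g z))"
    by (rule differentiable_has_derivative_dird[OF assms(1)])
  from has_derivative_compose[OF differentiable_has_derivative_dird[OF assms(2)] this]
  have "dird b (\<lambda>z. h (g z)) z = dird (dird b g z) h (g z)"
    by (rule dird_eq)
  moreover have "linear (\<lambda>t. dird t h (g z))"
    using differentiable_has_derivative_dird[OF assms(1)] has_derivative_linear by blast
  then have "dird (dird b g z *\<^sub>R 1) h (g z) = dird b g z *\<^sub>R dird 1 h (g z)"
    by (rule linear_cmul)
  ultimately show ?thesis by simp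
qed

lemma dird_const [simp]: "dird b (\<lambda>z. c) z = 0"
  by (rule dird_eq[where D="\<lambda>h. 0"]) simp

lemma dird_linear: "f differentiable (at z) \<Longrightarrow> linear (\<lambda>b. dird b f z)"
  using differentiable_has_derivative_dird has_derivative_linear by blast

lemma dird_expand:
  assumes "f differentiable (at z)"
  shows "dird b f z = (\<Sum>i\<in>Basis. (b \<bullet> i) *\<^sub>R dird i f z)"
proof -
  interpret linear "\<lambda>b. dird b f z" using dird_linear[OF assms] .
  have "dird b f z = dird (\<Sum>i\<in>Basis. (b \<bullet> i) *\<^sub>R i) f z" by (simp add: euclidean_representation)
  also have "\<dots> = (\<Sum>i\<in>Basis. (b \<bullet> i) *\<^sub>R dird i f z)" by (simp add: sum scale)
  finally show ?thesis .
qed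

lemma Ck_const: "Ck k (\<lambda>z. c)"
proof (induction k arbitrary: c)
  case (Suc k)
  have "dird b (\<lambda>z::'a. c) = (\<lambda>z. 0)" for b by auto
  then show ?case using Suc by simp
qed auto

lemma Ck_bounded_linear:
  assumes T: "bounded_linear T"
  shows "Ck k f \<Longrightarrow> Ck k (\<lambda>z. T (f z))"
proof (induction k arbitrary: f)
  case 0
  then show ?case by (auto intro: bounded_linear.continuous_on[OF T])
next
  case (Suc k)
  then have "dird b (\<lambda>z. T (f z)) = (\<lambda>z. T (dird b f z))" for b
    using dird_bounded_linear[OF T] by fastforce
  moreover have "(\<lambda>z. T (f z)) differentiable (at z)" for z
    unfolding differentiable_def
    using bounded_linear.has_derivative[OF T differentiable_has_derivative_dird, of f z] Suc.prems by auto
  ultimately show ?case using Suc by simp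
qed

lemma Ck_add: "Ck k f \<Longrightarrow> Ck k g \<Longrightarrow> Ck k (\<lambda>z. f z + g z)"
proof (induction k arbitrary: f g)
  case 0
  then show ?case by (auto intro: continuous_on_add)
next
  case (Suc k)
  then have "dird b (\<lambda>z. f z + g z) = (\<lambda>z. dird b f z + dird b g z)" for b
    using dird_add by fastforce
  moreover have "(\<lambda>z. f z + g z) differentiable (at z)" for z
    using Suc.prems by (auto intro: differentiable_add)
  ultimately show ?case using Suc by simp
qed

lemma Ck_bilinear:
  assumes P: "bounded_bilinear mul"
  shows "Ck k f \<Longrightarrow> Ck k g \<Longrightarrow> Ck k (\<lambda>z. mul (f z) (g z))"
proof (induction k arbitrary: f g)
  case 0
  then show ?case by (auto intro: bounded_bilinear.continuous_on[OF P])
next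
  case (Suc k)
  then have "dird b (\<lambda>z. mul (f z) (g z)) = (\<lambda>z. mul (f z) (dird b g z) + mul (dird b f z) (g z))" for b
    using dird_bounded_bilinear[OF P] by fastforce
  moreover have "(\<lambda>z. mul (f z) (g z)) differentiable (at z)" for z
    unfolding differentiable_def
    using bounded_bilinear.FDERIV[OF P differentiable_has_derivative_dird differentiable_has_derivative_dird, of f z g] Suc.prems
    by auto
  moreover have "Ck k f" "Ck k g" using Suc.prems Ck_lower by auto
  ultimately show ?case using Suc by (auto intro!: Ck_add)
qed

lemma Ck_compose:
  fixes h :: "real \<Rightarrow> real"
  shows "Ck k h \<Longrightarrow> Ck k g \<Longrightarrow> Ck k (\<lambda>z. h (g z))"
proof (induction k arbitrary: h g)
  case 0
  then show ?case by (auto intro: continuous_on_compose2)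
next
  case (Suc k)
  then have "dird b (\<lambda>z. h (g z)) = (\<lambda>z. dird 1 h (g z) * dird b g z)" for b
    using dird_compose by (metis Ck.simps(2))
  moreover have "(\<lambda>z. h (g z)) differentiable (at z)" for z
    using Suc.prems differentiable_compose[of h g z UNIV] by auto
  moreover have "Ck k (\<lambda>z. dird 1 h (g z))"
    using Suc Ck_lower by (metis Basis_real_def Ck.simps(2) singletonI)
  ultimately show ?case using Suc
    by (auto intro!: Ck_bilinear[OF bounded_bilinear_mult])
qed

definition smooth :: "('a::euclidean_space \<Rightarrow> 'b::real_normed_vector) \<Rightarrow> bool"
  where "smooth f \<longleftrightarrow> (\<forall>k. Ck k f)"

lemma smooth_continuous: "smooth f \<Longrightarrow> continuous_on UNIV f"
  using Ck_imp_continuous smooth_def by blast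

lemma smooth_differentiable: "smooth f \<Longrightarrow> f differentiable (at z)"
  unfolding smooth_def by (meson Ck.simps(2))

lemma smooth_const [simp, intro]: "smooth (\<lambda>z. c)"
  by (simp add: smooth_def Ck_const)

lemma smooth_bounded_linear: "bounded_linear T \<Longrightarrow> smooth f \<Longrightarrow> smooth (\<lambda>z. T (f z))"
  by (simp add: smooth_def Ck_bounded_linear)

lemma smooth_bilinear: "bounded_bilinear mul \<Longrightarrow> smooth f \<Longrightarrow> smooth g \<Longrightarrow> smooth (\<lambda>z. mul (f z) (g z))"
  by (simp add: smooth_def Ck_bilinear)

lemma smooth_compose: "smooth (h::real\<Rightarrow>real) \<Longrightarrow> smooth g \<Longrightarrow> smooth (\<lambda>z. h (g z))"
  by (simp add: smooth_def Ck_compose)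

lemma smooth_add [intro]: "smooth f \<Longrightarrow> smooth g \<Longrightarrow> smooth (\<lambda>z. f z + g z)"
  by (simp add: smooth_def Ck_add)

lemmas smooth_mult [intro] = smooth_bilinear[OF bounded_bilinear_mult]
lemmas smooth_scaleR [intro] = smooth_bilinear[OF bounded_bilinear_scaleR]
lemmas smooth_inner [intro] = smooth_bilinear[OF bounded_bilinear_inner]
lemmas smooth_minus [intro] = smooth_bounded_linear[OF bounded_linear_minus[OF bounded_linear_ident]]
lemmas smooth_vec_nth [intro] = smooth_bounded_linear[OF bounded_linear_vec_nth]

lemma smooth_diff [intro]: "smooth f \<Longrightarrow> smooth g \<Longrightarrow> smooth (\<lambda>z. f z - g z)"
  using smooth_add[of f "\<lambda>z. - g z"] by auto

lemma smooth_sum [intro]: "(\<And>i. i \<in> I \<Longrightarrow> smooth (f i)) \<Longrightarrow> smooth (\<lambda>z. \<Sum>i\<in>I. f i z)"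
  by (induction I rule: infinite_finite_induct) auto

lemma smooth_Pair [intro]:
  assumes "smooth f" "smooth g" shows "smooth (\<lambda>z. (f z, g z))"
proof -
  have "smooth (\<lambda>z. (f z, 0) + (0, g z))"
    by (intro smooth_add smooth_bounded_linear[OF _ assms(1)] smooth_bounded_linear[OF _ assms(2)]
      bounded_linear_Pair bounded_linear_ident bounded_linear_zero)
  then show ?thesis by simp
qed

lemma smooth_vec_lambda [intro]:
  fixes f :: "'n::finite \<Rightarrow> 'a::euclidean_space \<Rightarrow> 'b::euclidean_space"
  assumes "\<And>i. smooth (f i)" shows "smooth (\<lambda>z. \<chi> i. f i z)"
proof -
  have bl: "bounded_linear (\<lambda>x::'b. axis i x)" for i :: 'n
    by (intro linear_conv_bounded_linear[THEN iffD1] linearI) (auto simp: axis_def vec_eq_iff)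
  have "smooth (\<lambda>z. \<Sum>i\<in>UNIV. axis i (f i z))"
    by (intro smooth_sum smooth_bounded_linear[OF bl] assms)
  moreover have "(\<Sum>i\<in>UNIV. axis i (f i z)) = (\<chi> i. f i z)" for z
    by (simp add: vec_eq_iff axis_def sum.delta')
  ultimately show ?thesis by simp
qed

lemma smooth_dird [intro]:
  assumes "smooth f" shows "smooth (dird b f)"
proof -
  have "dird b f = (\<lambda>z. \<Sum>i\<in>Basis. (b \<bullet> i) *\<^sub>R dird i f z)"
    using dird_expand smooth_differentiable[OF assms] by blast
  moreover have "smooth (dird i f)" if "i \<in> Basis" for i
    using assms that unfolding smooth_def by (meson Ck.simps(2))
  then have "smooth (\<lambda>z. \<Sum>i\<in>Basis. (b \<bullet> i) *\<^sub>R dird i f z)"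
    by (intro smooth_sum smooth_scaleR smooth_const)
  ultimately show ?thesis by simp
qed

text \<open>The order of differentiability is raised by induction over all members of a class at
  once. This suits functions whose derivatives stay in one explicit family: trigonometric
  combinations, translates, and the functions \<open>flat p\<close>.\<close>

lemma smoothI_class:
  assumes "\<And>f z. P f \<Longrightarrow> f differentiable (at z)"
    and "\<And>f b. P f \<Longrightarrow> b \<in> Basis \<Longrightarrow> P (dird b f)"
    and "P f"
  shows "smooth f"
proof -
  have "P f \<Longrightarrow> Ck k f" for k f
  proof (induction k arbitrary: f)
    case 0
    then show ?case using assms(1)
      by (auto simp: continuous_on_eq_continuous_within differentiable_imp_continuous_within)
  qed (use assms in auto)
  then show ?thesis using assms(3) smooth_def by blast
qed

lemma smooth_ident: "smooth (\<lambda>z::'a::euclidean_space. z)"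
proof -
  have "Ck k (\<lambda>z::'a. z)" for k
  proof (cases k)
    case (Suc j)
    have "dird b (\<lambda>z::'a. z) = (\<lambda>z. b)" for b
      by (intro ext dird_eq[where D="\<lambda>h. h"]) simp
    then show ?thesis using Suc by (simp add: Ck_const)
  qed simp
  then show ?thesis by (simp add: smooth_def)
qed

lemma dird_real: "((f::real\<Rightarrow>real) has_real_derivative d) (at z) \<Longrightarrow> dird b f z = d * b"
  using dird_eq has_field_derivative_def by metis

lemma smooth_trig:
  shows smooth_cos: "smooth (cos :: real \<Rightarrow> real)" and smooth_sin: "smooth (sin :: real \<Rightarrow> real)"
proof -
  let ?P = "\<lambda>f. \<exists>a b. f = (\<lambda>x::real. a * sin x + b * cos x)"
  have d: "((\<lambda>x. a * sin x + b * cos x) has_real_derivative (a * cos z - b * sin z)) (at z)" for a b z :: real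
    by (auto intro!: derivative_eq_intros)
  have "smooth f" if "?P f" for f
  proof (rule smoothI_class[of ?P, OF _ _ that])
    show "f differentiable at z" if "?P f" for f z
      using that d unfolding differentiable_def has_field_derivative_def by blast
    show "?P (dird b f)" if f0: "?P f" and b: "b \<in> Basis" for f b
    proof -
      obtain c e where f: "f = (\<lambda>x. c * sin x + e * cos x)" using f0 by blast
      have "dird b f = (\<lambda>z. (-e) * sin z + c * cos z)"
        using dird_real[OF d] b unfolding f by auto
      then show ?thesis by blast
    qed
  qed
  moreover have "?P sin" by (intro exI[of _ 1] exI[of _ 0]) simp
  moreover have "?P cos" by (intro exI[of _ 0] exI[of _ 1]) simp
  ultimately show "smooth (cos :: real \<Rightarrow> real)" "smooth (sin :: real \<Rightarrow> real)" by blast+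
qed

section \<open>Mean value theorem along lines and symmetry of second derivatives\<close>

lemma dird_along_line:
  fixes f :: "'a::euclidean_space \<Rightarrow> real"
  assumes "smooth f"
  shows "((\<lambda>s. f (z + s *\<^sub>R a)) has_real_derivative dird a f (z + s *\<^sub>R a)) (at s)"
proof -
  have 1: "((\<lambda>s. z + s *\<^sub>R a) has_derivative (\<lambda>h. h *\<^sub>R a)) (at s)"
    by (auto intro!: derivative_eq_intros)
  have 2: "(f has_derivative (\<lambda>h. dird h f (z + s *\<^sub>R a))) (at (z + s *\<^sub>R a))"
    by (intro differentiable_has_derivative_dird smooth_differentiable assms)
  have "((\<lambda>s. f (z + s *\<^sub>R a)) has_derivative (\<lambda>h. dird (h *\<^sub>R a) f (z + s *\<^sub>R a))) (at s)"
    using has_derivative_compose[OF 1 2] .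
  moreover have "(\<lambda>h. dird (h *\<^sub>R a) f (z + s *\<^sub>R a)) = (*) (dird a f (z + s *\<^sub>R a))"
    using linear_cmul[OF dird_linear[OF smooth_differentiable[OF assms]]] by (auto simp: fun_eq_iff)
  ultimately show ?thesis unfolding has_field_derivative_def by simp
qed

lemma dird_mean_value:
  fixes f :: "'a::euclidean_space \<Rightarrow> real"
  assumes "smooth f" "h > 0"
  shows "\<exists>t. 0 < t \<and> t < h \<and> f (z + h *\<^sub>R a) - f z = h * dird a f (z + t *\<^sub>R a)"
  using MVT2[OF assms(2), of "\<lambda>s. f (z + s *\<^sub>R a)" "\<lambda>s. dird a f (z + s *\<^sub>R a)"]
    dird_along_line[OF assms(1)] by auto

lemma dird_translate:
  assumes "f differentiable (at (z + c))"
  shows "dird a (\<lambda>y. f (y + c)) z = dird a f (z + c)"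
proof -
  have "((\<lambda>y. y + c) has_derivative (\<lambda>h. h)) (at z)"
    by (auto intro!: derivative_eq_intros)
  from has_derivative_compose[OF this differentiable_has_derivative_dird[OF assms]]
  show ?thesis by (rule dird_eq)
qed

lemma smooth_translate:
  assumes "smooth f" shows "smooth (\<lambda>y. f (y + c))"
proof (rule smoothI_class[of "\<lambda>h. \<exists>f. smooth f \<and> h = (\<lambda>y. f (y + c))"])
  fix h :: "'a \<Rightarrow> 'b" and z assume "\<exists>f. smooth f \<and> h = (\<lambda>y. f (y + c))"
  then obtain f where f: "smooth f" "h = (\<lambda>y. f (y + c))" by blast
  show "h differentiable at z"
    unfolding f(2)
    by (rule differentiable_compose[where g="\<lambda>y. y + c", OF smooth_differentiable[OF f(1)]]) simp
next
  fix h :: "'a \<Rightarrow> 'b" and b assume "\<exists>f. smooth f \<and> h = (\<lambda>y. f (y + c))"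
  then obtain f where f: "smooth f" "h = (\<lambda>y. f (y + c))" by blast
  have "dird b h = (\<lambda>y. dird b f (y + c))"
    unfolding f(2) using dird_translate[OF smooth_differentiable[OF f(1)]] by auto
  then show "\<exists>f. smooth f \<and> dird b h = (\<lambda>y. f (y + c))"
    using smooth_dird[OF f(1)] by blast
qed (use assms in blast)

lemma dird_diff:
  assumes "f differentiable (at z)" "g differentiable (at z)"
  shows "dird b (\<lambda>z. f z - g z) z = dird b f z - dird b g z"
  by (rule dird_eq, intro has_derivative_diff differentiable_has_derivative_dird assms)

text \<open>The mean value theorem is used twice: along \<open>a\<close> for the increment of
  \<open>f\<close> by \<open>h *\<^sub>R b\<close>, then along \<open>b\<close> for
  \<open>dird a f\<close>. The left side is symmetric in \<open>a\<close> and \<open>b\<close>,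
  which is what \<open>dird_commute\<close> exploits.\<close>

lemma second_difference:
  fixes f :: "'a::euclidean_space \<Rightarrow> real"
  assumes "smooth f" "h > 0"
  shows "\<exists>s t. 0 < s \<and> s < h \<and> 0 < t \<and> t < h \<and>
    f (z + h *\<^sub>R a + h *\<^sub>R b) - f (z + h *\<^sub>R a) - f (z + h *\<^sub>R b) + f z
      = h * h * dird b (dird a f) (z + s *\<^sub>R a + t *\<^sub>R b)"
proof -
  define g where "g = (\<lambda>y. f (y + h *\<^sub>R b) - f y)"
  have "smooth g" unfolding g_def using assms(1) by (intro smooth_diff smooth_translate)
  then obtain s where s: "0 < s" "s < h" "g (z + h *\<^sub>R a) - g z = h * dird a g (z + s *\<^sub>R a)"
    using dird_mean_value assms(2) by blast
  have "dird a g (z + s *\<^sub>R a) = dird a f (z + s *\<^sub>R a + h *\<^sub>R b) - dird a f (z + s *\<^sub>R a)"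
    unfolding g_def using assms(1)
    by (subst dird_diff) (auto intro!: smooth_differentiable smooth_translate dird_translate)
  moreover obtain t where "0 < t" "t < h"
    "dird a f (z + s *\<^sub>R a + h *\<^sub>R b) - dird a f (z + s *\<^sub>R a) = h * dird b (dird a f) (z + s *\<^sub>R a + t *\<^sub>R b)"
    using dird_mean_value[OF smooth_dird[OF assms(1)] assms(2)] by blast
  ultimately show ?thesis using s unfolding g_def by (intro exI[of _ s] exI[of _ t]) auto
qed

text \<open>Both iterated derivatives are values, at points tending to \<open>z\<close>, that equal
  the same symmetric second difference divided by \<open>h\<^sup>2\<close>. Continuity of the second
  derivatives then identifies their limits.\<close>

lemma dird_commute:
  fixes f :: "'a::euclidean_space \<Rightarrow> real"
  assumes "smooth f"
  shows "dird a (dird b f) z = dird b (dird a f) z"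
proof -
  define h where "h n = 1 / real (Suc n)" for n
  have h0: "h \<longlonglongrightarrow> 0" unfolding h_def by (rule LIMSEQ_Suc[OF lim_1_over_n])
  have lim: "(\<lambda>n. dird q (dird p f) (z + s n *\<^sub>R p + t n *\<^sub>R q)) \<longlonglongrightarrow> dird q (dird p f) z"
    if "\<And>n. 0 < s n \<and> s n < h n" "\<And>n. 0 < t n \<and> t n < h n" for p q and s t :: "nat \<Rightarrow> real"
  proof -
    have s0: "s \<longlonglongrightarrow> 0"
      by (rule tendsto_sandwich[OF _ _ tendsto_const h0])
        (use that(1) in \<open>auto intro!: always_eventually less_imp_le\<close>)
    have t0: "t \<longlonglongrightarrow> 0"
      by (rule tendsto_sandwich[OF _ _ tendsto_const h0])
        (use that(2) in \<open>auto intro!: always_eventually less_imp_le\<close>)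
    have "isCont (dird q (dird p f)) z"
      using smooth_continuous[OF smooth_dird[OF smooth_dird[OF assms]]]
      by (simp add: continuous_on_eq_continuous_at)
    moreover have "(\<lambda>n. z + s n *\<^sub>R p + t n *\<^sub>R q) \<longlonglongrightarrow> z + 0 *\<^sub>R p + 0 *\<^sub>R q"
      by (intro tendsto_intros s0 t0)
    ultimately show ?thesis by (intro isCont_tendsto_compose[of _ "dird q (dird p f)"]) auto
  qed
  have pos: "h n > 0" for n by (simp add: h_def)
  obtain s t where st: "\<And>n. 0 < s n \<and> s n < h n" "\<And>n. 0 < t n \<and> t n < h n"
    "\<And>n. f (z + h n *\<^sub>R a + h n *\<^sub>R b) - f (z + h n *\<^sub>R a) - f (z + h n *\<^sub>R b) + f z
      = h n * h n * dird b (dird a f) (z + s n *\<^sub>R a + t n *\<^sub>R b)"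
    using second_difference[OF assms pos, where z=z and a=a and b=b] by metis
  obtain s' t' where st': "\<And>n. 0 < s' n \<and> s' n < h n" "\<And>n. 0 < t' n \<and> t' n < h n"
    "\<And>n. f (z + h n *\<^sub>R b + h n *\<^sub>R a) - f (z + h n *\<^sub>R b) - f (z + h n *\<^sub>R a) + f z
      = h n * h n * dird a (dird b f) (z + s' n *\<^sub>R b + t' n *\<^sub>R a)"
    using second_difference[OF assms pos, where z=z and a=b and b=a] by metis
  have "dird b (dird a f) (z + s n *\<^sub>R a + t n *\<^sub>R b) = dird a (dird b f) (z + s' n *\<^sub>R b + t' n *\<^sub>R a)" for n
  proof -
    have eq: "z + h n *\<^sub>R a + h n *\<^sub>R b = z + h n *\<^sub>R b + h n *\<^sub>R a"
      by (simp add: add_ac)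
    have "h n * h n * dird b (dird a f) (z + s n *\<^sub>R a + t n *\<^sub>R b)
      = h n * h n * dird a (dird b f) (z + s' n *\<^sub>R b + t' n *\<^sub>R a)"
      using st(3)[of n] st'(3)[of n] unfolding eq by linarith
    then show ?thesis using pos[of n] by (metis less_irrefl mult_cancel_left no_zero_divisors)
  qed
  then show ?thesis using LIMSEQ_unique[OF lim[OF st(1,2), of b a] ] lim[OF st'(1,2), of a b] by simp
qed

section \<open>Compactly supported functions\<close>

text \<open>Any compact superset of the support may serve as witness. Such supersets can be united
  freely, so closure properties need no computation of exact supports.\<close>

lemma Cc_infty_iff:
  "Cc_infty S f \<longleftrightarrow> smooth f \<and> (\<exists>K. compact K \<and> K \<subseteq> S \<and> (\<forall>z. z \<notin> K \<longrightarrow> f z = 0))"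
proof
  assume "Cc_infty S f"
  then show "smooth f \<and> (\<exists>K. compact K \<and> K \<subseteq> S \<and> (\<forall>z. z \<notin> K \<longrightarrow> f z = 0))"
    unfolding Cc_infty_def smooth_def using closure_subset[of "{z. f z \<noteq> 0}"]
    by (intro conjI exI[of _ "closure {z. f z \<noteq> 0}"]) auto
next
  assume *: "smooth f \<and> (\<exists>K. compact K \<and> K \<subseteq> S \<and> (\<forall>z. z \<notin> K \<longrightarrow> f z = 0))"
  then obtain K where K: "compact K" "K \<subseteq> S" "\<And>z. z \<notin> K \<Longrightarrow> f z = 0" by blast
  have "closure {z. f z \<noteq> 0} \<subseteq> K"
  proof (rule closure_minimal)
    show "{z. f z \<noteq> 0} \<subseteq> K" using K(3) by blast
  qed (rule compact_imp_closed[OF K(1)])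
  moreover from this have "compact (closure {z. f z \<noteq> 0})"
    using closed_Int_compact[OF closed_closure K(1), of "{z. f z \<noteq> 0}"] by (simp add: Int_absorb2)
  ultimately show "Cc_infty S f"
    using * K unfolding Cc_infty_def smooth_def by blast
qed

lemma Cc_inftyI: "smooth f \<Longrightarrow> compact K \<Longrightarrow> K \<subseteq> S \<Longrightarrow> (\<And>z. z \<notin> K \<Longrightarrow> f z = 0) \<Longrightarrow> Cc_infty S f"
  using Cc_infty_iff by blast

lemma Cc_infty_smooth: "Cc_infty S f \<Longrightarrow> smooth f"
  using Cc_infty_iff by blast

lemma Cc_infty_support:
  assumes "Cc_infty S f"
  obtains K where "compact K" "K \<subseteq> S" "\<And>z. z \<notin> K \<Longrightarrow> f z = 0"
  using assms Cc_infty_iff by blast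

lemma Cc_infty_mono: "Cc_infty S f \<Longrightarrow> S \<subseteq> T \<Longrightarrow> Cc_infty T f"
  unfolding Cc_infty_iff by blast

lemma Cc_infty_outside: "Cc_infty S f \<Longrightarrow> z \<notin> S \<Longrightarrow> f z = 0"
  unfolding Cc_infty_iff by blast

lemma Cc_infty_zero [simp]: "Cc_infty S (\<lambda>z. 0)"
  by (rule Cc_inftyI[of _ "{}"]) auto

lemma dird_outside:
  assumes "closed K" "\<And>z. z \<notin> K \<Longrightarrow> f z = 0" "z \<notin> K"
  shows "dird b f z = 0"
proof (rule dird_eq[where D="\<lambda>h. 0"])
  have "((\<lambda>z. 0) has_derivative (\<lambda>h. 0)) (at z)" by simp
  then show "(f has_derivative (\<lambda>h. 0)) (at z)"
    by (rule has_derivative_transform_within_open[of _ _ _ _ "- K"]) (use assms in \<open>auto\<close>)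
qed

lemma Cc_infty_dird [intro]:
  assumes "Cc_infty S f" shows "Cc_infty S (dird b f)"
proof -
  obtain K where K: "compact K" "K \<subseteq> S" "\<And>z. z \<notin> K \<Longrightarrow> f z = 0"
    using Cc_infty_support[OF assms] by blast
  show ?thesis
    using K dird_outside[OF compact_imp_closed[OF K(1)] K(3)] Cc_infty_smooth[OF assms]
    by (intro Cc_inftyI[of _ K]) auto
qed

text \<open>The union of the two supporting compact sets works for \<open>F\<close>. Sums,
  differences and pairs are instances, and with \<open>f = g\<close> so are products with a smooth
  factor.\<close>

lemma Cc_infty_comb:
  assumes "Cc_infty S f" "Cc_infty S g" "smooth F"
    and "\<And>z. f z = 0 \<Longrightarrow> g z = 0 \<Longrightarrow> F z = 0"
  shows "Cc_infty S F"
proof -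
  obtain K where K: "compact K" "K \<subseteq> S" "\<And>z. z \<notin> K \<Longrightarrow> f z = 0"
    using Cc_infty_support[OF assms(1)] by blast
  obtain L where L: "compact L" "L \<subseteq> S" "\<And>z. z \<notin> L \<Longrightarrow> g z = 0"
    using Cc_infty_support[OF assms(2)] by blast
  show ?thesis using K L assms(3,4)
    by (intro Cc_inftyI[of F "K \<union> L"]) auto
qed

lemma Cc_infty_smooth_comb:
  assumes "Cc_infty S f" "smooth F" "\<And>z. f z = 0 \<Longrightarrow> F z = 0"
  shows "Cc_infty S F"
  using Cc_infty_comb[OF assms(1,1,2)] assms(3) by blast

lemma Cc_infty_add [intro]: "Cc_infty S f \<Longrightarrow> Cc_infty S g \<Longrightarrow> Cc_infty S (\<lambda>z. f z + g z)"
  by (rule Cc_infty_comb[of S f g]) (auto dest: Cc_infty_smooth)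

lemma Cc_infty_diff [intro]: "Cc_infty S f \<Longrightarrow> Cc_infty S g \<Longrightarrow> Cc_infty S (\<lambda>z. f z - g z)"
  by (rule Cc_infty_comb[of S f g]) (auto dest: Cc_infty_smooth)

lemma Cc_infty_Pair [intro]: "Cc_infty S f \<Longrightarrow> Cc_infty S g \<Longrightarrow> Cc_infty S (\<lambda>z. (f z, g z))"
  by (rule Cc_infty_comb[of S f g]) (auto dest: Cc_infty_smooth simp: zero_prod_def)

lemma Cc_infty_sum [intro]: "(\<And>i. i \<in> I \<Longrightarrow> Cc_infty S (f i)) \<Longrightarrow> Cc_infty S (\<lambda>z. \<Sum>i\<in>I. f i z)"
  by (induction I rule: infinite_finite_induct) auto

lemma Cc_infty_mult_left [intro]:
  fixes f g :: "'a::euclidean_space \<Rightarrow> real"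
  shows "Cc_infty S f \<Longrightarrow> smooth g \<Longrightarrow> Cc_infty S (\<lambda>z. f z * g z)"
  by (rule Cc_infty_smooth_comb[of S f]) (auto dest: Cc_infty_smooth)

lemma Cc_infty_mult_right [intro]:
  fixes f g :: "'a::euclidean_space \<Rightarrow> real"
  shows "Cc_infty S f \<Longrightarrow> smooth g \<Longrightarrow> Cc_infty S (\<lambda>z. g z * f z)"
  by (rule Cc_infty_smooth_comb[of S f]) (auto dest: Cc_infty_smooth)

lemma Cc_infty_scaleR [intro]: "Cc_infty S f \<Longrightarrow> smooth g \<Longrightarrow> Cc_infty S (\<lambda>z. f z *\<^sub>R g z)"
  by (rule Cc_infty_smooth_comb[of S f]) (auto dest: Cc_infty_smooth)

lemma Cc_infty_inner [intro]: "Cc_infty S f \<Longrightarrow> smooth g \<Longrightarrow> Cc_infty S (\<lambda>z. f z \<bullet> g z)"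
  by (rule Cc_infty_smooth_comb[of S f]) (auto dest: Cc_infty_smooth)

lemma Cc_infty_vec_nth [intro]: "Cc_infty S f \<Longrightarrow> Cc_infty S (\<lambda>z. f z $ i)"
  by (rule Cc_infty_smooth_comb[of S f]) (auto dest: Cc_infty_smooth)

lemma Cc_infty_vec_lambda [intro]:
  fixes f :: "'n::finite \<Rightarrow> 'a::euclidean_space \<Rightarrow> 'b::euclidean_space"
  assumes "\<And>i. Cc_infty S (f i)"
  shows "Cc_infty S (\<lambda>z. \<chi> i. f i z)"
proof -
  obtain K where K: "\<And>i. compact (K i)" "\<And>i. K i \<subseteq> S" "\<And>i z. z \<notin> K i \<Longrightarrow> f i z = 0"
    using assms unfolding Cc_infty_iff by metis
  show ?thesis
    using K Cc_infty_smooth[OF assms]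
    by (intro Cc_inftyI[of _ "\<Union>i. K i"] compact_UN smooth_vec_lambda) (auto simp: vec_eq_iff)
qed

lemma Cc_infty_continuous: "Cc_infty S f \<Longrightarrow> continuous_on UNIV f"
  using smooth_continuous Cc_infty_smooth by blast

lemma smooth_borel [measurable_dest]: "smooth f \<Longrightarrow> f \<in> borel_measurable borel"
  using smooth_continuous borel_measurable_continuous_onI by blast

lemma Cc_infty_bounded:
  assumes "Cc_infty S f"
  obtains C where "C > 0" "\<And>z. norm (f z) \<le> C"
proof -
  obtain K where K: "compact K" "K \<subseteq> S" "\<And>z. z \<notin> K \<Longrightarrow> f z = 0"
    using Cc_infty_support[OF assms] by blast
  have "bounded (f ` K)"
    using K(1) Cc_infty_continuous[OF assms] continuous_on_subset
    by (intro compact_imp_bounded compact_continuous_image) auto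
  then obtain C where C: "C > 0" "\<And>z. z \<in> K \<Longrightarrow> norm (f z) \<le> C"
    unfolding bounded_pos by auto
  have "norm (f z) \<le> C" for z
    using C K(3)[of z] by (cases "z \<in> K") auto
  then show ?thesis using that C by blast
qed

lemma Cc_infty_integrable:
  fixes f :: "'a::euclidean_space \<Rightarrow> 'b::{banach, second_countable_topology}"
  assumes "Cc_infty S f"
  shows "integrable lborel f"
proof -
  obtain K where K: "compact K" "K \<subseteq> S" "\<And>z. z \<notin> K \<Longrightarrow> f z = 0"
    using Cc_infty_support[OF assms] by blast
  have "integrable lborel (\<lambda>x. indicator K x *\<^sub>R f x)"
    using K(1) Cc_infty_continuous[OF assms] continuous_on_subset
    by (intro borel_integrable_compact) auto
  moreover have "(\<lambda>x. indicator K x *\<^sub>R f x) = f"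
    using K(3) by (auto simp: indicator_def fun_eq_iff)
  ultimately show ?thesis by simp
qed

section \<open>Integration by parts on the whole space\<close>

lemma smooth_scaled_diff_tendsto:
  fixes f :: "'a::euclidean_space \<Rightarrow> real"
  assumes "smooth f"
  shows "(\<lambda>n. (f (z + (1 / real (Suc n)) *\<^sub>R b) - f z) * real (Suc n)) \<longlonglongrightarrow> dird b f z"
proof -
  have "((\<lambda>h. (f (z + h *\<^sub>R b) - f z) / h) \<longlongrightarrow> dird b f z) (at 0)"
    using dird_along_line[OF assms, of z b 0] by (simp add: DERIV_def)
  moreover have "filterlim (\<lambda>n. 1 / real (Suc n)) (at 0) sequentially"
    using LIMSEQ_Suc[OF lim_1_over_n] by (auto simp: filterlim_at simp del: of_nat_Suc)
  ultimately have "(\<lambda>n. (f (z + (1 / real (Suc n)) *\<^sub>R b) - f z) / (1 / real (Suc n))) \<longlonglongrightarrow> dird b f z"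
    by (rule filterlim_compose)
  then show ?thesis by (simp del: of_nat_Suc)
qed

lemma lborel_integral_shift:
  fixes f :: "'a::euclidean_space \<Rightarrow> real"
  assumes [measurable]: "f \<in> borel_measurable borel"
  shows "(\<integral>z. f (z + c) \<partial>lborel) = (\<integral>z. f z \<partial>lborel)"
proof -
  have "(\<integral>z. f z \<partial>lborel) = (\<integral>z. f z \<partial>(distr lborel borel ((+) c)))"
    by (simp add: lborel_distr_plus)
  also have "\<dots> = (\<integral>z. f (c + z) \<partial>lborel)"
    by (rule integral_distr) auto
  finally show ?thesis by (simp add: add.commute)
qed

text \<open>By translation invariance of Lebesgue measure every difference quotient has integral 0,
  and the quotients converge to the derivative under a common integrable bound.\<close>

lemma integral_dird_eq_0:
  fixes f :: "'a::euclidean_space \<Rightarrow> real"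
  assumes f: "Cc_infty S f"
  shows "(\<integral>z. dird b f z \<partial>lborel) = 0"
proof -
  obtain K where K: "compact K" "K \<subseteq> S" "\<And>z. z \<notin> K \<Longrightarrow> f z = 0"
    using Cc_infty_support[OF f] by blast
  obtain R where R: "R > 0" "\<And>z. z \<in> K \<Longrightarrow> norm z \<le> R"
    using compact_imp_bounded[OF K(1)] unfolding bounded_pos by auto
  obtain C where C: "C > 0" "\<And>z. norm (dird b f z) \<le> C"
    using Cc_infty_bounded[OF Cc_infty_dird[OF f]] by blast
  let ?g = "\<lambda>n z. (f (z + (1 / real (Suc n)) *\<^sub>R b) - f z) * real (Suc n)"
  have meas[measurable]: "f \<in> borel_measurable borel"
    using smooth_borel Cc_infty_smooth[OF f] by blast
  have sm: "smooth f" using Cc_infty_smooth[OF f] .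
  have lim: "(\<lambda>n. \<integral>z. ?g n z \<partial>lborel) \<longlonglongrightarrow> (\<integral>z. dird b f z \<partial>lborel)"
  \<comment> \<open>The translations have length at most \<open>norm b\<close>, so outside the ball
    of radius \<open>R + norm b\<close> both points of the quotient miss \<open>K\<close>. Inside,
    the mean value theorem bounds the quotient by \<open>C\<close>.\<close>
  proof (rule integral_dominated_convergence[where w="\<lambda>z. C * indicator (cball 0 (R + norm b)) z"])
    show "dird b f \<in> borel_measurable lborel"
      using smooth_borel[OF smooth_dird[OF sm]] by simp
    show "integrable lborel (\<lambda>z::'a. C * indicator (cball 0 (R + norm b)) z)"
      by (intro integrable_mult_right integrable_real_indicator) (use emeasure_lborel_cball_finite in \<open>auto simp: infinity_ennreal_def\<close>)
    show "AE z in lborel. (\<lambda>n. ?g n z) \<longlonglongrightarrow> dird b f z"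
      using smooth_scaled_diff_tendsto[OF sm] by auto
    show "AE z in lborel. norm (?g n z) \<le> C * indicator (cball 0 (R + norm b)) z" for n
    proof (rule AE_I2)
      fix z :: 'a
      have h: "1 / real (Suc n) > 0" "1 / real (Suc n) \<le> 1" by auto
      obtain t where "f (z + (1 / real (Suc n)) *\<^sub>R b) - f z = 1 / real (Suc n) * dird b f (z + t *\<^sub>R b)"
        using dird_mean_value[OF sm h(1)] by blast
      then have eq: "?g n z = dird b f (z + t *\<^sub>R b)" by (simp del: of_nat_Suc)
      show "norm (?g n z) \<le> C * indicator (cball 0 (R + norm b)) z"
      proof (cases "z \<in> cball 0 (R + norm b)")
        case True
        then show ?thesis using C(2)[of "z + t *\<^sub>R b"] unfolding eq by (simp add: indicator_def)
      next
        case False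
        then have zb: "norm z > R + norm b" by simp
        then have "z \<notin> K" using R(2)[of z] norm_ge_zero[of b] by linarith
        moreover have "norm z \<le> norm (z + (1 / real (Suc n)) *\<^sub>R b) + norm ((1 / real (Suc n)) *\<^sub>R b)"
          by (metis add_diff_cancel_right' norm_triangle_ineq4)
        moreover have "norm ((1 / real (Suc n)) *\<^sub>R b) \<le> norm b"
          using h mult_left_le_one_le[of "norm b" "1 / real (Suc n)"] by simp
        ultimately have "z \<notin> K" "z + (1 / real (Suc n)) *\<^sub>R b \<notin> K"
          using zb R(2)[of "z + (1 / real (Suc n)) *\<^sub>R b"] by auto
        then show ?thesis using K(3) False by (simp add: indicator_def)
      qed
    qed
  qed measurable
  have "(\<integral>z. ?g n z \<partial>lborel) = 0" for n
  proof -
    have i1: "integrable lborel (\<lambda>z. f z)" using Cc_infty_integrable[OF f] by simp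
    have i2: "integrable lborel (\<lambda>z. f (z + c))" for c
    proof -
      have "integrable (distr lborel borel ((+) c)) f" using i1 by (simp add: lborel_distr_plus)
      then have "integrable lborel (\<lambda>z. f (c + z))" by (subst (asm) integrable_distr_eq) auto
      then show ?thesis by (simp add: add.commute)
    qed
    show ?thesis using lborel_integral_shift[of f] i1 i2 by simp
  qed
  then show ?thesis using lim by (simp add: LIMSEQ_const_iff)
qed

lemma dird_mult:
  fixes f g :: "'a::euclidean_space \<Rightarrow> real"
  assumes "smooth f" "smooth g"
  shows "dird b (\<lambda>z. f z * g z) = (\<lambda>z. f z * dird b g z + dird b f z * g z)"
  using dird_bounded_bilinear[OF bounded_bilinear_mult] smooth_differentiable assms by blast

lemma integral_by_parts:
  fixes f g :: "'a::euclidean_space \<Rightarrow> real"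
  assumes f: "Cc_infty S f" and g: "smooth g"
  shows "(\<integral>z. dird b f z * g z \<partial>lborel) = - (\<integral>z. f z * dird b g z \<partial>lborel)"
proof -
  have "(\<integral>z. dird b (\<lambda>z. f z * g z) z \<partial>lborel) = 0"
    using f g by (intro integral_dird_eq_0[of S]) auto
  moreover have "integrable lborel (\<lambda>z. f z * dird b g z)" "integrable lborel (\<lambda>z. dird b f z * g z)"
    using f g by (auto intro!: Cc_infty_integrable[of S] Cc_infty_mult_left)
  ultimately show ?thesis
    using dird_mult[OF Cc_infty_smooth[OF f] g] by simp
qed

section \<open>A smooth bump function\<close>

lemma poly_times_exp_tendsto_0: "((\<lambda>t::real. poly p t * exp (1 - t)) \<longlongrightarrow> 0) at_top"
proof -
  have "((\<lambda>t::real. \<Sum>i\<le>degree p. coeff p i * exp 1 * (t ^ i / exp t)) \<longlongrightarrow> (\<Sum>i\<le>degree p. coeff p i * exp 1 * 0)) at_top"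
    by (intro tendsto_intros tendsto_power_div_exp_0)
  moreover have "(\<Sum>i\<le>degree p. coeff p i * exp 1 * (t ^ i / exp t)) = poly p t * exp (1 - t)" for t
    by (simp add: poly_altdef exp_diff sum_distrib_right sum_distrib_left sum_divide_distrib mult_ac)
  ultimately show ?thesis by simp
qed

text \<open>A polynomial factor in 1/x is carried along because differentiating exp (- 1/x) produces
  such factors; the family is thereby closed under differentiation. The summand 1 in the exponent
  normalizes \<open>flat 1 1 = 1\<close>.\<close>

definition flat :: "real poly \<Rightarrow> real \<Rightarrow> real"
  where "flat p x = (if x > 0 then poly p (1 / x) * exp (1 - 1 / x) else 0)"

text \<open>With t = 1/x one has d/dx = - t^2 d/dt, and differentiating p(t) exp (1 - t) gives the
  new polynomial t^2 (p - p'). At 0 the exponential beats every polynomial, so both one-sided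
  quotients tend to 0.\<close>

lemma flat_has_derivative:
  "(flat p has_real_derivative flat ([:0, 0, 1:] * (p - pderiv p)) x) (at x)"
proof -
  consider "x > 0" | "x < 0" | "x = 0" by linarith
  then show ?thesis
  proof cases
    case 1
    have "((\<lambda>x. poly p (1 / x) * exp (1 - 1 / x)) has_real_derivative flat ([:0, 0, 1:] * (p - pderiv p)) x) (at x)"
      using 1 by (auto intro!: derivative_eq_intros simp: flat_def field_simps power2_eq_square)
    then show ?thesis
      by (rule has_field_derivative_transform_within_open[of _ _ _ "{0<..}"]) (use 1 in \<open>auto simp: flat_def\<close>)
  next
    case 2
    have "((\<lambda>x. 0) has_real_derivative flat ([:0, 0, 1:] * (p - pderiv p)) x) (at x)"
      using 2 by (auto simp: flat_def)
    then show ?thesis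
      by (rule has_field_derivative_transform_within_open[of _ _ _ "{..<0}"]) (use 2 in \<open>auto simp: flat_def\<close>)
  next
    case 3
    have "((\<lambda>h. (flat p h - flat p 0) / h) \<longlongrightarrow> 0) (at_right 0)"
    proof (rule Lim_transform_eventually)
      show "((\<lambda>h::real. poly ([:0, 1:] * p) (inverse h) * exp (1 - inverse h)) \<longlongrightarrow> 0) (at_right 0)"
        using filterlim_compose[OF poly_times_exp_tendsto_0 filterlim_inverse_at_top_right] .
      show "\<forall>\<^sub>F h in at_right 0. poly ([:0, 1:] * p) (inverse h) * exp (1 - inverse h) = (flat p h - flat p 0) / h"
        using eventually_at_right_less[of 0]
        by eventually_elim (auto simp: flat_def divide_simps)
    qed
    moreover have "((\<lambda>h. (flat p h - flat p 0) / h) \<longlongrightarrow> 0) (at_left 0)"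
    proof (rule Lim_transform_eventually[OF tendsto_const])
      show "\<forall>\<^sub>F h in at_left 0. 0 = (flat p h - flat p 0) / h"
        by (intro eventually_at_leftI[of "-1"]) (auto simp: flat_def)
    qed
    ultimately have "((\<lambda>h. (flat p h - flat p 0) / h) \<longlongrightarrow> 0) (at 0)"
      by (simp add: filterlim_at_split)
    then show ?thesis using 3 by (simp add: DERIV_def) (simp add: flat_def)
  qed
qed

lemma smooth_flat: "smooth (flat p)"
proof (rule smoothI_class[of "\<lambda>f. f \<in> range flat"])
  fix f :: "real \<Rightarrow> real" and z assume "f \<in> range flat"
  then obtain p where "f = flat p" by blast
  then show "f differentiable (at z)"
    using flat_has_derivative[of p z] unfolding has_field_derivative_def differentiable_def by blast
next
  fix f :: "real \<Rightarrow> real" and b :: real assume "f \<in> range flat" "b \<in> Basis"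
  then obtain p where f: "f = flat p" and b: "b = 1" by auto
  have "dird b f = flat ([:0, 0, 1:] * (p - pderiv p))"
    using dird_real[OF flat_has_derivative, of b p] unfolding f b by (simp add: fun_eq_iff)
  then show "dird b f \<in> range flat" by blast
qed blast

lemma bump_function:
  fixes z0 :: "'a::euclidean_space"
  assumes "r > 0"
  obtains f :: "'a \<Rightarrow> real" where "Cc_infty (ball z0 r) f" "\<And>z. 0 \<le> f z" "\<And>z. f z \<le> 1"
    "\<And>z. z \<in> ball z0 (r / 4) \<Longrightarrow> f z \<ge> 1 / 2"
proof
  \<comment> \<open>\<open>g\<close> drops to 0 at radius \<open>r / 2\<close>, which leaves a
    compact support inside the open ball. At radius \<open>r / 4\<close> it still equals 3/4, where
    the bound 1 + (1 - 4/3) = 2/3 on the exponential exceeds 1/2.\<close>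
  define g where "g z = 1 - 4 / r\<^sup>2 * ((z - z0) \<bullet> (z - z0))" for z
  let ?f = "\<lambda>z. flat 1 (g z)"
  have g: "smooth g" unfolding g_def by (intro smooth_diff smooth_const smooth_mult smooth_inner smooth_ident)
  show "Cc_infty (ball z0 r) ?f"
  proof (rule Cc_inftyI[of _ "cball z0 (r/2)"])
    show "smooth ?f" by (rule smooth_compose[OF smooth_flat g])
    fix z assume "z \<notin> cball z0 (r/2)"
    then have "norm (z - z0) \<ge> r / 2" by (simp add: dist_norm norm_minus_commute)
    then have "(norm (z - z0))\<^sup>2 \<ge> (r / 2)\<^sup>2" using assms by (intro power_mono) auto
    then have "g z \<le> 0" using assms unfolding g_def power2_norm_eq_inner[symmetric]
      by (simp add: field_simps)
    then show "?f z = 0" by (simp add: flat_def)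
  qed (use assms in auto)
  show "0 \<le> ?f z" for z by (simp add: flat_def)
  have g1: "g z \<le> 1" for z unfolding g_def by simp
  show "?f z \<le> 1" for z
    using g1[of z] by (auto simp: flat_def field_simps)
  fix z assume "z \<in> ball z0 (r / 4)"
  then have "norm (z - z0) \<le> r / 4" by (simp add: dist_norm norm_minus_commute)
  then have "(norm (z - z0))\<^sup>2 \<le> (r / 4)\<^sup>2" by (intro power_mono) auto
  then have g: "g z \<ge> 3 / 4" using assms unfolding g_def power2_norm_eq_inner[symmetric]
    by (simp add: field_simps)
  then have "1 / g z \<le> 4 / 3" by (simp add: field_simps)
  moreover have "1 + (1 - 1 / g z) \<le> exp (1 - 1 / g z)" by (rule exp_ge_add_one_self)
  ultimately show "?f z \<ge> 1 / 2" using g by (simp add: flat_def)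
qed

section \<open>The set of subsolution values\<close>

text \<open>\<open>W\<close> stands for \<open>u + q I\<close> with \<open>u\<close> trace-free. The form
  \<open>gap_form v W\<close> is that of \<open>u + I/n - v \<otimes> v\<close>; its positive definiteness describes the
  relative interior of the convex hull of the set of all \<open>(v, v \<otimes> v - I/n)\<close> with
  \<open>|v| = 1\<close>, and leaves \<open>q\<close> unconstrained.\<close>

definition gap_form :: "real ^ 'n \<Rightarrow> real ^ 'n ^ 'n \<Rightarrow> real ^ 'n \<Rightarrow> real ^ 'n \<Rightarrow> real"
  where "gap_form v W x y =
    x \<bullet> (W *v y) + (1 - trace W) / CARD('n) * (x \<bullet> y) - (v \<bullet> x) * (v \<bullet> y)"

text \<open>Positive definiteness is stated with an explicit margin \<open>d\<close>; this margin is
  what a small change of \<open>(v, W)\<close> consumes in \<open>open_subsol\<close>. Symmetry of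
  \<open>W\<close> is imposed elsewhere, in \<open>lin_sol\<close>.\<close>

definition subsol :: "((real ^ 'n) \<times> (real ^ 'n ^ 'n)) set"
  where "subsol = {(v, W). \<exists>d>0. \<forall>x. d * (norm x)\<^sup>2 \<le> gap_form v W x x}"

section \<open>Continuity and elementary bounds of the gap form\<close>

lemma norm_matrix_vector_mult_le:
  fixes A :: "real ^ 'n ^ 'm"
  shows "norm (A *v x) \<le> norm A * norm x"
proof -
  have "norm (A *v x) = L2_set (\<lambda>i. A $ i \<bullet> x) UNIV"
    by (simp add: norm_vec_def matrix_vector_mul_component L2_set_def)
  also have "\<dots> \<le> L2_set (\<lambda>i. norm (A $ i) * norm x) UNIV"
    unfolding L2_set_def
    by (intro real_sqrt_le_mono sum_mono) (metis Cauchy_Schwarz_ineq2 abs_le_square_iff abs_mult abs_norm_cancel)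
  also have "\<dots> = norm A * norm x"
    by (simp add: norm_vec_def L2_set_left_distrib)
  finally show ?thesis .
qed

lemma trace_bounded_linear: "bounded_linear (trace :: real ^ 'n ^ 'n \<Rightarrow> real)"
  unfolding trace_def
  by (intro bounded_linear_sum bounded_linear_compose[OF bounded_linear_vec_nth bounded_linear_vec_nth])

lemma abs_trace_le:
  fixes A :: "real ^ 'n ^ 'n"
  shows "\<bar>trace A\<bar> \<le> CARD('n) * norm A"
proof -
  have "\<bar>trace A\<bar> \<le> (\<Sum>i\<in>UNIV. \<bar>A $ i $ i\<bar>)" unfolding trace_def by (rule sum_abs)
  also have "\<dots> \<le> (\<Sum>i\<in>(UNIV::'n set). norm A)"
    by (intro sum_mono) (metis component_le_norm_cart Finite_Cartesian_Product.norm_nth_le order_trans real_norm_def)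
  finally show ?thesis by simp
qed

lemma gap_form_add_left: "gap_form v W (x + y) z = gap_form v W x z + gap_form v W y z"
  by (simp add: gap_form_def inner_add_left algebra_simps add_divide_distrib diff_divide_distrib)

lemma gap_form_add_right: "gap_form v W z (x + y) = gap_form v W z x + gap_form v W z y"
  by (simp add: gap_form_def inner_add_left inner_add_right matrix_vector_right_distrib algebra_simps add_divide_distrib diff_divide_distrib)

lemma gap_form_scaleR_left: "gap_form v W (c *\<^sub>R x) z = c * gap_form v W x z"
  by (simp add: gap_form_def algebra_simps)

lemma gap_form_scaleR_right: "gap_form v W z (c *\<^sub>R x) = c * gap_form v W z x"
  by (simp add: gap_form_def algebra_simps scaleR_matrix_vector_assoc[symmetric] matrix_vector_mult_scaleR)

lemma gap_form_commute:
  assumes "transpose W = W"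
  shows "gap_form v W x y = gap_form v W y x"
proof -
  have "x \<bullet> (W *v y) = (W *v x) \<bullet> y"
    using dot_lmul_matrix[of x W y] transpose_matrix_vector[of W x] assms by simp
  then show ?thesis by (simp add: gap_form_def inner_commute mult.commute)
qed

text \<open>One copy of \<open>norm (W - W')\<close> comes from the quadratic form itself, the other
  from the trace term, since the trace divided by the dimension is at most the norm. The last term
  factors the difference of two squares.\<close>

lemma gap_form_diff_bound:
  fixes v v' :: "real ^ 'n"
  shows "\<bar>gap_form v W x x - gap_form v' W' x x\<bar>
    \<le> (2 * norm (W - W') + norm (v - v') * (norm v + norm v')) * (norm x)\<^sup>2"
proof -
  have n: "real CARD('n) > 0" by simp
  have "gap_form v W x x - gap_form v' W' x x = x \<bullet> ((W - W') *v x)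
      - trace (W - W') / CARD('n) * (x \<bullet> x) - ((v - v') \<bullet> x) * ((v + v') \<bullet> x)"
    using n by (simp add: gap_form_def matrix_vector_mult_diff_rdistrib inner_diff_right inner_diff_left
      inner_add_left trace_sub field_simps)
  moreover have "\<bar>x \<bullet> ((W - W') *v x)\<bar> \<le> norm (W - W') * (norm x)\<^sup>2"
  proof -
    have "\<bar>x \<bullet> ((W - W') *v x)\<bar> \<le> norm x * norm ((W - W') *v x)" by (rule Cauchy_Schwarz_ineq2)
    also have "\<dots> \<le> norm x * (norm (W - W') * norm x)"
      by (intro mult_left_mono norm_matrix_vector_mult_le) auto
    finally show ?thesis by (simp add: power2_eq_square mult_ac)
  qed
  moreover have "\<bar>trace (W - W') / CARD('n) * (x \<bullet> x)\<bar> \<le> norm (W - W') * (norm x)\<^sup>2"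
  proof -
    have "\<bar>trace (W - W') / CARD('n)\<bar> \<le> norm (W - W')"
      using abs_trace_le[of "W - W'"] n by (simp add: field_simps)
    then show ?thesis
      unfolding abs_mult power2_norm_eq_inner[symmetric] by (intro mult_mono) auto
  qed
  moreover have "\<bar>((v - v') \<bullet> x) * ((v + v') \<bullet> x)\<bar> \<le> norm (v - v') * (norm v + norm v') * (norm x)\<^sup>2"
  proof -
    have "\<bar>((v - v') \<bullet> x) * ((v + v') \<bullet> x)\<bar> \<le> (norm (v - v') * norm x) * (norm (v + v') * norm x)"
      unfolding abs_mult by (intro mult_mono Cauchy_Schwarz_ineq2) auto
    also have "\<dots> \<le> (norm (v - v') * norm x) * ((norm v + norm v') * norm x)"
      by (intro mult_left_mono mult_right_mono norm_triangle_ineq) auto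
    finally show ?thesis by (simp add: power2_eq_square mult_ac)
  qed
  ultimately show ?thesis unfolding distrib_right mult_2 by linarith
qed

lemma open_subsol: "open (subsol :: ((real ^ 'n) \<times> (real ^ 'n ^ 'n)) set)"
  unfolding open_dist
proof clarify
  fix v :: "real ^ 'n" and W :: "real ^ 'n ^ 'n"
  assume "(v, W) \<in> subsol"
  then obtain d where d: "d > 0" "\<And>x. d * (norm x)\<^sup>2 \<le> gap_form v W x x"
    unfolding subsol_def by auto
  \<comment> \<open>With \<open>e \<le> 1\<close> the sum of the two velocity norms is at most
    \<open>1 + 2 * norm v\<close>. Together with the factor 2 on the matrix part this gives
    \<open>3 + 2 * norm v\<close>, and half of the margin survives.\<close>
  define e where "e = min 1 (d / (2 * (3 + 2 * norm v)))"
  have e: "e > 0" "e \<le> 1" "e * (3 + 2 * norm v) \<le> d / 2"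
  proof -
    have p: "3 + 2 * norm v > 0" by (intro add_pos_nonneg) auto
    show "e > 0" "e \<le> 1" unfolding e_def using d p by auto
    have "e * (3 + 2 * norm v) \<le> d / (2 * (3 + 2 * norm v)) * (3 + 2 * norm v)"
      unfolding e_def using p by (intro mult_right_mono) auto
    also have "\<dots> = d / 2" using p by (simp add: field_simps)
    finally show "e * (3 + 2 * norm v) \<le> d / 2" .
  qed
  have "(v', W') \<in> subsol" if "dist (v', W') (v, W) < e" for v' :: "real ^ 'n" and W' :: "real ^ 'n ^ 'n"
  proof -
    have nv: "norm (v' - v) \<le> e" and nW: "norm (W' - W) \<le> e"
      using that dist_fst_le[of "(v', W')" "(v, W)"] dist_snd_le[of "(v', W')" "(v, W)"]
      by (auto simp: dist_norm)
    have "norm v' \<le> norm v + 1" using nv e(2) norm_triangle_sub[of v' v] by linarith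
    then have "norm (v' - v) * (norm v' + norm v) \<le> e * (1 + 2 * norm v)"
      using nv e by (intro mult_mono) auto
    then have b: "2 * norm (W' - W) + norm (v' - v) * (norm v' + norm v) \<le> d / 2"
      using nW e(3) by (simp add: algebra_simps)
    have "d / 2 * (norm x)\<^sup>2 \<le> gap_form v' W' x x" for x
      using gap_form_diff_bound[of v' W' x v W] mult_right_mono[OF b, of "(norm x)\<^sup>2"] d(2)[of x]
      by (simp add: field_simps)
    then show ?thesis unfolding subsol_def using d(1) by (auto intro!: exI[of _ "d / 2"])
  qed
  then show "\<exists>e>0. \<forall>y. dist y (v, W) < e \<longrightarrow> y \<in> subsol" using e(1) by auto
qed

lemma zero_in_subsol: "(0, 0) \<in> subsol"
  unfolding subsol_def gap_form_def
  by (auto intro!: exI[of _ "1 / real CARD('a)"] simp: power2_norm_eq_inner trace_def)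

lemma matrix_axis_entry: "axis i 1 \<bullet> ((W :: real ^ 'n ^ 'n) *v axis j 1) = W $ i $ j"
  by (simp add: inner_axis' matrix_vector_mul_component inner_axis)

lemma gap_form_axis:
  fixes v :: "real ^ 'n"
  shows "gap_form v W (axis i 1) (axis j 1) =
    W $ i $ j + (if i = j then (1 - trace W) / CARD('n) else 0) - v $ i * v $ j"
  unfolding gap_form_def by (simp add: matrix_axis_entry inner_axis inner_axis_axis) (simp add: axis_def)

text \<open>This is the trace of the form: its normalization cancels the trace of \<open>W\<close>.
  It turns positivity of the form into bounds by 1 - |v|^2.\<close>

lemma sum_gap_form_axis:
  fixes v :: "real ^ 'n"
  shows "(\<Sum>i\<in>UNIV. gap_form v W (axis i 1) (axis i 1)) = 1 - (norm v)\<^sup>2"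
  by (simp add: gap_form_axis sum.distrib sum_subtractf trace_def[symmetric] power2_norm_eq_inner inner_vec_def)

lemma subsol_gap_nonneg: "(v, W) \<in> subsol \<Longrightarrow> 0 \<le> gap_form v W x x"
  unfolding subsol_def by (auto intro: order_trans[rotated])

lemma subsol_gap_pos: "(v, W) \<in> subsol \<Longrightarrow> x \<noteq> 0 \<Longrightarrow> 0 < gap_form v W x x"
  unfolding subsol_def by (auto intro: less_le_trans[rotated])

lemma subsol_norm_less_1:
  assumes "(v, W) \<in> subsol" shows "norm v < 1"
proof -
  have "0 < (\<Sum>i\<in>UNIV. gap_form v W (axis i 1) (axis i 1))"
    by (intro sum_pos subsol_gap_pos[OF assms]) auto
  then have "(norm v)\<^sup>2 < 1\<^sup>2" using sum_gap_form_axis[of v W] by simp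
  then show ?thesis by (rule power2_less_imp_less) simp
qed

text \<open>A diagonal entry of a nonnegative form is at most the trace. For the others, evaluating
  the form at the sum and the difference of two axis vectors bounds twice the mixed entry by two
  diagonal ones.\<close>

lemma gap_form_entry_bound:
  assumes "(v, W) \<in> subsol" "transpose W = W"
  shows "\<bar>gap_form v W (axis i 1) (axis j 1)\<bar> \<le> 1 - (norm v)\<^sup>2"
proof -
  let ?q = "gap_form v W" and ?x = "axis i 1" and ?y = "axis j 1"
  have pm: "0 \<le> ?q ?x ?x + 2 * c * ?q ?x ?y + c * c * ?q ?y ?y" for c
    using subsol_gap_nonneg[OF assms(1), of "?x + c *\<^sub>R ?y"] gap_form_commute[OF assms(2), of v ?y ?x]
    by (simp add: gap_form_add_left gap_form_add_right gap_form_scaleR_left gap_form_scaleR_right algebra_simps)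
  have le: "?q (axis k 1) (axis k 1) \<le> 1 - (norm v)\<^sup>2" for k
    unfolding sum_gap_form_axis[of v W, symmetric]
    by (rule member_le_sum[of k UNIV "\<lambda>k. ?q (axis k 1) (axis k 1)"]) (auto intro: subsol_gap_nonneg[OF assms(1)])
  show ?thesis using pm[of 1] pm[of "-1"] le[of i] le[of j] by auto
qed

lemma gap_form_Cauchy_Schwarz:
  assumes "(v, W) \<in> subsol" "transpose W = W" "y \<noteq> 0"
  shows "(gap_form v W x y)\<^sup>2 \<le> gap_form v W x x * gap_form v W y y"
proof -
  let ?q = "gap_form v W"
  have pos: "?q y y > 0" using subsol_gap_pos assms by blast
  define t where "t = - ?q x y / ?q y y"
  have "0 \<le> ?q (x + t *\<^sub>R y) (x + t *\<^sub>R y)" by (rule subsol_gap_nonneg[OF assms(1)])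
  also have "\<dots> = ?q x x + 2 * t * ?q x y + t * t * ?q y y"
    using gap_form_commute[OF assms(2), of v y x]
    by (simp add: gap_form_add_left gap_form_add_right gap_form_scaleR_left gap_form_scaleR_right algebra_simps)
  also have "\<dots> = ?q x x - (?q x y)\<^sup>2 / ?q y y"
    unfolding t_def using pos by (simp add: power2_eq_square field_simps)
  finally show ?thesis using pos by (simp add: field_simps)
qed

section \<open>Segments through a point of the set, of length proportional to 1 - |v|^2\<close>

definition sym_otimes :: "real ^ 'n \<Rightarrow> real ^ 'n \<Rightarrow> real ^ 'n ^ 'n"
  where "sym_otimes a b = otimes a b + otimes b a"

lemma otimes_vector_mult: "otimes a b *v x = (b \<bullet> x) *\<^sub>R a"
  by (simp add: vec_eq_iff otimes_def matrix_vector_mult_def inner_vec_def sum_distrib_left mult_ac)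

lemma trace_otimes: "trace (otimes a b) = a \<bullet> b"
  by (simp add: trace_def otimes_def inner_vec_def)

text \<open>The vector \<open>e\<close> is the direction of the column of the form at its largest diagonal entry, so
  by Cauchy-Schwarz the form dominates \<open>(1 - |v|\<^sup>2)/n\<close> times \<open>(e \<bullet> x)\<^sup>2\<close>. Taking
  \<open>m = v - (v \<bullet> e) e\<close>, moving along the segment changes the form only by a multiple of
  \<open>(e \<bullet> x)\<^sup>2\<close>.\<close>

lemma subsol_segment:
  fixes v :: "real ^ 'n"
  assumes U: "(v, W) \<in> subsol" and sym: "transpose W = W"
  obtains e m where "norm e = 1" "e \<bullet> m = 0"
    "\<And>s. \<bar>s\<bar> \<le> (1 - (norm v)\<^sup>2) / (4 * real CARD('n)) \<Longrightarrow> (v + s *\<^sub>R e, W + s *\<^sub>R sym_otimes e m) \<in> subsol"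
proof -
  let ?q = "gap_form v W" and ?n = "real CARD('n)"
  define T where "T = 1 - (norm v)\<^sup>2"
  have v1: "norm v < 1" using subsol_norm_less_1[OF U] .
  have T: "0 < T" "T \<le> 1"
    unfolding T_def using power_strict_mono[OF v1, of 2] by auto
  have n: "?n \<ge> 1" by (simp add: Suc_leI)
  \<comment> \<open>The diagonal entries add up to \<open>T\<close>, so at least one of them reaches
    the average.\<close>
  obtain i where i: "?q (axis i 1) (axis i 1) \<ge> T / ?n"
  proof (rule ccontr)
    assume "\<not> thesis"
    then have "(\<Sum>i\<in>UNIV. ?q (axis i 1) (axis i 1)) < (\<Sum>i\<in>(UNIV::'n set). T / ?n)"
      using that by (intro sum_strict_mono) (auto simp: not_le[symmetric])
    then show False using sum_gap_form_axis[of v W] T_def by simp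
  qed
  define y where "y = W *v axis i 1 + ((1 - trace W) / ?n) *\<^sub>R axis i 1 - v $ i *\<^sub>R v"
  have y: "?q x (axis i 1) = x \<bullet> y" for x
    unfolding y_def gap_form_def by (simp add: inner_add_right inner_diff_right inner_axis inner_commute)
  define \<mu> where "\<mu> = ?q (axis i 1) (axis i 1)"
  have \<mu>: "\<mu> \<ge> T / ?n" "\<mu> > 0" using i T n unfolding \<mu>_def by (auto intro: less_le_trans[OF _ i])
  have yn: "norm y \<ge> \<mu>"
    using Cauchy_Schwarz_ineq2[of "axis i 1" y] y[of "axis i 1"] unfolding \<mu>_def by (auto simp: norm_axis_1)
  then have ypos: "norm y > 0" using \<mu> by linarith
  define e where "e = y /\<^sub>R norm y"
  have e1: "norm e = 1" unfolding e_def using ypos by simp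
  have ee: "e \<bullet> e = 1" using e1 by (simp add: norm_eq_1)
  \<comment> \<open>Cauchy-Schwarz bounds \<open>(x \<bullet> y)\<^sup>2\<close> by \<mu> times the
    form at \<open>x\<close>. As \<open>y\<close> is \<open>norm y\<close> times \<open>e\<close>
    and \<open>norm y\<close> is at least \<mu>, one factor \<mu> cancels and another
    remains.\<close>
  have low: "(T / ?n) * (e \<bullet> x)\<^sup>2 \<le> ?q x x" for x
  proof -
    have "(x \<bullet> y)\<^sup>2 \<le> ?q x x * \<mu>"
      using gap_form_Cauchy_Schwarz[OF U sym, of "axis i 1" x] unfolding y \<mu>_def by simp
    moreover have "x \<bullet> y = norm y * (e \<bullet> x)" unfolding e_def using ypos by (simp add: inner_commute)
    moreover have "\<mu> * \<mu> * (e \<bullet> x)\<^sup>2 \<le> (norm y * norm y) * (e \<bullet> x)\<^sup>2"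
      using yn \<mu> by (intro mult_right_mono mult_mono) auto
    ultimately have "\<mu> * (\<mu> * (e \<bullet> x)\<^sup>2) \<le> \<mu> * ?q x x"
      by (simp add: power2_eq_square mult_ac)
    then have "\<mu> * (e \<bullet> x)\<^sup>2 \<le> ?q x x" using \<mu>(2) by simp
    moreover have "(T / ?n) * (e \<bullet> x)\<^sup>2 \<le> \<mu> * (e \<bullet> x)\<^sup>2" using \<mu> by (intro mult_right_mono) auto
    ultimately show ?thesis by linarith
  qed
  define m where "m = v - (v \<bullet> e) *\<^sub>R e"
  have em: "e \<bullet> m = 0" unfolding m_def using ee by (simp add: inner_diff_right inner_commute)
  have "(v + s *\<^sub>R e, W + s *\<^sub>R sym_otimes e m) \<in> subsol" if s: "\<bar>s\<bar> \<le> T / (4 * ?n)" for s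
  proof -
    have "trace (s *\<^sub>R sym_otimes e m) = s * trace (sym_otimes e m)"
      using linear_cmul[OF bounded_linear.linear[OF trace_bounded_linear]] by simp
    then have tr: "trace (W + s *\<^sub>R sym_otimes e m) = trace W"
      using em by (simp add: trace_add sym_otimes_def trace_otimes inner_commute)
    \<comment> \<open>Splitting \<open>v\<close> into \<open>m\<close> plus its component along
      \<open>e\<close>, the contributions linear in \<open>m \<bullet> x\<close> from
      \<open>W\<close> and from the square of the velocity cancel. This is the reason for the choice
      of \<open>m\<close>.\<close>
    have q: "gap_form (v + s *\<^sub>R e) (W + s *\<^sub>R sym_otimes e m) x x = ?q x x - (2 * s * (v \<bullet> e) + s\<^sup>2) * (e \<bullet> x)\<^sup>2" for x
    proof -
      have mx: "m \<bullet> x = v \<bullet> x - (v \<bullet> e) * (e \<bullet> x)" unfolding m_def by (simp add: inner_diff_left)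
      have "x \<bullet> ((W + s *\<^sub>R sym_otimes e m) *v x) = x \<bullet> (W *v x) + 2 * s * (e \<bullet> x) * (m \<bullet> x)"
        unfolding sym_otimes_def
        by (simp add: matrix_vector_mult_add_rdistrib scaleR_matrix_vector_assoc[symmetric]
            otimes_vector_mult inner_add_right inner_commute algebra_simps)
      then show ?thesis unfolding gap_form_def tr mx
        by (simp add: inner_add_left power2_eq_square algebra_simps)
    qed
    have "2 * s * (v \<bullet> e) + s\<^sup>2 \<le> 3 * \<bar>s\<bar>"
    proof -
      have "T \<le> 4 * ?n" using T n by linarith
      then have "T / (4 * ?n) \<le> 1" by (simp add: pos_divide_le_eq)
      then have "\<bar>s\<bar> \<le> 1" using s by linarith
      then have "s\<^sup>2 \<le> \<bar>s\<bar>" using mult_left_mono[of "\<bar>s\<bar>" 1 "\<bar>s\<bar>"] by (simp add: power2_eq_square)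
      moreover have "\<bar>v \<bullet> e\<bar> \<le> 1" using Cauchy_Schwarz_ineq2[of v e] v1 e1 by simp
      then have "\<bar>2 * s * (v \<bullet> e)\<bar> \<le> 2 * \<bar>s\<bar>" using mult_left_mono[of "\<bar>v \<bullet> e\<bar>" 1 "2 * \<bar>s\<bar>"] by (simp add: abs_mult mult_ac)
      ultimately show ?thesis by linarith
    qed
    moreover have "3 * (T / (4 * ?n)) = 3 / 4 * (T / ?n)" by simp
    \<comment> \<open>The bound on \<open>s\<close> lets the change consume at most three quarters
      of the lower bound \<open>low\<close>, so a quarter of the original form, and of its margin
      \<open>d\<close>, is left.\<close>
    ultimately have c: "2 * s * (v \<bullet> e) + s\<^sup>2 \<le> 3 / 4 * (T / ?n)" using s by linarith
    obtain d where d: "d > 0" "\<And>x. d * (norm x)\<^sup>2 \<le> ?q x x" using U unfolding subsol_def by auto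
    have "d / 4 * (norm x)\<^sup>2 \<le> gap_form (v + s *\<^sub>R e) (W + s *\<^sub>R sym_otimes e m) x x" for x
      unfolding q using mult_right_mono[OF c, of "(e \<bullet> x)\<^sup>2"] low[of x] d(2)[of x] by (simp add: algebra_simps)
    then show ?thesis unfolding subsol_def using d(1) by (auto intro!: exI[of _ "d / 4"])
  qed
  then show ?thesis using that[OF e1 em] unfolding T_def by blast
qed

section \<open>Localized plane waves\<close>

lemma dird_scaleR_const:
  assumes "f differentiable (at z)"
  shows "dird b (\<lambda>y. f y *\<^sub>R a) z = dird b f z *\<^sub>R a"
  using dird_bounded_linear[OF bounded_linear_scaleR_left assms] .

lemma dird_vec_nth:
  assumes "f differentiable (at z)"
  shows "dird b (\<lambda>y. f y $ i) z = dird b f z $ i"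
  using dird_bounded_linear[OF bounded_linear_vec_nth assms] .

lemma div_x_eq:
  assumes "smooth w" shows "div_x w z = (\<Sum>j\<in>UNIV. dird (e_x j) w z $ j)"
  unfolding div_x_def by (intro sum.cong refl dird_vec_nth smooth_differentiable assms)

lemma Div_x_eq:
  assumes "smooth M" shows "Div_x M z $ i = (\<Sum>j\<in>UNIV. dird (e_x j) M z $ i $ j)"
  unfolding Div_x_def using assms
  by (simp add: div_x_eq smooth_vec_nth dird_vec_nth smooth_differentiable)

lemma div_x_add:
  assumes "smooth u" "smooth w" shows "div_x (\<lambda>y. u y + w y) z = div_x u z + div_x w z"
  using assms by (simp add: div_x_eq smooth_add dird_add smooth_differentiable sum.distrib)

lemma div_x_diff:
  assumes "smooth u" "smooth w" shows "div_x (\<lambda>y. u y - w y) z = div_x u z - div_x w z"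
  using assms by (simp add: div_x_eq smooth_diff dird_diff smooth_differentiable sum_subtractf)

lemma Div_x_add:
  assumes "smooth u" "smooth w" shows "Div_x (\<lambda>y. u y + w y) z = Div_x u z + Div_x w z"
  using assms by (simp add: vec_eq_iff Div_x_eq smooth_add dird_add smooth_differentiable sum.distrib)

lemma Div_x_diff:
  assumes "smooth u" "smooth w" shows "Div_x (\<lambda>y. u y - w y) z = Div_x u z - Div_x w z"
  using assms by (simp add: vec_eq_iff Div_x_eq smooth_diff dird_diff smooth_differentiable sum_subtractf)

lemma dird_spatial:
  fixes f :: "('n::finite) spacetime \<Rightarrow> real"
  assumes "smooth f"
  shows "dird (a, 0) f z = (\<Sum>j\<in>UNIV. a $ j * dird (e_x j) f z)"
proof -
  interpret linear "\<lambda>b. dird b f z" by (rule dird_linear[OF smooth_differentiable[OF assms]])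
  have "(a, 0::real) = (\<Sum>j\<in>UNIV. a $ j *\<^sub>R e_x j)"
    by (simp add: prod_eq_iff fst_sum snd_sum vec_eq_iff axis_def sum.delta' if_distrib cong: if_cong)
  then have "dird (a, 0) f z = dird (\<Sum>j\<in>UNIV. a $ j *\<^sub>R e_x j) f z" by simp
  also have "\<dots> = (\<Sum>j\<in>UNIV. a $ j * dird (e_x j) f z)" by (simp only: sum scale real_scaleR_def)
  finally show ?thesis .
qed

lemma div_x_scaleR:
  assumes "smooth f" shows "div_x (\<lambda>y. f y *\<^sub>R a) z = dird (a, 0) f z"
  using assms by (simp add: div_x_eq smooth_scaleR dird_scaleR_const smooth_differentiable dird_spatial[OF assms, of a] mult.commute)

lemma Div_x_otimes:
  assumes "smooth f" shows "Div_x (\<lambda>y. f y *\<^sub>R otimes a b) z = dird (b, 0) f z *\<^sub>R a"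
  using assms by (simp add: vec_eq_iff Div_x_eq smooth_scaleR dird_scaleR_const smooth_differentiable
    dird_spatial[OF assms, of b] otimes_def sum_distrib_left mult_ac)

lemma Div_x_sym_otimes:
  assumes "smooth f"
  shows "Div_x (\<lambda>y. f y *\<^sub>R sym_otimes a b) z = dird (b, 0) f z *\<^sub>R a + dird (a, 0) f z *\<^sub>R b"
proof -
  have "(\<lambda>y. f y *\<^sub>R sym_otimes a b) = (\<lambda>y. f y *\<^sub>R otimes a b + f y *\<^sub>R otimes b a)"
    by (simp add: sym_otimes_def scaleR_add_right)
  then show ?thesis using assms by (simp add: Div_x_add smooth_scaleR Div_x_otimes)
qed

text \<open>The space-time operators \<open>A = (e,0) \<partial>\<^sub>\<xi> - (\<xi>,0) \<partial>\<^sub>e\<close> and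
  \<open>B = (m,1) \<partial>\<^sub>\<xi> - (\<xi>,0) \<partial>\<^sub>h\<close>, with \<open>h = (m,1)\<close>, are antisymmetric, hence
  divergence-free. So the symmetric matrix \<open>(A \<otimes> B + B \<otimes> A) \<phi>\<close> is divergence-free;
  its time column is \<open>(wave_v, 0)\<close>, since \<open>A\<close> has no time component, and its space block is
  \<open>wave_W\<close>.\<close>

definition wave_v :: "real ^ 'n \<Rightarrow> real ^ 'n \<Rightarrow> ('n::finite spacetime \<Rightarrow> real) \<Rightarrow> 'n spacetime \<Rightarrow> real ^ 'n"
  where "wave_v e \<xi> \<phi> z =
    dird (\<xi>, 0) (dird (\<xi>, 0) \<phi>) z *\<^sub>R e - dird (\<xi>, 0) (dird (e, 0) \<phi>) z *\<^sub>R \<xi>"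

definition wave_W :: "real ^ 'n \<Rightarrow> real ^ 'n \<Rightarrow> real ^ 'n \<Rightarrow> ('n::finite spacetime \<Rightarrow> real) \<Rightarrow> 'n spacetime \<Rightarrow> real ^ 'n ^ 'n"
  where "wave_W e m \<xi> \<phi> z =
    dird (\<xi>, 0) (dird (\<xi>, 0) \<phi>) z *\<^sub>R sym_otimes e m - dird (\<xi>, 0) (dird (m, 1) \<phi>) z *\<^sub>R sym_otimes e \<xi>
    - dird (\<xi>, 0) (dird (e, 0) \<phi>) z *\<^sub>R sym_otimes \<xi> m + dird (e, 0) (dird (m, 1) \<phi>) z *\<^sub>R sym_otimes \<xi> \<xi>"

lemma Cc_infty_wave:
  assumes "Cc_infty S \<phi>" shows "Cc_infty S (wave_v e \<xi> \<phi>)" "Cc_infty S (wave_W e m \<xi> \<phi>)"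
  unfolding wave_v_def[abs_def] wave_W_def[abs_def]
  using assms by (intro Cc_infty_add Cc_infty_diff Cc_infty_scaleR Cc_infty_dird smooth_const; assumption)+

lemma wave_div_free:
  assumes "smooth \<phi>" shows "div_x (wave_v e \<xi> \<phi>) z = 0"
proof -
  have "div_x (wave_v e \<xi> \<phi>) z = dird (e, 0) (dird (\<xi>, 0) (dird (\<xi>, 0) \<phi>)) z - dird (\<xi>, 0) (dird (\<xi>, 0) (dird (e, 0) \<phi>)) z"
    unfolding wave_v_def[abs_def] using assms
    by (subst div_x_diff) (auto simp: div_x_scaleR smooth_dird intro!: smooth_scaleR)
  also have "dird (\<xi>, 0) (dird (e, 0) \<phi>) = dird (e, 0) (dird (\<xi>, 0) \<phi>)"
    using dird_commute[OF assms] by blast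
  finally show ?thesis using dird_commute[OF smooth_dird[OF assms]] by simp
qed

lemma transpose_wave_W: "transpose (wave_W e m \<xi> \<phi> z) = wave_W e m \<xi> \<phi> z"
  by (simp add: vec_eq_iff transpose_def wave_W_def sym_otimes_def otimes_def algebra_simps)

lemma wave_equation:
  assumes "smooth \<phi>" shows "dird e_t (wave_v e \<xi> \<phi>) z + Div_x (wave_W e m \<xi> \<phi>) z = 0"
proof -
  let ?X = "(\<xi>, 0::real)" and ?E = "(e, 0::real)" and ?H = "(m, 1::real)" and ?D = "\<lambda>a b c. dird a (dird b (dird c \<phi>)) z"
  have s: "smooth (dird a (dird b \<phi>))" for a b using assms by (intro smooth_dird)
  have c1: "?D a b c = ?D b a c" for a b c using dird_commute[OF smooth_dird[OF assms]] .
  have c2: "?D a b c = ?D a c b" for a b c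
  proof -
    have "dird b (dird c \<phi>) = dird c (dird b \<phi>)" using dird_commute[OF assms] by blast
    then show ?thesis by simp
  qed
  \<comment> \<open>The divergence of \<open>wave_W\<close> involves only the spatial vector
    \<open>m\<close>, while the potentials are built with \<open>(m, 1)\<close>. The difference is a
    time derivative, and these terms cancel that of \<open>wave_v\<close>.\<close>
  have M: "dird (m, 0) f z = dird ?H f z - dird e_t f z" if "smooth f" for f :: "'a spacetime \<Rightarrow> real"
    using linear_diff[OF dird_linear[OF smooth_differentiable[OF that]], of ?H e_t z] by simp
  have W: "Div_x (wave_W e m \<xi> \<phi>) z =
     ((?D ?H ?X ?X - ?D e_t ?X ?X) *\<^sub>R e + ?D ?E ?X ?X *\<^sub>R m) - (?D ?X ?X ?H *\<^sub>R e + ?D ?E ?X ?H *\<^sub>R \<xi>)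
     - ((?D ?H ?X ?E - ?D e_t ?X ?E) *\<^sub>R \<xi> + ?D ?X ?X ?E *\<^sub>R m) + (?D ?X ?E ?H *\<^sub>R \<xi> + ?D ?X ?E ?H *\<^sub>R \<xi>)"
    unfolding wave_W_def[abs_def] M[OF s, symmetric]
    by (subst Div_x_add Div_x_diff, (intro smooth_add smooth_diff smooth_scaleR smooth_const s)+)+
       (simp add: Div_x_sym_otimes[OF s])
  have v: "dird e_t (wave_v e \<xi> \<phi>) z = ?D e_t ?X ?X *\<^sub>R e - ?D e_t ?X ?E *\<^sub>R \<xi>"
    unfolding wave_v_def[abs_def]
    by (subst dird_diff, (intro smooth_differentiable smooth_scaleR smooth_const s)+)
       (simp add: dird_scaleR_const smooth_differentiable s)
  have c: "?D ?X ?X ?H = ?D ?H ?X ?X" "?D ?E ?X ?H = ?D ?X ?E ?H" "?D ?H ?X ?E = ?D ?X ?E ?H" "?D ?X ?X ?E = ?D ?E ?X ?X"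
    using c1 c2 by metis+
  show ?thesis unfolding W v c by (simp add: algebra_simps)
qed

text \<open>The waves are second order in the potential, so the factor
  \<open>1 / \<nu>\<^sup>2\<close> leaves them of unit size while the potential and its first
  derivatives vanish as \<nu> grows.\<close>

definition osc :: "'a::euclidean_space \<Rightarrow> real \<Rightarrow> ('a \<Rightarrow> real) \<Rightarrow> 'a \<Rightarrow> real"
  where "osc \<eta> \<nu> \<theta> z = \<theta> z * (cos (\<nu> * (\<eta> \<bullet> z)) / \<nu>\<^sup>2)"

lemma smooth_linear_phase: "smooth (\<lambda>z. \<nu> * (\<eta> \<bullet> z))"
  by (intro smooth_mult smooth_const smooth_inner smooth_ident)

lemma smooth_cos_phase: "smooth (\<lambda>z. cos (\<nu> * (\<eta> \<bullet> z)) * c)"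
  by (intro smooth_mult smooth_const smooth_compose[OF smooth_cos smooth_linear_phase])

lemma smooth_sin_phase: "smooth (\<lambda>z. sin (\<nu> * (\<eta> \<bullet> z)) * c)"
  by (intro smooth_mult smooth_const smooth_compose[OF smooth_sin smooth_linear_phase])

lemma dird_cos_phase: "dird a (\<lambda>z. cos (\<nu> * (\<eta> \<bullet> z)) * c) = (\<lambda>z. sin (\<nu> * (\<eta> \<bullet> z)) * (- \<nu> * (\<eta> \<bullet> a) * c))"
proof
  fix z :: 'a
  have "((\<lambda>z. cos (\<nu> * (\<eta> \<bullet> z)) * c) has_derivative (\<lambda>h. sin (\<nu> * (\<eta> \<bullet> z)) * (- \<nu> * (\<eta> \<bullet> h) * c))) (at z)"
    by (auto intro!: derivative_eq_intros simp: fun_eq_iff)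
  then show "dird a (\<lambda>z. cos (\<nu> * (\<eta> \<bullet> z)) * c) z = sin (\<nu> * (\<eta> \<bullet> z)) * (- \<nu> * (\<eta> \<bullet> a) * c)"
    by (rule dird_eq)
qed

lemma dird_sin_phase: "dird a (\<lambda>z. sin (\<nu> * (\<eta> \<bullet> z)) * c) = (\<lambda>z. cos (\<nu> * (\<eta> \<bullet> z)) * (\<nu> * (\<eta> \<bullet> a) * c))"
proof
  fix z :: 'a
  have "((\<lambda>z. sin (\<nu> * (\<eta> \<bullet> z)) * c) has_derivative (\<lambda>h. cos (\<nu> * (\<eta> \<bullet> z)) * (\<nu> * (\<eta> \<bullet> h) * c))) (at z)"
    by (auto intro!: derivative_eq_intros simp: fun_eq_iff)
  then show "dird a (\<lambda>z. sin (\<nu> * (\<eta> \<bullet> z)) * c) z = cos (\<nu> * (\<eta> \<bullet> z)) * (\<nu> * (\<eta> \<bullet> a) * c)"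
    by (rule dird_eq)
qed

lemma osc_eq: "osc \<eta> \<nu> \<theta> = (\<lambda>z. \<theta> z * (cos (\<nu> * (\<eta> \<bullet> z)) * (1 / \<nu>\<^sup>2)))"
  by (simp add: osc_def fun_eq_iff)

lemma Cc_infty_osc: "Cc_infty S \<theta> \<Longrightarrow> Cc_infty S (osc \<eta> \<nu> \<theta>)"
  unfolding osc_eq by (intro Cc_infty_mult_left smooth_cos_phase)

lemma dird_osc:
  assumes "smooth \<theta>" "\<nu> \<noteq> 0"
  shows "dird a (osc \<eta> \<nu> \<theta>) = (\<lambda>z. \<theta> z * (sin (\<nu> * (\<eta> \<bullet> z)) * (- (\<eta> \<bullet> a) / \<nu>)) + dird a \<theta> z * (cos (\<nu> * (\<eta> \<bullet> z)) * (1 / \<nu>\<^sup>2)))"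
  unfolding osc_eq dird_mult[OF assms(1) smooth_cos_phase] dird_cos_phase
  using assms(2) by (simp add: power2_eq_square)

lemma dird_dird_osc:
  assumes "smooth \<theta>" "\<nu> \<noteq> 0"
  shows "dird b (dird a (osc \<eta> \<nu> \<theta>)) = (\<lambda>z. - (\<eta> \<bullet> a) * (\<eta> \<bullet> b) * \<theta> z * cos (\<nu> * (\<eta> \<bullet> z))
     - ((\<eta> \<bullet> a) * dird b \<theta> z + (\<eta> \<bullet> b) * dird a \<theta> z) * sin (\<nu> * (\<eta> \<bullet> z)) / \<nu>
     + dird b (dird a \<theta>) z * cos (\<nu> * (\<eta> \<bullet> z)) / \<nu>\<^sup>2)"
proof
  fix z
  have h: "dird b (dird a (osc \<eta> \<nu> \<theta>)) z = dird b (\<lambda>z. \<theta> z * (sin (\<nu> * (\<eta> \<bullet> z)) * (- (\<eta> \<bullet> a) / \<nu>))) z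
    + dird b (\<lambda>z. dird a \<theta> z * (cos (\<nu> * (\<eta> \<bullet> z)) * (1 / \<nu>\<^sup>2))) z"
    unfolding dird_osc[OF assms]
    by (intro dird_add smooth_differentiable smooth_mult[OF assms(1)] smooth_mult[OF smooth_dird[OF assms(1)]] smooth_cos_phase smooth_sin_phase)
  show "dird b (dird a (osc \<eta> \<nu> \<theta>)) z = - (\<eta> \<bullet> a) * (\<eta> \<bullet> b) * \<theta> z * cos (\<nu> * (\<eta> \<bullet> z))
     - ((\<eta> \<bullet> a) * dird b \<theta> z + (\<eta> \<bullet> b) * dird a \<theta> z) * sin (\<nu> * (\<eta> \<bullet> z)) / \<nu>
     + dird b (dird a \<theta>) z * cos (\<nu> * (\<eta> \<bullet> z)) / \<nu>\<^sup>2"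
    by (rule trans[OF h[unfolded dird_mult[OF assms(1) smooth_sin_phase] dird_mult[OF smooth_dird[OF assms(1)] smooth_cos_phase] dird_cos_phase dird_sin_phase]])
      (use assms(2) in \<open>simp add: power2_eq_square field_simps\<close>)
qed

lemma eventually_le_of_bound_over:
  assumes "\<And>\<nu> z. \<nu> \<ge> 1 \<Longrightarrow> \<bar>f \<nu> z\<bar> \<le> C / \<nu>" "\<delta> > (0::real)"
  shows "\<forall>\<^sub>F \<nu> in at_top. \<forall>z. \<bar>f \<nu> z\<bar> \<le> \<delta>"
proof -
  have "\<forall>\<^sub>F \<nu>::real in at_top. \<nu> \<ge> max 1 (C / \<delta>)" by (rule eventually_ge_at_top)
  then show ?thesis
  proof eventually_elim
    case (elim \<nu>)
    then have "C / \<delta> \<le> \<nu>" "\<nu> \<ge> 1" by auto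
    then have "C / \<nu> \<le> \<delta>" using assms(2) by (simp add: field_simps)
    then show ?case using assms(1)[OF \<open>\<nu> \<ge> 1\<close>] order_trans by blast
  qed
qed

lemma osc_first_small:
  assumes "Cc_infty S \<theta>" "\<delta> > 0"
  shows "\<forall>\<^sub>F \<nu> in at_top. \<forall>z. \<bar>dird a (osc \<eta> \<nu> \<theta>) z\<bar> \<le> \<delta>"
proof -
  obtain A where A: "A > 0" "\<And>z. norm (\<theta> z) \<le> A" using Cc_infty_bounded[OF assms(1)] by blast
  obtain B where B: "B > 0" "\<And>z. norm (dird a \<theta> z) \<le> B" using Cc_infty_bounded[OF Cc_infty_dird[OF assms(1)]] by blast
  show ?thesis
  proof (rule eventually_le_of_bound_over[OF _ assms(2)])
    fix \<nu> :: real and z assume l: "\<nu> \<ge> 1"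
    have "\<bar>\<theta> z * (sin (\<nu> * (\<eta> \<bullet> z)) * (- (\<eta> \<bullet> a) / \<nu>))\<bar> \<le> A * (1 * (\<bar>\<eta> \<bullet> a\<bar> / \<nu>))"
      using l A(2)[of z] A(1) unfolding abs_mult by (intro mult_mono) auto
    moreover have "\<bar>dird a \<theta> z * (cos (\<nu> * (\<eta> \<bullet> z)) * (1 / \<nu>\<^sup>2))\<bar> \<le> B * (1 * (1 / \<nu>))"
      using l B(2)[of z] B(1) unfolding abs_mult
      by (intro mult_mono) (auto simp: power2_eq_square field_simps)
    ultimately show "\<bar>dird a (osc \<eta> \<nu> \<theta>) z\<bar> \<le> (B + A * \<bar>\<eta> \<bullet> a\<bar>) / \<nu>"
      using l by (auto simp: dird_osc[OF Cc_infty_smooth[OF assms(1)]] add_divide_distrib intro!: order_trans[OF abs_triangle_ineq4] add_mono)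
  qed
qed

text \<open>Only the term with both derivatives on the cosine keeps order one, with the minus sign
  of a second derivative of cos. Each derivative falling on \<theta> instead costs a factor
  \<open>1 / \<nu>\<close>, uniformly in \<open>z\<close>.\<close>

lemma osc_second_small:
  assumes "Cc_infty S \<theta>" "\<delta> > 0"
  shows "\<forall>\<^sub>F \<nu> in at_top. \<forall>z. \<bar>dird b (dird a (osc \<eta> \<nu> \<theta>)) z + (\<eta> \<bullet> a) * (\<eta> \<bullet> b) * (\<theta> z * cos (\<nu> * (\<eta> \<bullet> z)))\<bar> \<le> \<delta>"
proof -
  obtain A where A: "A > 0" "\<And>z. norm ((\<eta> \<bullet> a) * dird b \<theta> z + (\<eta> \<bullet> b) * dird a \<theta> z) \<le> A"
    using Cc_infty_bounded[OF Cc_infty_add[OF Cc_infty_mult_right[OF Cc_infty_dird smooth_const]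
        Cc_infty_mult_right[OF Cc_infty_dird smooth_const]], OF assms(1) assms(1)] by blast
  obtain B where B: "B > 0" "\<And>z. norm (dird b (dird a \<theta>) z) \<le> B"
    using Cc_infty_bounded[OF Cc_infty_dird[OF Cc_infty_dird[OF assms(1)]]] by blast
  show ?thesis
  proof (rule eventually_le_of_bound_over[OF _ assms(2)])
    fix \<nu> :: real and z assume l: "\<nu> \<ge> 1"
    have "\<bar>((\<eta> \<bullet> a) * dird b \<theta> z + (\<eta> \<bullet> b) * dird a \<theta> z) * (sin (\<nu> * (\<eta> \<bullet> z)) * (1 / \<nu>))\<bar> \<le> A * (1 * (1 / \<nu>))"
      using l A(2)[of z] A(1) unfolding abs_mult by (intro mult_mono) auto
    moreover have "\<bar>dird b (dird a \<theta>) z * (cos (\<nu> * (\<eta> \<bullet> z)) * (1 / \<nu>\<^sup>2))\<bar> \<le> B * (1 * (1 / \<nu>))"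
      using l B(2)[of z] B(1) unfolding abs_mult
      by (intro mult_mono) (auto simp: power2_eq_square field_simps)
    ultimately show "\<bar>dird b (dird a (osc \<eta> \<nu> \<theta>)) z + (\<eta> \<bullet> a) * (\<eta> \<bullet> b) * (\<theta> z * cos (\<nu> * (\<eta> \<bullet> z)))\<bar> \<le> (B + A) / \<nu>"
      using l by (auto simp: dird_dird_osc[OF Cc_infty_smooth[OF assms(1)]] add_divide_distrib intro!: order_trans[OF abs_triangle_ineq4] add_mono)
  qed
qed

text \<open>Since \<open>\<eta> \<bullet> a = 1\<close>, the cosine is the derivative along
  \<open>a\<close> of the sine divided by \<nu>. One integration by parts moves this derivative to
  \<open>f\<close> and leaves a bound of order \<open>1 / \<nu>\<close>.\<close>

lemma Riemann_Lebesgue_cos: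
  assumes f: "Cc_infty S f" and "\<eta> \<bullet> a = 1" and "\<delta> > 0"
  shows "\<forall>\<^sub>F \<nu> in at_top. \<bar>\<integral>z. f z * cos (\<nu> * (\<eta> \<bullet> z)) \<partial>lborel\<bar> \<le> \<delta>"
proof -
  let ?C = "\<integral>z. \<bar>dird a f z\<bar> \<partial>lborel"
  have int: "integrable lborel (\<lambda>z. dird a f z)" using f by (intro Cc_infty_integrable[of S]) auto
  \<comment> \<open>A dummy variable of type \<open>unit\<close> makes the uniform estimate
    applicable to a single number.\<close>
  have "\<forall>\<^sub>F \<nu> in at_top. \<forall>z::unit. \<bar>\<integral>z. f z * cos (\<nu> * (\<eta> \<bullet> z)) \<partial>lborel\<bar> \<le> \<delta>"
  proof (rule eventually_le_of_bound_over[OF _ assms(3)])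
    fix \<nu> :: real and u :: unit assume l: "\<nu> \<ge> 1"
    let ?g = "\<lambda>z. sin (\<nu> * (\<eta> \<bullet> z)) * (1 / \<nu>)"
    have "dird a ?g = (\<lambda>z. cos (\<nu> * (\<eta> \<bullet> z)))" using dird_sin_phase[of a \<nu> \<eta> "1 / \<nu>"] l assms(2) by simp
    then have "(\<integral>z. f z * cos (\<nu> * (\<eta> \<bullet> z)) \<partial>lborel) = - (\<integral>z. dird a f z * ?g z \<partial>lborel)"
      using integral_by_parts[OF f smooth_sin_phase, of a \<nu> \<eta> "1 / \<nu>"] by simp
    then have "\<bar>\<integral>z. f z * cos (\<nu> * (\<eta> \<bullet> z)) \<partial>lborel\<bar> = \<bar>\<integral>z. dird a f z * ?g z \<partial>lborel\<bar>" by simp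
    also have "\<dots> \<le> (\<integral>z. \<bar>dird a f z * ?g z\<bar> \<partial>lborel)" by (rule integral_abs_bound)
    also have "\<dots> \<le> (\<integral>z. \<bar>dird a f z\<bar> * (1 / \<nu>) \<partial>lborel)"
    proof (rule integral_mono)
      show "integrable lborel (\<lambda>z. \<bar>dird a f z * ?g z\<bar>)"
        using f by (intro integrable_abs Cc_infty_integrable[of S] Cc_infty_mult_left smooth_sin_phase Cc_infty_dird)
      show "integrable lborel (\<lambda>z. \<bar>dird a f z\<bar> * (1 / \<nu>))" using int by simp
      show "\<bar>dird a f z * ?g z\<bar> \<le> \<bar>dird a f z\<bar> * (1 / \<nu>)" for z
        unfolding abs_mult using l by (intro mult_left_mono) (auto simp: field_simps)
    qed
    finally show "\<bar>\<integral>z. f z * cos (\<nu> * (\<eta> \<bullet> z)) \<partial>lborel\<bar> \<le> ?C / \<nu>" by simp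
  qed
  then show ?thesis by simp
qed

text \<open>One of the two derivatives in the wave is integrated by parts onto the fixed field
  \<open>g\<close>. What remains of the potential is a first derivative, which tends uniformly to
  0.\<close>

lemma wave_orthogonal_small:
  assumes \<theta>: "Cc_infty S \<theta>" and g: "Cc_infty T g" and "\<delta> > 0"
  shows "\<forall>\<^sub>F \<nu> in at_top. \<bar>\<integral>z. g z \<bullet> wave_v e \<xi> (osc \<eta> \<nu> \<theta>) z \<partial>lborel\<bar> \<le> \<delta>"
proof -
  let ?X = "(\<xi>, 0::real)" and ?E = "(e, 0::real)"
  define h1 where "h1 = dird ?X (\<lambda>z. g z \<bullet> e)"
  define h2 where "h2 = dird ?X (\<lambda>z. g z \<bullet> \<xi>)"
  have h: "Cc_infty T h1" "Cc_infty T h2"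
    unfolding h1_def h2_def using g by (auto intro!: Cc_infty_dird Cc_infty_inner)
  have sg: "smooth (\<lambda>z. g z \<bullet> a)" for a
    using Cc_infty_smooth[OF Cc_infty_inner[OF g smooth_const]] .
  have hi: "integrable lborel h1" "integrable lborel h2" using h Cc_infty_integrable by auto
  define I where "I = (\<integral>z. \<bar>h1 z\<bar> \<partial>lborel) + (\<integral>z. \<bar>h2 z\<bar> \<partial>lborel)"
  have I: "I \<ge> 0" unfolding I_def by (intro add_nonneg_nonneg integral_nonneg) auto
  define d where "d = \<delta> / (I + 1)"
  have d: "d > 0" "d * I \<le> \<delta>" using I assms(3) unfolding d_def by (auto simp: field_simps)
  show ?thesis
    using osc_first_small[OF \<theta> d(1), of ?X \<eta>] osc_first_small[OF \<theta> d(1), of ?E \<eta>]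
  proof eventually_elim
    case (elim \<nu>)
    let ?\<phi> = "osc \<eta> \<nu> \<theta>"
    have \<phi>: "Cc_infty S ?\<phi>" by (rule Cc_infty_osc[OF \<theta>])
    have ints: "integrable lborel (\<lambda>z. dird a (dird b ?\<phi>) z * (g z \<bullet> c))" "integrable lborel (\<lambda>z. dird a ?\<phi> z * h1 z)"
      "integrable lborel (\<lambda>z. dird a ?\<phi> z * h2 z)" for a b c
      using \<phi> sg h Cc_infty_smooth by (auto intro!: Cc_infty_integrable[of S] Cc_infty_mult_left)
    have "(\<integral>z. g z \<bullet> wave_v e \<xi> ?\<phi> z \<partial>lborel) =
       (\<integral>z. dird ?X (dird ?X ?\<phi>) z * (g z \<bullet> e) - dird ?X (dird ?E ?\<phi>) z * (g z \<bullet> \<xi>) \<partial>lborel)"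
      by (simp add: wave_v_def inner_diff_right)
    also have "\<dots> = (\<integral>z. dird ?X (dird ?X ?\<phi>) z * (g z \<bullet> e) \<partial>lborel) - (\<integral>z. dird ?X (dird ?E ?\<phi>) z * (g z \<bullet> \<xi>) \<partial>lborel)"
      by (intro Bochner_Integration.integral_diff ints)
    also have "\<dots> = - (\<integral>z. dird ?X ?\<phi> z * h1 z \<partial>lborel) + (\<integral>z. dird ?E ?\<phi> z * h2 z \<partial>lborel)"
      unfolding h1_def h2_def by (simp add: integral_by_parts[OF Cc_infty_dird[OF \<phi>] sg])
    finally have eq: "(\<integral>z. g z \<bullet> wave_v e \<xi> ?\<phi> z \<partial>lborel) = - (\<integral>z. dird ?X ?\<phi> z * h1 z \<partial>lborel) + (\<integral>z. dird ?E ?\<phi> z * h2 z \<partial>lborel)" .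
    have bd: "\<bar>\<integral>z. u z * k z \<partial>lborel\<bar> \<le> d * (\<integral>z. \<bar>k z\<bar> \<partial>lborel)"
      if "integrable lborel k" "integrable lborel (\<lambda>z. u z * k z)" "\<forall>z. \<bar>u z\<bar> \<le> d" for u k :: "'a spacetime \<Rightarrow> real"
    proof -
      have "\<bar>\<integral>z. u z * k z \<partial>lborel\<bar> \<le> (\<integral>z. \<bar>u z * k z\<bar> \<partial>lborel)" by (rule integral_abs_bound)
      also have "\<dots> \<le> (\<integral>z. d * \<bar>k z\<bar> \<partial>lborel)"
      proof (rule integral_mono)
        show "integrable lborel (\<lambda>z. \<bar>u z * k z\<bar>)" using that(2) by (rule integrable_abs)
      qed (use that in \<open>auto simp: abs_mult intro!: mult_right_mono\<close>)
      finally show ?thesis by simp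
    qed
    have "\<bar>\<integral>z. g z \<bullet> wave_v e \<xi> ?\<phi> z \<partial>lborel\<bar> \<le> d * I"
      unfolding eq I_def distrib_left
      using bd[OF hi(1) ints(2) elim(1)] bd[OF hi(2) ints(3) elim(2)] by linarith
    then show ?case using d(2) by linarith
  qed
qed

text \<open>The component along \<open>e\<close> suffices: it is close to - \<theta> cos, and cos^2
  has mean 1/2 up to a cosine of doubled frequency, whose integral against
  \<open>\<theta>\<^sup>2\<close> vanishes in the limit.\<close>

lemma wave_energy:
  assumes \<theta>: "Cc_infty S \<theta>" "\<And>z. 0 \<le> \<theta> z" and "norm e = 1" "e \<bullet> \<xi> = 0" "\<xi> \<noteq> 0" "\<eta> \<bullet> (\<xi>, 0) = 1" and "\<delta> > 0"
  shows "\<forall>\<^sub>F \<nu> in at_top. (\<integral>z. (norm (wave_v e \<xi> (osc \<eta> \<nu> \<theta>) z))\<^sup>2 \<partial>lborel) \<ge> (\<integral>z. (\<theta> z)\<^sup>2 \<partial>lborel) / 2 - \<delta>"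
proof -
  let ?X = "(\<xi>, 0::real)"
  define I where "I = (\<integral>z. \<theta> z \<partial>lborel)"
  have I: "I \<ge> 0" unfolding I_def using \<theta>(2) by (intro Bochner_Integration.integral_nonneg) auto
  \<comment> \<open>Half of \<delta> pays for the pointwise error \<open>d\<close>, the other half
    for the cosine of doubled frequency.\<close>
  define d where "d = \<delta> / (4 * (I + 1))"
  have d: "d > 0" "2 * d * I \<le> \<delta> / 2" using I assms(7) unfolding d_def by (auto simp: field_simps)
  have \<theta>2: "Cc_infty S (\<lambda>z. (\<theta> z)\<^sup>2)"
    using \<theta>(1) Cc_infty_smooth unfolding power2_eq_square by (auto intro!: Cc_infty_mult_left)
  \<comment> \<open>The doubled phase has unit slope along half the vector
    \<open>(\<xi>, 0)\<close>, as the Riemann-Lebesgue estimate requires.\<close>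
  have "(2 *\<^sub>R \<eta>) \<bullet> ((1/2) *\<^sub>R ?X) = 1" using assms(6) by (simp del: scaleR_Pair)
  note RL = Riemann_Lebesgue_cos[OF \<theta>2 this, of \<delta>]
  show ?thesis
    using RL[OF assms(7)] osc_second_small[OF \<theta>(1) d(1), of ?X ?X \<eta>]
  proof eventually_elim
    case (elim \<nu>)
    let ?\<phi> = "osc \<eta> \<nu> \<theta>"
    have \<phi>: "Cc_infty S ?\<phi>" by (rule Cc_infty_osc[OF \<theta>(1)])
    let ?c = "\<lambda>z. cos (\<nu> * ((2 *\<^sub>R \<eta>) \<bullet> z))"
    have i1: "integrable lborel (\<lambda>z. (\<theta> z)\<^sup>2)" "integrable lborel \<theta>"
      using \<theta>2 \<theta> Cc_infty_integrable by auto
    have "smooth ?c" using smooth_cos_phase[of \<nu> "2 *\<^sub>R \<eta>" 1] by simp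
    then have i2: "integrable lborel (\<lambda>z. (\<theta> z)\<^sup>2 * ?c z)"
      using \<theta>2 by (intro Cc_infty_integrable[of S] Cc_infty_mult_left)
    have "Cc_infty S (\<lambda>z. wave_v e \<xi> ?\<phi> z \<bullet> wave_v e \<xi> ?\<phi> z)"
      using Cc_infty_wave(1)[OF \<phi>] Cc_infty_smooth by (intro Cc_infty_inner) auto
    then have i3: "integrable lborel (\<lambda>z. (norm (wave_v e \<xi> ?\<phi> z))\<^sup>2)"
      unfolding power2_norm_eq_inner by (rule Cc_infty_integrable)
    have "(\<integral>z. (\<theta> z)\<^sup>2 / 2 + (\<theta> z)\<^sup>2 * ?c z / 2 - 2 * d * \<theta> z \<partial>lborel) \<le> (\<integral>z. (norm (wave_v e \<xi> ?\<phi> z))\<^sup>2 \<partial>lborel)"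
    proof (rule integral_mono)
      show "integrable lborel (\<lambda>z. (\<theta> z)\<^sup>2 / 2 + (\<theta> z)\<^sup>2 * ?c z / 2 - 2 * d * \<theta> z)"
        using i1 i2 by auto
      show "integrable lborel (\<lambda>z. (norm (wave_v e \<xi> ?\<phi> z))\<^sup>2)" by (rule i3)
      fix z
      define x where "x = dird ?X (dird ?X ?\<phi>) z"
      define a where "a = \<theta> z * cos (\<nu> * (\<eta> \<bullet> z))"
      have "wave_v e \<xi> ?\<phi> z \<bullet> e = x"
        using assms(3,4) inner_commute[of e \<xi>] unfolding wave_v_def x_def by (simp add: inner_diff_left norm_eq_1)
      then have "\<bar>x\<bar> \<le> norm (wave_v e \<xi> ?\<phi> z)"
        using Cauchy_Schwarz_ineq2[of "wave_v e \<xi> ?\<phi> z" e] assms(3) by simp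
      then have 1: "x\<^sup>2 \<le> (norm (wave_v e \<xi> ?\<phi> z))\<^sup>2" by (simp add: abs_le_square_iff[symmetric])
      have xa: "\<bar>x + a\<bar> \<le> d" using elim(2)[rule_format, of z] assms(6) unfolding x_def a_def by simp
      have "\<bar>a\<bar> \<le> \<theta> z" unfolding a_def abs_mult using \<theta>(2)[of z] by (simp add: mult_left_le)
      then have "\<bar>a * (x + a)\<bar> \<le> \<theta> z * d" unfolding abs_mult using xa \<theta>(2)[of z] by (intro mult_mono) auto
      moreover have "x\<^sup>2 = a\<^sup>2 - 2 * (a * (x + a)) + (x + a)\<^sup>2" by (simp add: power2_eq_square algebra_simps)
      moreover have "2 * d * \<theta> z = 2 * (\<theta> z * d)" by simp
      ultimately have 2: "a\<^sup>2 - 2 * d * \<theta> z \<le> x\<^sup>2"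
        using zero_le_power2[of "x + a"] by linarith
      have c2: "(cos (\<nu> * (\<eta> \<bullet> z)))\<^sup>2 = (1 + ?c z) / 2"
        using cos_double_cos[of "\<nu> * (\<eta> \<bullet> z)"] by (simp add: mult_ac)
      have "a\<^sup>2 = (\<theta> z)\<^sup>2 / 2 + (\<theta> z)\<^sup>2 * ?c z / 2"
        unfolding a_def power_mult_distrib c2 by (simp add: field_simps)
      then show "(\<theta> z)\<^sup>2 / 2 + (\<theta> z)\<^sup>2 * ?c z / 2 - 2 * d * \<theta> z \<le> (norm (wave_v e \<xi> ?\<phi> z))\<^sup>2"
        using 1 2 by linarith
    qed
    moreover have "(\<integral>z. (\<theta> z)\<^sup>2 / 2 + (\<theta> z)\<^sup>2 * ?c z / 2 - 2 * d * \<theta> z \<partial>lborel)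
      = (\<integral>z. (\<theta> z)\<^sup>2 \<partial>lborel) / 2 + (\<integral>z. (\<theta> z)\<^sup>2 * ?c z \<partial>lborel) / 2 - 2 * d * I"
      unfolding I_def using i1 i2 by simp
    ultimately show ?case using elim(1) d(2) by linarith
  qed
qed

text \<open>The phase is constant along \<open>(e, 0)\<close> and \<open>(m, 1)\<close>, so that only the terms
  with two derivatives along \<open>(\<xi>, 0)\<close> survive as the frequency grows.\<close>

lemma wave_pointwise:
  fixes e m \<xi> :: "real ^ 'n"
  assumes \<theta>: "Cc_infty S \<theta>" and "norm e = 1" "norm \<xi> = 1" "\<eta> \<bullet> (\<xi>, 0) = 1" "\<eta> \<bullet> (e, 0) = 0" "\<eta> \<bullet> (m, 1) = 0"
    and "e \<bullet> m = 0" "e \<bullet> \<xi> = 0" and "\<delta> > 0"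
  shows "\<forall>\<^sub>F \<nu> in at_top. \<forall>z. norm (wave_v e \<xi> (osc \<eta> \<nu> \<theta>) z + (\<theta> z * cos (\<nu> * (\<eta> \<bullet> z))) *\<^sub>R e) \<le> \<delta> \<and>
    norm (wave_W e m \<xi> (osc \<eta> \<nu> \<theta>) z + (\<theta> z * cos (\<nu> * (\<eta> \<bullet> z))) *\<^sub>R sym_otimes e m) \<le> \<delta> \<and>
    \<bar>trace (wave_W e m \<xi> (osc \<eta> \<nu> \<theta>) z)\<bar> \<le> \<delta>"
proof -
  let ?X = "(\<xi>, 0::real)" and ?E = "(e, 0::real)" and ?H = "(m, 1::real)"
  \<comment> \<open>A single constant dominates the coefficients in all three estimates: the
    velocity needs 2, the trace needs 2 plus the last summand, and the matrix needs the four
    norms.\<close>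
  define K where "K = 4 + norm (sym_otimes e m) + norm (sym_otimes e \<xi>) + norm (sym_otimes \<xi> m) + norm (sym_otimes \<xi> \<xi>) + 2 * \<bar>\<xi> \<bullet> m\<bar>"
  have K: "K > 0" unfolding K_def by (auto intro!: add_pos_nonneg)
  define d where "d = \<delta> / K"
  have d: "d > 0" "d * K = \<delta>" using K assms(9) unfolding d_def by auto
  show ?thesis
    using osc_second_small[OF \<theta> d(1), of ?X ?X \<eta>] osc_second_small[OF \<theta> d(1), of ?X ?E \<eta>]
      osc_second_small[OF \<theta> d(1), of ?X ?H \<eta>] osc_second_small[OF \<theta> d(1), of ?E ?H \<eta>]
  proof eventually_elim
    case (elim \<nu>)
    show ?case
    proof
      fix z
      let ?\<phi> = "osc \<eta> \<nu> \<theta>"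
      define c where "c = \<theta> z * cos (\<nu> * (\<eta> \<bullet> z))"
      define xx where "xx = dird ?X (dird ?X ?\<phi>) z"
      define xe where "xe = dird ?X (dird ?E ?\<phi>) z"
      define xh where "xh = dird ?X (dird ?H ?\<phi>) z"
      define eh where "eh = dird ?E (dird ?H ?\<phi>) z"
      have b: "\<bar>xx + c\<bar> \<le> d" "\<bar>xe\<bar> \<le> d" "\<bar>xh\<bar> \<le> d" "\<bar>eh\<bar> \<le> d"
        using elim(1)[rule_format, of z] elim(2)[rule_format, of z] elim(3)[rule_format, of z] elim(4)[rule_format, of z] assms(4-6)
        unfolding xx_def xe_def xh_def eh_def c_def by auto
      have v: "wave_v e \<xi> ?\<phi> z + c *\<^sub>R e = (xx + c) *\<^sub>R e - xe *\<^sub>R \<xi>"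
        unfolding wave_v_def xx_def xe_def by (simp add: algebra_simps)
      have "norm (wave_v e \<xi> ?\<phi> z + c *\<^sub>R e) \<le> \<bar>xx + c\<bar> + \<bar>xe\<bar>"
        unfolding v using norm_triangle_ineq4[of "(xx + c) *\<^sub>R e" "xe *\<^sub>R \<xi>"] assms(2,3) by simp
      also have "\<dots> \<le> d * 2" using b by linarith
      also have "\<dots> \<le> d * K" using d(1) by (intro mult_left_mono) (auto simp: K_def intro!: add_nonneg_nonneg)
      finally have 1: "norm (wave_v e \<xi> ?\<phi> z + c *\<^sub>R e) \<le> \<delta>" unfolding d(2) .
      have W: "wave_W e m \<xi> ?\<phi> z + c *\<^sub>R sym_otimes e m
        = (xx + c) *\<^sub>R sym_otimes e m - xh *\<^sub>R sym_otimes e \<xi> - xe *\<^sub>R sym_otimes \<xi> m + eh *\<^sub>R sym_otimes \<xi> \<xi>"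
        unfolding wave_W_def xx_def xe_def xh_def eh_def by (simp add: algebra_simps)
      have t4: "norm (x - y - u + w) \<le> norm x + norm y + norm u + norm w" for x y u w :: "real ^ 'n ^ 'n"
        using norm_triangle_ineq[of "x - y - u" w] norm_triangle_ineq4[of "x - y" u] norm_triangle_ineq4[of x y] by linarith
      have "norm (wave_W e m \<xi> ?\<phi> z + c *\<^sub>R sym_otimes e m) \<le>
         \<bar>xx + c\<bar> * norm (sym_otimes e m) + \<bar>xh\<bar> * norm (sym_otimes e \<xi>) + \<bar>xe\<bar> * norm (sym_otimes \<xi> m) + \<bar>eh\<bar> * norm (sym_otimes \<xi> \<xi>)"
        unfolding W using t4[of "(xx + c) *\<^sub>R sym_otimes e m" "xh *\<^sub>R sym_otimes e \<xi>" "xe *\<^sub>R sym_otimes \<xi> m" "eh *\<^sub>R sym_otimes \<xi> \<xi>"]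
        by simp
      also have "\<dots> \<le> d * norm (sym_otimes e m) + d * norm (sym_otimes e \<xi>) + d * norm (sym_otimes \<xi> m) + d * norm (sym_otimes \<xi> \<xi>)"
        using b by (intro add_mono mult_right_mono) auto
      also have "\<dots> = d * (norm (sym_otimes e m) + norm (sym_otimes e \<xi>) + norm (sym_otimes \<xi> m) + norm (sym_otimes \<xi> \<xi>))"
        by (simp add: algebra_simps)
      also have "\<dots> \<le> d * K" using d(1) by (intro mult_left_mono) (auto simp: K_def)
      finally have 2: "norm (wave_W e m \<xi> ?\<phi> z + c *\<^sub>R sym_otimes e m) \<le> \<delta>" unfolding d(2) .
      have trs: "trace (s *\<^sub>R sym_otimes a b) = 2 * s * (a \<bullet> b)" for s and a b :: "real ^ 'n"
        unfolding linear_cmul[OF bounded_linear.linear[OF trace_bounded_linear]]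
        by (simp add: sym_otimes_def trace_add trace_otimes inner_commute)
      have "\<xi> \<bullet> \<xi> = 1" using assms(3) by (simp add: norm_eq_1)
      \<comment> \<open>Orthogonality of \<open>e\<close> to \<open>m\<close> and \<xi> removes two
        of the four terms, in particular the one that does not decay. The localized wave is thus
        nearly, but not exactly, trace-free.\<close>
      then have "trace (wave_W e m \<xi> ?\<phi> z) = 2 * eh - 2 * xe * (\<xi> \<bullet> m)"
        unfolding wave_W_def xx_def[symmetric] xe_def[symmetric] xh_def[symmetric] eh_def[symmetric]
        using assms(7,8) by (simp add: trace_add trace_sub trs)
      then have "\<bar>trace (wave_W e m \<xi> ?\<phi> z)\<bar> \<le> 2 * \<bar>eh\<bar> + 2 * \<bar>xe\<bar> * \<bar>\<xi> \<bullet> m\<bar>"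
        using abs_triangle_ineq4[of "2 * eh" "2 * xe * (\<xi> \<bullet> m)"] by (simp add: abs_mult)
      also have "\<dots> \<le> 2 * d + 2 * d * \<bar>\<xi> \<bullet> m\<bar>" using b by (intro add_mono mult_right_mono mult_left_mono) auto
      also have "\<dots> = d * (2 + 2 * \<bar>\<xi> \<bullet> m\<bar>)" by (simp add: algebra_simps)
      also have "\<dots> \<le> d * K" using d(1) by (intro mult_left_mono) (auto simp: K_def intro!: add_nonneg_nonneg)
      finally have 3: "\<bar>trace (wave_W e m \<xi> ?\<phi> z)\<bar> \<le> \<delta>" unfolding d(2) .
      show "norm (wave_v e \<xi> ?\<phi> z + (\<theta> z * cos (\<nu> * (\<eta> \<bullet> z))) *\<^sub>R e) \<le> \<delta> \<and>
        norm (wave_W e m \<xi> ?\<phi> z + (\<theta> z * cos (\<nu> * (\<eta> \<bullet> z))) *\<^sub>R sym_otimes e m) \<le> \<delta> \<and>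
        \<bar>trace (wave_W e m \<xi> ?\<phi> z)\<bar> \<le> \<delta>"
        using 1 2 3 unfolding c_def by blast
    qed
  qed
qed

text \<open>Each requirement holds for all sufficiently high frequencies, and there are finitely
  many of them, so one frequency meets them all.\<close>

lemma localized_wave:
  fixes e m :: "real ^ 'n"
  assumes "CARD('n) \<ge> 2" and \<theta>: "Cc_infty S \<theta>" "\<And>z. 0 \<le> \<theta> z"
    and e: "norm e = 1" "e \<bullet> m = 0" and "\<delta> > 0" "finite G" "\<And>g. g \<in> G \<Longrightarrow> Cc_infty T g"
  obtains w Z where "Cc_infty S w" "Cc_infty S Z" "\<And>z. div_x w z = 0" "\<And>z. dird e_t w z + Div_x Z z = 0"
    "\<And>z. transpose (Z z) = Z z"
    "\<And>z. \<exists>s. \<bar>s\<bar> \<le> \<theta> z \<and> norm (w z - s *\<^sub>R e) \<le> \<delta> \<and> norm (Z z - s *\<^sub>R sym_otimes e m) \<le> \<delta>"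
    "\<And>z. \<bar>trace (Z z)\<bar> \<le> \<delta>" "\<And>g. g \<in> G \<Longrightarrow> \<bar>\<integral>z. g z \<bullet> w z \<partial>lborel\<bar> \<le> \<delta>"
    "(\<integral>z. (norm (w z))\<^sup>2 \<partial>lborel) \<ge> (\<integral>z. (\<theta> z)\<^sup>2 \<partial>lborel) / 2 - \<delta>"
proof -
  have "2 \<le> DIM(real ^ 'n)" using assms(1) by simp
  \<comment> \<open>Dimension at least 2 enters here: the wave must oscillate in a spatial direction
    orthogonal to its velocity \<open>e\<close>.\<close>
  from orthogonal_to_vector_exists[OF this, of e] obtain y where y: "y \<noteq> 0" "orthogonal e y" by blast
  define \<xi> where "\<xi> = y /\<^sub>R norm y"
  have \<xi>: "norm \<xi> = 1" "e \<bullet> \<xi> = 0" "\<xi> \<noteq> 0" using y unfolding \<xi>_def by (auto simp: orthogonal_def)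
  \<comment> \<open>The time frequency is the one for which the phase is constant along
    \<open>(m, 1)\<close>.\<close>
  define \<eta> where "\<eta> = (\<xi>, - (m \<bullet> \<xi>))"
  have \<eta>: "\<eta> \<bullet> (\<xi>, 0) = 1" "\<eta> \<bullet> (e, 0) = 0" "\<eta> \<bullet> (m, 1) = 0"
    unfolding \<eta>_def using \<xi> by (auto simp: norm_eq_1 inner_commute)
  have "\<forall>\<^sub>F \<nu> in at_top. \<forall>g\<in>G. \<bar>\<integral>z. g z \<bullet> wave_v e \<xi> (osc \<eta> \<nu> \<theta>) z \<partial>lborel\<bar> \<le> \<delta>"
    by (rule eventually_ball_finite[OF assms(7)]) (use wave_orthogonal_small[OF \<theta>(1) assms(8) assms(6)] in blast)
  then have "\<forall>\<^sub>F \<nu> in at_top. (\<forall>g\<in>G. \<bar>\<integral>z. g z \<bullet> wave_v e \<xi> (osc \<eta> \<nu> \<theta>) z \<partial>lborel\<bar> \<le> \<delta>) \<and>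
    (\<integral>z. (norm (wave_v e \<xi> (osc \<eta> \<nu> \<theta>) z))\<^sup>2 \<partial>lborel) \<ge> (\<integral>z. (\<theta> z)\<^sup>2 \<partial>lborel) / 2 - \<delta> \<and>
    (\<forall>z. norm (wave_v e \<xi> (osc \<eta> \<nu> \<theta>) z + (\<theta> z * cos (\<nu> * (\<eta> \<bullet> z))) *\<^sub>R e) \<le> \<delta> \<and>
    norm (wave_W e m \<xi> (osc \<eta> \<nu> \<theta>) z + (\<theta> z * cos (\<nu> * (\<eta> \<bullet> z))) *\<^sub>R sym_otimes e m) \<le> \<delta> \<and>
    \<bar>trace (wave_W e m \<xi> (osc \<eta> \<nu> \<theta>) z)\<bar> \<le> \<delta>)" (is "\<forall>\<^sub>F \<nu> in at_top. ?P \<nu>")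
    by (intro eventually_conj wave_energy[OF \<theta> e(1) \<xi>(2,3) \<eta>(1) assms(6)]
       wave_pointwise[OF \<theta>(1) e(1) \<xi>(1) \<eta> e(2) \<xi>(2) assms(6)])
  then obtain \<nu> where "?P \<nu>"
    by (rule exE[OF eventually_happens'[OF trivial_limit_at_top_linorder]])
  then have \<nu>: "\<forall>g\<in>G. \<bar>\<integral>z. g z \<bullet> wave_v e \<xi> (osc \<eta> \<nu> \<theta>) z \<partial>lborel\<bar> \<le> \<delta>"
    "(\<integral>z. (norm (wave_v e \<xi> (osc \<eta> \<nu> \<theta>) z))\<^sup>2 \<partial>lborel) \<ge> (\<integral>z. (\<theta> z)\<^sup>2 \<partial>lborel) / 2 - \<delta>"
    "\<And>z. norm (wave_v e \<xi> (osc \<eta> \<nu> \<theta>) z + (\<theta> z * cos (\<nu> * (\<eta> \<bullet> z))) *\<^sub>R e) \<le> \<delta>"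
    "\<And>z. norm (wave_W e m \<xi> (osc \<eta> \<nu> \<theta>) z + (\<theta> z * cos (\<nu> * (\<eta> \<bullet> z))) *\<^sub>R sym_otimes e m) \<le> \<delta>"
    "\<And>z. \<bar>trace (wave_W e m \<xi> (osc \<eta> \<nu> \<theta>) z)\<bar> \<le> \<delta>"
    by blast+
  have \<phi>: "Cc_infty S (osc \<eta> \<nu> \<theta>)" by (rule Cc_infty_osc[OF \<theta>(1)])
  show ?thesis
  proof (rule that[OF Cc_infty_wave[OF \<phi>]])
    show "\<exists>s. \<bar>s\<bar> \<le> \<theta> z \<and> norm (wave_v e \<xi> (osc \<eta> \<nu> \<theta>) z - s *\<^sub>R e) \<le> \<delta> \<and>
      norm (wave_W e m \<xi> (osc \<eta> \<nu> \<theta>) z - s *\<^sub>R sym_otimes e m) \<le> \<delta>" for z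
      using \<nu>(3)[of z] \<nu>(4)[of z] \<theta>(2)[of z]
      \<comment> \<open>The minus sign is that of the second derivative of the cosine.\<close>
      by (intro exI[of _ "- (\<theta> z * cos (\<nu> * (\<eta> \<bullet> z)))"]) (auto simp: abs_mult mult_left_le)
  qed (use \<nu> wave_div_free[OF Cc_infty_smooth[OF \<phi>]] wave_equation[OF Cc_infty_smooth[OF \<phi>]] transpose_wave_W in auto)
qed

section \<open>Perturbing a subsolution\<close>

text \<open>These are the Euler equations with the matrix v \<otimes> v + p I replaced by an
  independent symmetric \<open>W\<close>. The system is linear, so perturbations can be added; the
  nonlinearity is confined to membership in \<open>subsol\<close>.\<close>

definition lin_sol :: "('n::finite) spacetime set \<Rightarrow> ('n spacetime \<Rightarrow> real ^ 'n) \<Rightarrow> ('n spacetime \<Rightarrow> real ^ 'n ^ 'n) \<Rightarrow> bool"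
  where "lin_sol S v W \<longleftrightarrow> Cc_infty S v \<and> Cc_infty S W \<and> (\<forall>z. div_x v z = 0) \<and>
    (\<forall>z. dird e_t v z + Div_x W z = 0) \<and> (\<forall>z. transpose (W z) = W z)"

lemma lin_sol_smooth: "lin_sol S v W \<Longrightarrow> smooth v" "lin_sol S v W \<Longrightarrow> smooth W"
  unfolding lin_sol_def using Cc_infty_smooth[of S v] Cc_infty_smooth[of S W] by blast+

lemma lin_sol_zero: "lin_sol S (\<lambda>z. 0) (\<lambda>z. 0)"
  unfolding lin_sol_def by (simp add: div_x_def Div_x_def vec_eq_iff transpose_def)

lemma lin_sol_mono: "lin_sol S v W \<Longrightarrow> S \<subseteq> T \<Longrightarrow> lin_sol T v W"
  unfolding lin_sol_def using Cc_infty_mono[of S v T] Cc_infty_mono[of S W T] by blast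

lemma lin_sol_add:
  assumes "lin_sol S v W" "lin_sol S v' W'"
  shows "lin_sol S (\<lambda>z. v z + v' z) (\<lambda>z. W z + W' z)"
proof -
  note s = lin_sol_smooth[OF assms(1)] lin_sol_smooth[OF assms(2)]
  have "dird e_t (\<lambda>z. v z + v' z) z + Div_x (\<lambda>z. W z + W' z) z
    = (dird e_t v z + Div_x W z) + (dird e_t v' z + Div_x W' z)" for z
    using s by (simp add: Div_x_add dird_add smooth_differentiable)
  moreover have "transpose (W z + W' z) = transpose (W z) + transpose (W' z)" for z
    by (simp add: vec_eq_iff transpose_def)
  ultimately show ?thesis using assms s unfolding lin_sol_def
    by (simp add: Cc_infty_add div_x_add)
qed

lemma norm_Pair_triangle: "norm (a, b) \<le> norm a + norm b"
  by (metis norm_Pair real_sqrt_sum_squares_triangle_ineq[of "norm a" 0 0 "norm b"] abs_norm_cancel add.left_neutral add.right_neutral real_sqrt_abs zero_power2)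

definition defect :: "('a \<Rightarrow> 'b::real_normed_vector) \<Rightarrow> 'a \<Rightarrow> real"
  where "defect v z = (1 - (norm (v z))\<^sup>2)\<^sup>2"

text \<open>Here \<open>512 n\<^sup>2 = 2 \<cdot> 16 \<cdot> (4 n)\<^sup>2\<close>: the amplitude is \<open>(1 - |v|\<^sup>2)/(4 n)\<close>,
  the mean of \<open>cos\<^sup>2\<close> is \<open>1/2\<close>, the bump function is at least \<open>1/2\<close> on a ball of a
  quarter of the radius, and two factors 2 are lost to the oscillation of \<open>v\<close> and to error terms.\<close>

definition gain_const :: "('n::finite) itself \<Rightarrow> real"
  where "gain_const _ = 1 / (512 * (real CARD('n))\<^sup>2 * 4 ^ DIM('n spacetime))"

lemma gain_const_pos: "gain_const TYPE('n::finite) > 0"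
  unfolding gain_const_def by simp

lemma defect_bounds:
  assumes "norm (v z) \<le> 1"
  shows "0 \<le> defect v z" "defect v z \<le> 1"
proof -
  have "(norm (v z))\<^sup>2 \<le> 1" using assms by (simp add: power_le_one)
  then show "defect v z \<le> 1" unfolding defect_def by (intro power_le_one) auto
qed (simp add: defect_def)

lemma borel_defect [measurable]:
  fixes v :: "'a::euclidean_space \<Rightarrow> 'b::euclidean_space"
  assumes [measurable]: "v \<in> borel_measurable borel" shows "defect v \<in> borel_measurable borel"
  unfolding defect_def[abs_def] by measurable

lemma integrable_indicator_defect:
  fixes v :: "'a::euclidean_space \<Rightarrow> 'b::euclidean_space"
  assumes [measurable]: "v \<in> borel_measurable borel" and "\<And>z. norm (v z) \<le> 1" and A: "A \<in> sets borel" "bounded A"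
  shows "integrable lborel (\<lambda>z. indicator A z * defect v z)"
proof -
  have "integrable lborel (\<lambda>z. indicator A z *\<^sub>R defect v z)"
  proof (rule integrableI_bounded_set_indicator[where B=1])
    show "AE z in lborel. z \<in> A \<longrightarrow> norm (defect v z) \<le> 1"
      using defect_bounds[of v, OF assms(2)] by auto
    show "emeasure lborel A < \<infinity>" by (rule emeasure_bounded_finite[OF A(2)])
  qed (use A in auto)
  then show ?thesis by simp
qed

text \<open>The energy gain carries no error term, so it adds up exactly over disjoint sets; only
  the trace and the pairings are charged to \<epsilon>. Support in \<open>B\<close> is part of
  \<open>lin_sol B w Z\<close>.\<close>

definition perturbs :: "('n::finite spacetime \<Rightarrow> real ^ 'n) \<Rightarrow> ('n spacetime \<Rightarrow> real ^ 'n ^ 'n) \<Rightarrow> real \<Rightarrow>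
    ('n spacetime \<Rightarrow> real ^ 'n) set \<Rightarrow> 'n spacetime set \<Rightarrow> ('n spacetime \<Rightarrow> real ^ 'n) \<Rightarrow> ('n spacetime \<Rightarrow> real ^ 'n ^ 'n) \<Rightarrow> bool"
  where "perturbs v W \<epsilon> G B w Z \<longleftrightarrow> lin_sol B w Z \<and> (\<forall>z. (v z + w z, W z + Z z) \<in> subsol) \<and>
    (\<forall>z. \<bar>trace (Z z)\<bar> \<le> \<epsilon>) \<and> (\<forall>g\<in>G. \<bar>\<integral>z. g z \<bullet> w z \<partial>lborel\<bar> \<le> \<epsilon>) \<and>
    (\<integral>z. (norm (w z))\<^sup>2 \<partial>lborel) \<ge> gain_const TYPE('n) * (\<integral>z. indicator B z * defect v z \<partial>lborel)"

text \<open>The segment at \<open>z0\<close> is compact in an open set, hence has a tube of radius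
  \<rho> inside it; near \<open>z0\<close> the values of \<open>v\<close> and \<open>W\<close> are
  almost frozen, so a wave along this segment stays in the tube. The radius \<open>r0\<close>
  depends on \<open>z0\<close> only: a covering can be fixed before \<epsilon> is distributed over
  its balls.\<close>

lemma local_perturbation:
  fixes v :: "('n::finite) spacetime \<Rightarrow> real ^ 'n"
  assumes n: "CARD('n) \<ge> 2" and sol: "lin_sol \<Omega> v W" "\<And>z. (v z, W z) \<in> subsol"
  shows "\<exists>r0>0. \<forall>r \<epsilon> G. 0 < r \<and> r < r0 \<and> \<epsilon> > 0 \<and> finite G \<and> (\<forall>g\<in>G. Cc_infty \<Omega> g) \<longrightarrow>
    (\<exists>w Z. perturbs v W \<epsilon> G (ball z0 r) w Z)"
proof -
  define T where "T = 1 - (norm (v z0))\<^sup>2"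
  define \<sigma> where "\<sigma> = T / (4 * real CARD('n))"
  have v1: "norm (v z) < 1" for z using subsol_norm_less_1[OF sol(2)] .
  have T: "T > 0" unfolding T_def using power_strict_mono[OF v1[of z0], of 2] by simp
  have \<sigma>: "\<sigma> > 0" unfolding \<sigma>_def using T by simp
  have sv: "smooth v" "smooth W" using lin_sol_smooth[OF sol(1)] by auto
  have symW: "transpose (W z0) = W z0" using sol(1) unfolding lin_sol_def by blast
  obtain e m where e: "norm e = 1" "e \<bullet> m = 0"
    and seg: "\<And>s. \<bar>s\<bar> \<le> \<sigma> \<Longrightarrow> (v z0 + s *\<^sub>R e, W z0 + s *\<^sub>R sym_otimes e m) \<in> subsol"
    using subsol_segment[OF sol(2) symW] unfolding \<sigma>_def T_def by blast
  define A where "A = (\<lambda>s. (v z0 + s *\<^sub>R e, W z0 + s *\<^sub>R sym_otimes e m)) ` {-\<sigma>..\<sigma>}"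
  have "compact A" unfolding A_def by (intro compact_continuous_image continuous_intros compact_Icc)
  moreover have "A \<subseteq> subsol" unfolding A_def using seg by (auto simp: abs_le_iff)
  ultimately obtain \<rho> where \<rho>: "\<rho> > 0" "(\<Union>x\<in>A. ball x \<rho>) \<subseteq> subsol"
    using compact_subset_open_imp_ball_epsilon_subset[OF _ open_subsol] by metis
  have cont: "isCont v z0" "isCont W z0"
    using smooth_continuous sv by (auto simp: continuous_on_eq_continuous_at)
  obtain r1 where r1: "r1 > 0" "\<And>z. dist z z0 < r1 \<Longrightarrow> dist (v z) (v z0) < \<rho> / 4"
    using cont(1) \<rho>(1) unfolding continuous_at_eps_delta by (metis zero_less_divide_iff zero_less_numeral)
  obtain r2 where r2: "r2 > 0" "\<And>z. dist z z0 < r2 \<Longrightarrow> dist (W z) (W z0) < \<rho> / 4"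
    using cont(2) \<rho>(1) unfolding continuous_at_eps_delta by (metis zero_less_divide_iff zero_less_numeral)
  have "isCont (defect v) z0" unfolding defect_def[abs_def] by (intro continuous_intros cont)
  moreover have "T\<^sup>2 > 0" using T by simp
  \<comment> \<open>The defect at \<open>z0\<close> is \<open>T\<^sup>2\<close>, so oscillation
    below this amount keeps it under twice that value on the ball.\<close>
  ultimately obtain r3 where r3: "r3 > 0" "\<And>z. dist z z0 < r3 \<Longrightarrow> dist (defect v z) (defect v z0) < T\<^sup>2"
    unfolding continuous_at_eps_delta by metis
  define r0 where "r0 = min r1 (min r2 r3)"
  have r0: "r0 > 0" unfolding r0_def using r1 r2 r3 by simp
  have "\<exists>w Z. perturbs v W \<epsilon> G (ball z0 r) w Z"
    if r: "0 < r" "r < r0" and \<epsilon>: "\<epsilon> > 0" and G: "finite G" "\<forall>g\<in>G. Cc_infty \<Omega> g" for r \<epsilon> G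
  proof -
    let ?B = "ball z0 r" and ?N = "DIM('n spacetime)"
    define M where "M = measure lborel ?B"
    have M: "M > 0" unfolding M_def using r content_ball_pos by blast
    \<comment> \<open>On the quarter ball, of measure \<open>M / 4 ^ ?N\<close>, the amplitude is at
      least \<open>\<sigma> / 2\<close>. Half the integral of \<open>\<theta>\<^sup>2\<close> is
      therefore at least \<open>2 * E\<close>, and \<open>E\<close> remains after losing
      \<delta>.\<close>
    define E where "E = \<sigma>\<^sup>2 * M / (16 * 4 ^ ?N)"
    have E: "E > 0" unfolding E_def using \<sigma> M by simp
    \<comment> \<open>Two deviations below \<open>\<rho> / 4\<close>, of \<open>v\<close> and
      \<open>W\<close> from their values at \<open>z0\<close>, and two of at most
      \<open>\<rho> / 5\<close>, of the wave from the segment, add up to less than \<rho>.\<close>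
    define \<delta> where "\<delta> = min \<epsilon> (min (\<rho> / 5) E)"
    have \<delta>: "\<delta> > 0" "\<delta> \<le> \<epsilon>" "\<delta> \<le> \<rho> / 5" "\<delta> \<le> E" unfolding \<delta>_def using \<epsilon> \<rho> E by auto
    obtain f :: "'n spacetime \<Rightarrow> real" where f: "Cc_infty ?B f" "\<And>z. 0 \<le> f z" "\<And>z. f z \<le> 1" "\<And>z. z \<in> ball z0 (r / 4) \<Longrightarrow> f z \<ge> 1 / 2"
      using bump_function[OF r(1), of z0] by blast
    define \<theta> where "\<theta> z = \<sigma> * f z" for z
    have \<theta>: "Cc_infty ?B \<theta>" "\<And>z. 0 \<le> \<theta> z" "\<And>z. \<theta> z \<le> \<sigma>"
      unfolding \<theta>_def[abs_def] using f \<sigma> by (auto intro!: Cc_infty_mult_right mult_left_le)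
    obtain w Z where w: "Cc_infty ?B w" "Cc_infty ?B Z" "\<And>z. div_x w z = 0" "\<And>z. dird e_t w z + Div_x Z z = 0"
      "\<And>z. transpose (Z z) = Z z"
      and near: "\<And>z. \<exists>s. \<bar>s\<bar> \<le> \<theta> z \<and> norm (w z - s *\<^sub>R e) \<le> \<delta> \<and> norm (Z z - s *\<^sub>R sym_otimes e m) \<le> \<delta>"
      and tr: "\<And>z. \<bar>trace (Z z)\<bar> \<le> \<delta>" and orth: "\<And>g. g \<in> G \<Longrightarrow> \<bar>\<integral>z. g z \<bullet> w z \<partial>lborel\<bar> \<le> \<delta>"
      and en: "(\<integral>z. (norm (w z))\<^sup>2 \<partial>lborel) \<ge> (\<integral>z. (\<theta> z)\<^sup>2 \<partial>lborel) / 2 - \<delta>"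
      by (rule localized_wave[OF n \<theta>(1,2) e \<delta>(1) G(1)]) ((rule G(2)[rule_format], assumption), rule that)
    have in_sub: "(v z + w z, W z + Z z) \<in> subsol" for z
    proof (cases "z \<in> ?B")
      case False
      then show ?thesis using sol(2) Cc_infty_outside[OF w(1)] Cc_infty_outside[OF w(2)] by simp
    next
      case True
      then have z: "dist z z0 < r1" "dist z z0 < r2" using r unfolding r0_def by (auto simp: dist_commute)
      obtain s where s: "\<bar>s\<bar> \<le> \<sigma>" "norm (w z - s *\<^sub>R e) \<le> \<delta>" "norm (Z z - s *\<^sub>R sym_otimes e m) \<le> \<delta>"
        using near[of z] \<theta>(3)[of z] by (meson order_trans)
      let ?a = "(v z0 + s *\<^sub>R e, W z0 + s *\<^sub>R sym_otimes e m)"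
      have "norm (v z + w z - (v z0 + s *\<^sub>R e)) \<le> norm (v z - v z0) + norm (w z - s *\<^sub>R e)"
        using norm_triangle_ineq[of "v z - v z0" "w z - s *\<^sub>R e"] by (simp add: algebra_simps)
      moreover have "norm (W z + Z z - (W z0 + s *\<^sub>R sym_otimes e m)) \<le> norm (W z - W z0) + norm (Z z - s *\<^sub>R sym_otimes e m)"
        using norm_triangle_ineq[of "W z - W z0" "Z z - s *\<^sub>R sym_otimes e m"] by (simp add: algebra_simps)
      moreover have "dist (v z + w z, W z + Z z) ?a \<le> norm (v z + w z - (v z0 + s *\<^sub>R e)) + norm (W z + Z z - (W z0 + s *\<^sub>R sym_otimes e m))"
        unfolding dist_norm using norm_Pair_triangle by simp
      ultimately have "dist ?a (v z + w z, W z + Z z) < \<rho>"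
        using r1(2)[OF z(1)] r2(2)[OF z(2)] s(2,3) \<delta>(3) \<rho>(1) unfolding dist_norm[of "v z"] dist_norm[of "W z"]
        by (simp add: dist_commute)
      moreover have "?a \<in> A" unfolding A_def using s(1) by (auto simp: abs_le_iff)
      ultimately show ?thesis using \<rho>(2) by (meson UN_I mem_ball subsetD)
    qed
    have energy: "(\<integral>z. (norm (w z))\<^sup>2 \<partial>lborel) \<ge> gain_const TYPE('n) * (\<integral>z. indicator ?B z * defect v z \<partial>lborel)"
    proof -
      have "measure lborel (ball z0 (r / 4)) = M / 4 ^ ?N"
        unfolding M_def using r content_ball_conv_unit_ball[of "r / 4" z0] content_ball_conv_unit_ball[of r z0]
        by (simp add: power_divide)
      then have "(\<integral>z. \<sigma>\<^sup>2 / 4 * indicator (ball z0 (r / 4)) z \<partial>lborel) = \<sigma>\<^sup>2 / 4 * (M / 4 ^ ?N)"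
        by simp
      moreover have "(\<integral>z. \<sigma>\<^sup>2 / 4 * indicator (ball z0 (r / 4)) z \<partial>lborel) \<le> (\<integral>z. (\<theta> z)\<^sup>2 \<partial>lborel)"
      proof (rule integral_mono)
        show "integrable lborel (\<lambda>z. \<sigma>\<^sup>2 / 4 * indicator (ball z0 (r / 4)) z :: real)"
          using emeasure_bounded_finite[OF bounded_ball, of z0 "r/4"] by (intro integrable_mult_right integrable_real_indicator) auto
        show "integrable lborel (\<lambda>z. (\<theta> z)\<^sup>2)"
          unfolding power2_eq_square using \<theta>(1) Cc_infty_smooth by (intro Cc_infty_integrable[of ?B]) auto
        show "\<sigma>\<^sup>2 / 4 * indicator (ball z0 (r / 4)) z \<le> (\<theta> z)\<^sup>2" for z
        proof (cases "z \<in> ball z0 (r / 4)")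
          case True
          then have "(\<sigma> * (1 / 2))\<^sup>2 \<le> (\<theta> z)\<^sup>2" unfolding \<theta>_def using f(4)[OF True] \<sigma> by (intro power_mono mult_left_mono) auto
          then show ?thesis using True by (simp add: power_mult_distrib power_divide)
        qed simp
      qed
      ultimately have "(\<integral>z. (\<theta> z)\<^sup>2 \<partial>lborel) / 2 \<ge> 2 * E" unfolding E_def by simp
      then have low: "(\<integral>z. (norm (w z))\<^sup>2 \<partial>lborel) \<ge> E" using en \<delta>(4) by linarith
      have meas: "v \<in> borel_measurable borel" using smooth_borel[OF sv(1)] .
      have "(\<integral>z. indicator ?B z * defect v z \<partial>lborel) \<le> (\<integral>z. 2 * T\<^sup>2 * indicator ?B z \<partial>lborel)"
      proof (rule integral_mono)
        show "integrable lborel (\<lambda>z. indicator ?B z * defect v z)"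
          by (intro integrable_indicator_defect meas less_imp_le[OF v1]) auto
        show "integrable lborel (\<lambda>z. 2 * T\<^sup>2 * indicator ?B z :: real)"
          using emeasure_bounded_finite[OF bounded_ball, of z0 r] by (intro integrable_mult_right integrable_real_indicator) auto
        show "indicator ?B z * defect v z \<le> 2 * T\<^sup>2 * indicator ?B z" for z
        proof (cases "z \<in> ?B")
          case True
          then have "dist z z0 < r3" using r unfolding r0_def by (auto simp: dist_commute)
          from r3(2)[OF this] have "defect v z \<le> 2 * T\<^sup>2"
            unfolding dist_real_def defect_def[of v z0] T_def[symmetric] by linarith
          then show ?thesis using True by simp
        qed simp
      qed
      also have "\<dots> = 2 * T\<^sup>2 * M" unfolding M_def by simp
      finally have "gain_const TYPE('n) * (\<integral>z. indicator ?B z * defect v z \<partial>lborel) \<le> gain_const TYPE('n) * (2 * T\<^sup>2 * M)"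
        using gain_const_pos[where 'n='n] by (intro mult_left_mono) auto
      also have "\<dots> = E" unfolding E_def \<sigma>_def gain_const_def by (simp add: power_divide power_mult_distrib field_simps)
      finally show ?thesis using low by linarith
    qed
    have "perturbs v W \<epsilon> G ?B w Z"
      unfolding perturbs_def lin_sol_def
      using w in_sub energy tr orth \<delta>(2) by (meson order_trans)
    then show ?thesis by blast
  qed
  then show ?thesis using r0 by blast
qed

text \<open>At every point at least one of the two perturbations vanishes. Hence membership in
  \<open>subsol\<close> is inherited pointwise, although this set is not closed under addition, and
  the energies add without cross term.\<close>

lemma perturbs_Un:
  fixes v :: "('n::finite) spacetime \<Rightarrow> real ^ 'n"
  assumes P1: "perturbs v W \<epsilon>1 G A w1 Z1" and P2: "perturbs v W \<epsilon>2 G B w2 Z2" and disj: "A \<inter> B = {}"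
    and G: "\<forall>g\<in>G. Cc_infty \<Omega> g" and v: "smooth v" "\<And>z. norm (v z) \<le> 1"
    and AB: "A \<in> sets borel" "bounded A" "B \<in> sets borel" "bounded B"
  shows "perturbs v W (\<epsilon>1 + \<epsilon>2) G (A \<union> B) (\<lambda>z. w1 z + w2 z) (\<lambda>z. Z1 z + Z2 z)"
proof -
  have l: "lin_sol A w1 Z1" "lin_sol B w2 Z2" using P1 P2 unfolding perturbs_def by auto
  have lin: "lin_sol (A \<union> B) (\<lambda>z. w1 z + w2 z) (\<lambda>z. Z1 z + Z2 z)"
    using l by (intro lin_sol_add) (auto intro: lin_sol_mono)
  have cc: "Cc_infty A w1" "Cc_infty A Z1" "Cc_infty B w2" "Cc_infty B Z2" using l unfolding lin_sol_def by auto
  have zero: "w1 z = 0 \<and> Z1 z = 0 \<or> w2 z = 0 \<and> Z2 z = 0" for z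
    using Cc_infty_outside[OF cc(1), of z] Cc_infty_outside[OF cc(2), of z] Cc_infty_outside[OF cc(3), of z]
      Cc_infty_outside[OF cc(4), of z] disj by blast
  have sub: "(v z + (w1 z + w2 z), W z + (Z1 z + Z2 z)) \<in> subsol" for z
  proof -
    have "(v z + w1 z, W z + Z1 z) \<in> subsol" "(v z + w2 z, W z + Z2 z) \<in> subsol"
      using P1 P2 unfolding perturbs_def by blast+
    then show ?thesis using zero[of z] by auto
  qed
  have tr: "\<bar>trace (Z1 z + Z2 z)\<bar> \<le> \<epsilon>1 + \<epsilon>2" for z
  proof -
    have "\<bar>trace (Z1 z)\<bar> \<le> \<epsilon>1" "\<bar>trace (Z2 z)\<bar> \<le> \<epsilon>2" using P1 P2 unfolding perturbs_def by blast+
    then show ?thesis unfolding trace_add by linarith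
  qed
  have orth: "\<bar>\<integral>z. g z \<bullet> (w1 z + w2 z) \<partial>lborel\<bar> \<le> \<epsilon>1 + \<epsilon>2" if "g \<in> G" for g
  proof -
    have "\<bar>\<integral>z. g z \<bullet> w1 z \<partial>lborel\<bar> \<le> \<epsilon>1" "\<bar>\<integral>z. g z \<bullet> w2 z \<partial>lborel\<bar> \<le> \<epsilon>2"
      using P1 P2 that unfolding perturbs_def by auto
    moreover have "integrable lborel (\<lambda>z. g z \<bullet> w1 z)" "integrable lborel (\<lambda>z. g z \<bullet> w2 z)"
      using G that cc Cc_infty_smooth by (auto intro!: Cc_infty_integrable[of \<Omega>])
    ultimately show ?thesis by (simp add: inner_add_right)
  qed
  have i: "integrable lborel (\<lambda>z. (norm (w1 z))\<^sup>2)" "integrable lborel (\<lambda>z. (norm (w2 z))\<^sup>2)"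
    unfolding power2_norm_eq_inner using cc Cc_infty_smooth by (auto intro!: Cc_infty_integrable Cc_infty_inner)
  have "(\<lambda>z. (norm (w1 z + w2 z))\<^sup>2) = (\<lambda>z. (norm (w1 z))\<^sup>2 + (norm (w2 z))\<^sup>2)"
  proof
    show "(norm (w1 z + w2 z))\<^sup>2 = (norm (w1 z))\<^sup>2 + (norm (w2 z))\<^sup>2" for z using zero[of z] by auto
  qed
  then have e1: "(\<integral>z. (norm (w1 z + w2 z))\<^sup>2 \<partial>lborel) = (\<integral>z. (norm (w1 z))\<^sup>2 \<partial>lborel) + (\<integral>z. (norm (w2 z))\<^sup>2 \<partial>lborel)"
    using i by simp
  have j: "integrable lborel (\<lambda>z. indicator A z * defect v z)" "integrable lborel (\<lambda>z. indicator B z * defect v z)"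
    using AB v by (auto intro!: integrable_indicator_defect smooth_borel)
  have "(\<lambda>z. indicator (A \<union> B) z * defect v z) = (\<lambda>z. indicator A z * defect v z + indicator B z * defect v z)"
    using disj by (auto simp: fun_eq_iff indicator_def)
  then have e2: "(\<integral>z. indicator (A \<union> B) z * defect v z \<partial>lborel)
     = (\<integral>z. indicator A z * defect v z \<partial>lborel) + (\<integral>z. indicator B z * defect v z \<partial>lborel)"
    using j by simp
  have "gain_const TYPE('n) * (\<integral>z. indicator (A \<union> B) z * defect v z \<partial>lborel) \<le> (\<integral>z. (norm (w1 z + w2 z))\<^sup>2 \<partial>lborel)"
    using P1 P2 unfolding e1 e2 distrib_left perturbs_def by (simp add: add_mono)
  then show ?thesis unfolding perturbs_def using lin sub tr orth by blast
qed

text \<open>Every single set admits perturbations for all tolerances, so the allowance \<epsilon> is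
  halved whenever one more set is joined.\<close>

lemma perturbs_finite_Union:
  fixes v :: "('n::finite) spacetime \<Rightarrow> real ^ 'n"
  assumes v: "smooth v" "\<And>z. (v z, W z) \<in> subsol"
    and G: "\<forall>g\<in>G. Cc_infty \<Omega> g" and "finite F"
    and "\<And>i \<epsilon>. i \<in> F \<Longrightarrow> \<epsilon> > 0 \<Longrightarrow> \<exists>w Z. perturbs v W \<epsilon> G (B i) w Z"
    and "\<And>i. i \<in> F \<Longrightarrow> B i \<in> sets borel \<and> bounded (B i)"
    and "pairwise (\<lambda>i j. disjnt (B i) (B j)) F" and "\<epsilon> > 0"
  shows "\<exists>w Z. perturbs v W \<epsilon> G (\<Union>i\<in>F. B i) w Z"
  using assms(4-)
proof (induction F arbitrary: \<epsilon> rule: finite_induct)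
  case empty
  have "perturbs v W \<epsilon> G {} (\<lambda>z. 0) (\<lambda>z. 0)"
    unfolding perturbs_def using empty v(2) lin_sol_zero by (auto simp: trace_def)
  then show ?case by auto
next
  case (insert i F)
  have "\<exists>w Z. perturbs v W (\<epsilon> / 2) G (\<Union>i\<in>F. B i) w Z"
    using insert.prems by (intro insert.IH) (auto simp: pairwise_insert)
  then obtain w1 Z1 where 1: "perturbs v W (\<epsilon> / 2) G (\<Union>i\<in>F. B i) w1 Z1" by blast
  obtain w2 Z2 where 2: "perturbs v W (\<epsilon> / 2) G (B i) w2 Z2"
    using insert.prems(1)[of i "\<epsilon> / 2"] insert.prems(4) by auto
  have "(\<Union>i\<in>F. B i) \<inter> B i = {}"
    using insert.prems(3) insert.hyps(2) unfolding pairwise_insert disjnt_def by blast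
  from perturbs_Un[OF 1 2 this G v(1) less_imp_le[OF subsol_norm_less_1[OF v(2)]]]
  have "perturbs v W (\<epsilon> / 2 + \<epsilon> / 2) G ((\<Union>i\<in>F. B i) \<union> B i) (\<lambda>z. w1 z + w2 z) (\<lambda>z. Z1 z + Z2 z)"
    using insert.prems(2) insert.hyps(1) by (auto intro!: sets.finite_UN)
  moreover have "(\<Union>i\<in>F. B i) \<union> B i = (\<Union>i\<in>insert i F. B i)" by auto
  ultimately show ?case by auto
qed

text \<open>A Vitali family is countable, but only finitely many waves can be added while keeping
  smoothness and compact support. Dominated convergence along the partial unions shows that
  truncation loses arbitrarily little.\<close>

lemma countable_Union_integral_approx:
  fixes h :: "'a::euclidean_space \<Rightarrow> real"
  assumes C: "countable C" and B: "\<And>i. i \<in> C \<Longrightarrow> B i \<in> sets borel"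
    and h: "integrable lborel h" and cover: "AE z in lborel. h z \<noteq> 0 \<longrightarrow> z \<in> (\<Union>i\<in>C. B i)" and "\<epsilon> > 0"
  shows "\<exists>F. finite F \<and> F \<subseteq> C \<and> (\<integral>z. indicator (\<Union>i\<in>F. B i) z * h z \<partial>lborel) > (\<integral>z. h z \<partial>lborel) - \<epsilon>"
proof (cases "C = {}")
  case True
  then have "AE z in lborel. h z = 0" using cover by auto
  then have "(\<integral>z. h z \<partial>lborel) = 0" by (rule integral_eq_zero_AE)
  then show ?thesis using assms(5) by (intro exI[of _ "{}"]) auto
next
  case False
  define c where "c = from_nat_into C"
  have c: "range c = C" unfolding c_def by (rule range_from_nat_into[OF False C])
  define D where "D k = (\<Union>i\<in>c ` {..<k}. B i)" for k :: nat
  have D[measurable]: "D k \<in> sets borel" for k unfolding D_def using B c by (intro sets.finite_UN) auto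
  have hm[measurable]: "h \<in> borel_measurable borel" using h by simp
  have "(\<lambda>k. \<integral>z. indicator (D k) z * h z \<partial>lborel) \<longlonglongrightarrow> (\<integral>z. h z \<partial>lborel)"
  proof (rule integral_dominated_convergence[where w="\<lambda>z. \<bar>h z\<bar>"])
    show "AE z in lborel. (\<lambda>k. indicator (D k) z * h z) \<longlonglongrightarrow> h z"
      using cover
    proof eventually_elim
      case (elim z)
      show ?case
      proof (cases "h z = 0")
        case nz: False
        then obtain k where k: "z \<in> B (c k)" using elim c by auto
        have "\<forall>\<^sub>F j in sequentially. indicator (D j) z * h z = h z"
          using eventually_gt_at_top[of k] by eventually_elim (use k in \<open>auto simp: D_def indicator_def\<close>)
        then show ?thesis by (rule tendsto_eventually)
      qed simp
    qed
    show "AE z in lborel. norm (indicator (D k) z * h z) \<le> \<bar>h z\<bar>" for k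
      by (auto simp: indicator_def)
  qed (use h in auto)
  then have "\<forall>\<^sub>F k in sequentially. (\<integral>z. indicator (D k) z * h z \<partial>lborel) > (\<integral>z. h z \<partial>lborel) - \<epsilon>"
    using assms(5) by (intro order_tendstoD(1)) auto
  then obtain k where "(\<integral>z. indicator (D k) z * h z \<partial>lborel) > (\<integral>z. h z \<partial>lborel) - \<epsilon>"
    using eventually_happens'[OF sequentially_bot] by blast
  then show ?thesis using c unfolding D_def by (intro exI[of _ "c ` {..<k}"]) auto
qed

lemma global_perturbation:
  fixes v :: "('n::finite) spacetime \<Rightarrow> real ^ 'n"
  assumes n: "CARD('n) \<ge> 2" and \<Omega>: "open \<Omega>" "bounded \<Omega>" and sol: "lin_sol \<Omega> v W" "\<And>z. (v z, W z) \<in> subsol"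
    and \<epsilon>: "\<epsilon> > 0" and G: "finite G" "\<forall>g\<in>G. Cc_infty \<Omega> g"
  obtains w Z where "lin_sol \<Omega> w Z" "\<And>z. (v z + w z, W z + Z z) \<in> subsol" "\<And>z. \<bar>trace (Z z)\<bar> \<le> \<epsilon>"
    "\<And>g. g \<in> G \<Longrightarrow> \<bar>\<integral>z. g z \<bullet> w z \<partial>lborel\<bar> \<le> \<epsilon>"
    "(\<integral>z. (norm (w z))\<^sup>2 \<partial>lborel) \<ge> gain_const TYPE('n) * (\<integral>z. indicator \<Omega> z * defect v z \<partial>lborel) - \<epsilon>"
proof -
  let ?\<kappa> = "gain_const TYPE('n)"
  obtain r0 where r0: "\<And>z. r0 z > 0" and loc: "\<And>z r \<epsilon> G. 0 < r \<Longrightarrow> r < r0 z \<Longrightarrow> \<epsilon> > 0 \<Longrightarrow> finite G \<Longrightarrow> \<forall>g\<in>G. Cc_infty \<Omega> g \<Longrightarrow>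
    \<exists>w Z. perturbs v W \<epsilon> G (ball z r) w Z"
    using local_perturbation[OF n sol] by metis
  \<comment> \<open>All balls inside \<Omega> that are small enough for the local construction: they
    cover \<Omega> finely, as the Vitali theorem demands.\<close>
  define K where "K = {(z, r). z \<in> \<Omega> \<and> 0 < r \<and> r < r0 z \<and> ball z r \<subseteq> \<Omega>}"
  have "\<exists>i. i \<in> K \<and> z \<in> ball (fst i) (snd i) \<and> snd i < d" if z: "z \<in> \<Omega>" and d: "0 < d" for z d
  proof -
    obtain t where t: "t > 0" "ball z t \<subseteq> \<Omega>" using \<Omega>(1) z open_contains_ball by blast
    define r where "r = min t (min d (r0 z)) / 2"
    have "r > 0" "r < t" "r < d" "r < r0 z" unfolding r_def using t d r0[of z] by auto
    moreover from this have "ball z r \<subseteq> \<Omega>" using t by (meson less_imp_le order_trans subset_ball)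
    ultimately show ?thesis using z unfolding K_def by (intro exI[of _ "(z, r)"]) auto
  qed
  then obtain C where C: "countable C" "C \<subseteq> K" "pairwise (\<lambda>i j. disjnt (ball (fst i) (snd i)) (ball (fst j) (snd j))) C"
    "negligible (\<Omega> - (\<Union>i\<in>C. ball (fst i) (snd i)))"
    using Vitali_covering_theorem_balls[of \<Omega> K fst snd] by blast
  let ?B = "\<lambda>i::'n spacetime \<times> real. ball (fst i) (snd i)" and ?h = "\<lambda>z. indicator \<Omega> z * defect v z"
  \<comment> \<open>Negligibility refers to the completed measure; for a Borel set it gives a null
    set of \<open>lborel\<close>.\<close>
  have "\<Omega> - (\<Union>i\<in>C. ?B i) \<in> sets borel" using \<Omega>(1) by (intro sets.Diff borel_open open_UN) auto
  then have "\<Omega> - (\<Union>i\<in>C. ?B i) \<in> null_sets lborel"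
    using C(4) unfolding negligible_iff_null_sets by (simp add: null_sets_completion_iff)
  then have "AE z in lborel. z \<notin> \<Omega> - (\<Union>i\<in>C. ?B i)" by (rule AE_not_in)
  then have ae: "AE z in lborel. ?h z \<noteq> 0 \<longrightarrow> z \<in> (\<Union>i\<in>C. ?B i)" by eventually_elim (auto simp: indicator_def)
  have sv: "smooth v" using lin_sol_smooth[OF sol(1)] by blast
  have v1: "norm (v z) \<le> 1" for z using subsol_norm_less_1[OF sol(2)] less_imp_le by blast
  have hi: "integrable lborel ?h"
    using \<Omega> by (intro integrable_indicator_defect smooth_borel sv v1) auto
  \<comment> \<open>The loss in the integral is later multiplied by the gain constant, hence the
    division.\<close>
  have "\<epsilon> / ?\<kappa> > 0" using \<epsilon> gain_const_pos[where 'n='n] by simp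
  from countable_Union_integral_approx[OF C(1) _ hi ae this]
  obtain F where F: "finite F" "F \<subseteq> C" "(\<integral>z. indicator (\<Union>i\<in>F. ?B i) z * ?h z \<partial>lborel) > (\<integral>z. ?h z \<partial>lborel) - \<epsilon> / ?\<kappa>"
    by auto
  have "F \<subseteq> K" using F C by auto
  have "\<exists>w Z. perturbs v W \<epsilon> G (\<Union>i\<in>F. ?B i) w Z"
  proof (rule perturbs_finite_Union[OF sv sol(2) G(2) F(1) _ _ _ \<epsilon>])
    show "pairwise (\<lambda>i j. disjnt (?B i) (?B j)) F" using C(3) F(2) pairwise_subset by blast
    show "\<exists>w Z. perturbs v W \<epsilon>' G (?B i) w Z" if "i \<in> F" "\<epsilon>' > 0" for i \<epsilon>'
      using that \<open>F \<subseteq> K\<close> G unfolding K_def by (intro loc) auto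
  qed auto
  then obtain w Z where P: "perturbs v W \<epsilon> G (\<Union>i\<in>F. ?B i) w Z" by blast
  have sub: "(\<Union>i\<in>F. ?B i) \<subseteq> \<Omega>"
  proof (rule UN_least)
    show "?B i \<subseteq> \<Omega>" if "i \<in> F" for i
      using that \<open>F \<subseteq> K\<close> unfolding K_def by (cases i) auto
  qed
  have "(\<lambda>z. indicator (\<Union>i\<in>F. ?B i) z * ?h z) = (\<lambda>z. indicator (\<Union>i\<in>F. ?B i) z * defect v z)"
  proof
    show "indicator (\<Union>i\<in>F. ?B i) z * ?h z = indicator (\<Union>i\<in>F. ?B i) z * defect v z" for z
    proof (cases "z \<in> (\<Union>i\<in>F. ?B i)")
      case True
      then have "z \<in> \<Omega>" using sub by blast
      then show ?thesis by simp
    next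
      case False
      then show ?thesis by (simp del: UN_iff)
    qed
  qed
  then have "?\<kappa> * (\<integral>z. indicator (\<Union>i\<in>F. ?B i) z * defect v z \<partial>lborel) \<ge> ?\<kappa> * ((\<integral>z. ?h z \<partial>lborel) - \<epsilon> / ?\<kappa>)"
    using F(3) gain_const_pos[where 'n='n] by (intro mult_left_mono) auto
  then have "(\<integral>z. (norm (w z))\<^sup>2 \<partial>lborel) \<ge> ?\<kappa> * ((\<integral>z. ?h z \<partial>lborel) - \<epsilon> / ?\<kappa>)"
    using P unfolding perturbs_def by (meson order_trans)
  then have "(\<integral>z. (norm (w z))\<^sup>2 \<partial>lborel) \<ge> ?\<kappa> * (\<integral>z. ?h z \<partial>lborel) - \<epsilon>"
    using gain_const_pos[where 'n='n] by (simp add: right_diff_distrib)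
  then show ?thesis using that[of w Z] P lin_sol_mono[OF _ sub] unfolding perturbs_def by blast
qed

section \<open>Iteration\<close>

definition admissible :: "('n::finite) spacetime set \<Rightarrow> ('n spacetime \<Rightarrow> real ^ 'n) \<Rightarrow> ('n spacetime \<Rightarrow> real ^ 'n ^ 'n) \<Rightarrow> bool"
  where "admissible \<Omega> v W \<longleftrightarrow> lin_sol \<Omega> v W \<and> (\<forall>z. (v z, W z) \<in> subsol)"

lemma admissible_Cc: "admissible \<Omega> v W \<Longrightarrow> Cc_infty \<Omega> v" "admissible \<Omega> v W \<Longrightarrow> Cc_infty \<Omega> W"
  unfolding admissible_def lin_sol_def by auto

lemma admissible_norm_le: "admissible \<Omega> v W \<Longrightarrow> norm (v z) \<le> 1"
  unfolding admissible_def using subsol_norm_less_1 less_imp_le by blast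

lemma Cc_infty_integrable_inner:
  assumes "Cc_infty S f" "Cc_infty T g" shows "integrable lborel (\<lambda>z. f z \<bullet> g z)"
  using assms Cc_infty_smooth by (intro Cc_infty_integrable[of S] Cc_infty_inner) auto

lemma Cc_infty_integrable_norm2:
  fixes f :: "'a::euclidean_space \<Rightarrow> 'b::euclidean_space"
  shows "Cc_infty S f \<Longrightarrow> integrable lborel (\<lambda>z. (norm (f z))\<^sup>2)"
  unfolding power2_norm_eq_inner by (rule Cc_infty_integrable_inner)

definition total_defect :: "('n::finite) spacetime set \<Rightarrow> ('n spacetime \<Rightarrow> real ^ 'n) \<Rightarrow> real"
  where "total_defect \<Omega> v = (\<integral>z. indicator \<Omega> z * defect v z \<partial>lborel)"

text \<open>Dependent choice with tolerance \<open>(1/2) ^ k\<close> at stage \<open>k\<close>. The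
  case \<open>j = k\<close> of the pairing bound controls energy increments, the cases
  \<open>j < k\<close> control distances between remote iterates.\<close>

lemma iteration:
  fixes \<Omega> :: "('n::finite) spacetime set"
  assumes n: "CARD('n) \<ge> 2" and \<Omega>: "open \<Omega>" "bounded \<Omega>"
  obtains v W where "\<And>k. admissible \<Omega> (v k) (W k)" "\<And>z. W 0 z = 0"
    "\<And>k z. \<bar>trace (W (Suc k) z) - trace (W k z)\<bar> \<le> (1/2) ^ k"
    "\<And>j k. j \<le> k \<Longrightarrow> \<bar>\<integral>z. v j z \<bullet> (v (Suc k) z - v k z) \<partial>lborel\<bar> \<le> (1/2) ^ k"
    "\<And>k. (\<integral>z. (norm (v (Suc k) z - v k z))\<^sup>2 \<partial>lborel) \<ge> gain_const TYPE('n) * total_defect \<Omega> (v k) - (1/2) ^ k"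
proof -
  \<comment> \<open>The state carries, besides the current pair, a finite set \<open>G\<close> that
    accumulates all velocities so far, the current one included; these are the fields against which
    the next increment is tested.\<close>
  define P where "P = (\<lambda>(k::nat) (v, W, G). admissible \<Omega> v W \<and> finite G \<and> (\<forall>g\<in>G. Cc_infty \<Omega> g) \<and> v \<in> G
    \<and> (k = 0 \<longrightarrow> (\<forall>z. W z = 0)))"
  define Q where "Q = (\<lambda>(k::nat) (v, W, G) (v' :: 'n spacetime \<Rightarrow> real ^ 'n, W' :: 'n spacetime \<Rightarrow> real ^ 'n ^ 'n, G'). G \<subseteq> G' \<and> (\<forall>z::'n spacetime. \<bar>trace (W' z) - trace (W z :: real ^ 'n ^ 'n)\<bar> \<le> (1/2) ^ k) \<and>
    (\<forall>g\<in>G. \<bar>\<integral>z. g z \<bullet> (v' z - v z) \<partial>lborel\<bar> \<le> (1/2) ^ k) \<and>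
    (\<integral>z. (norm (v' z - v z))\<^sup>2 \<partial>lborel) \<ge> gain_const TYPE('n) * total_defect \<Omega> v - (1/2) ^ k)"
  have "\<exists>f. \<forall>k. P k (f k) \<and> Q k (f k) (f (Suc k))"
  proof (rule dependent_nat_choice)
    have "admissible \<Omega> (\<lambda>z. 0) (\<lambda>z. 0)" unfolding admissible_def using lin_sol_zero zero_in_subsol by blast
    then have "P 0 ((\<lambda>z. 0), (\<lambda>z. 0), {\<lambda>z. 0})" unfolding P_def by auto
    then show "\<exists>x. P 0 x" by blast
  next
    fix x k assume "P k x"
    moreover obtain v W G where x: "x = (v, W, G)" by (cases x) auto
    ultimately have P: "admissible \<Omega> v W" "finite G" "\<forall>g\<in>G. Cc_infty \<Omega> g" "v \<in> G" unfolding P_def by auto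
    have ad: "lin_sol \<Omega> v W" "\<And>z. (v z, W z) \<in> subsol" using P(1) unfolding admissible_def by auto
    have "(1/2::real) ^ k > 0" by simp
    then obtain w Z where w: "lin_sol \<Omega> w Z" "\<And>z. (v z + w z, W z + Z z) \<in> subsol" "\<And>z. \<bar>trace (Z z)\<bar> \<le> (1/2) ^ k"
      "\<And>g. g \<in> G \<Longrightarrow> \<bar>\<integral>z. g z \<bullet> w z \<partial>lborel\<bar> \<le> (1/2) ^ k"
      "(\<integral>z. (norm (w z))\<^sup>2 \<partial>lborel) \<ge> gain_const TYPE('n) * (\<integral>z. indicator \<Omega> z * defect v z \<partial>lborel) - (1/2) ^ k"
      by (rule global_perturbation[OF n \<Omega> ad _ P(2,3)]) (rule that)
    let ?v = "\<lambda>z. v z + w z"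
    have 1: "admissible \<Omega> ?v (\<lambda>z. W z + Z z)"
      unfolding admissible_def using lin_sol_add[OF ad(1) w(1)] w(2) by blast
    have "P (Suc k) (?v, (\<lambda>z. W z + Z z), insert ?v G)"
      unfolding P_def using 1 P admissible_Cc(1)[OF 1] by simp
    moreover have "Q k x (?v, (\<lambda>z. W z + Z z), insert ?v G)"
      unfolding Q_def x using w by (auto simp: trace_add total_defect_def)
    ultimately show "\<exists>y. P (Suc k) y \<and> Q k x y" by blast
  qed
  then obtain f where f: "\<And>k. P k (f k)" "\<And>k. Q k (f k) (f (Suc k))" by blast
  define v where "v k = fst (f k)" for k
  define W where "W k = fst (snd (f k))" for k
  define G where "G k = snd (snd (f k))" for k
  have fk: "f k = (v k, W k, G k)" for k unfolding v_def W_def G_def by simp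
  have P: "admissible \<Omega> (v k) (W k)" "v k \<in> G k" "k = 0 \<longrightarrow> (\<forall>z. W k z = 0)" for k
    using f(1)[of k] unfolding P_def fk by auto
  have Q: "G k \<subseteq> G (Suc k)" "\<forall>z. \<bar>trace (W (Suc k) z) - trace (W k z)\<bar> \<le> (1/2) ^ k"
    "\<forall>g\<in>G k. \<bar>\<integral>z. g z \<bullet> (v (Suc k) z - v k z) \<partial>lborel\<bar> \<le> (1/2) ^ k"
    "(\<integral>z. (norm (v (Suc k) z - v k z))\<^sup>2 \<partial>lborel) \<ge> gain_const TYPE('n) * total_defect \<Omega> (v k) - (1/2) ^ k" for k
    using f(2)[of k] unfolding Q_def fk by auto
  have vG: "v j \<in> G k" if "j \<le> k" for j k
    using lift_Suc_mono_le[of G, OF Q(1) that] P(2)[of j] by blast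
  show ?thesis
  proof (rule that[of v W])
    show "W 0 z = 0" for z using P(3)[of 0] by blast
    show "\<bar>trace (W (Suc k) z) - trace (W k z)\<bar> \<le> (1/2) ^ k" for k z using Q(2)[of k] by blast
    show "\<bar>\<integral>z. v j z \<bullet> (v (Suc k) z - v k z) \<partial>lborel\<bar> \<le> (1/2) ^ k" if "j \<le> k" for j k
      using Q(3)[of k] vG[OF that] by blast
  qed (use P(1) Q(4) in auto)
qed

text \<open>With a free \<open>s\<close>, this bounds an L1 norm on a set of finite measure by the
  squared L2 norm, in place of Cauchy-Schwarz.\<close>

lemma norm_le_AM_GM: "0 < s \<Longrightarrow> norm x \<le> s / 2 + (norm x)\<^sup>2 / (2 * s)"
proof -
  assume s: "0 < s"
  have "0 \<le> (norm x - s)\<^sup>2" by simp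
  then have "2 * s * norm x \<le> s * s + (norm x)\<^sup>2" by (simp add: power2_eq_square algebra_simps)
  then show ?thesis using s by (simp add: field_simps power2_eq_square)
qed

lemma approximating_sequence:
  fixes \<Omega> :: "('n::finite) spacetime set"
  assumes n: "CARD('n) \<ge> 2" and \<Omega>: "open \<Omega>" "bounded \<Omega>"
  obtains v W where "\<And>k. admissible \<Omega> (v k) (W k)" "\<And>k z. \<bar>trace (W k z)\<bar> \<le> 2"
    "\<And>z. convergent (\<lambda>k. trace (W k z))" "AE z in lborel. convergent (\<lambda>k. v k z)"
    "(\<lambda>k. total_defect \<Omega> (v k)) \<longlonglongrightarrow> 0"
proof -
  obtain v W where ad: "\<And>k. admissible \<Omega> (v k) (W k)" and W0: "\<And>z. W 0 z = 0"
    and tr: "\<And>k z. \<bar>trace (W (Suc k) z) - trace (W k z)\<bar> \<le> (1/2) ^ k"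
    and orth: "\<And>j k. j \<le> k \<Longrightarrow> \<bar>\<integral>z. v j z \<bullet> (v (Suc k) z - v k z) \<partial>lborel\<bar> \<le> (1/2) ^ k"
    and gain: "\<And>k. (\<integral>z. (norm (v (Suc k) z - v k z))\<^sup>2 \<partial>lborel) \<ge> gain_const TYPE('n) * total_defect \<Omega> (v k) - (1/2) ^ k"
    by (rule iteration[OF n \<Omega>]) (rule that)
  \<comment> \<open>The right side is the partial sum of the geometric series of increments,
    starting from trace 0.\<close>
  have trb: "\<bar>trace (W k z)\<bar> \<le> 2 - 2 * (1/2) ^ k" for k z
  proof (induction k)
    case 0
    then show ?case using W0 by (simp add: trace_def)
  next
    case (Suc k)
    then show ?case using tr[of k z] by (simp add: abs_le_iff)
  qed
  have trc: "convergent (\<lambda>k. trace (W k z))" for z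
  proof -
    have "summable (\<lambda>k. trace (W (Suc k) z) - trace (W k z))"
      by (rule summable_comparison_test'[where g="\<lambda>k. (1/2) ^ k" and N=0]) (use tr in auto)
    then have "convergent (\<lambda>m. \<Sum>k<m. trace (W (Suc k) z) - trace (W k z))"
      by (simp add: summable_iff_convergent)
    then have "convergent (\<lambda>m. trace (W m z) - trace (W 0 z))" by (simp only: sum_lessThan_telescope[of "\<lambda>k. trace (W k z)"])
    then show ?thesis using W0 by (simp add: trace_def)
  qed
  have cc: "Cc_infty \<Omega> (v k)" for k using admissible_Cc(1)[OF ad] .
  have dcc: "Cc_infty \<Omega> (\<lambda>z. v k z - v l z)" for k l using cc by (intro Cc_infty_diff)
  have v1: "norm (v k z) \<le> 1" for k z using admissible_norm_le[OF ad] .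
  have vout: "v k z = 0" if "z \<notin> \<Omega>" for k z using Cc_infty_outside[OF cc that] .
  define M where "M = measure lborel \<Omega>"
  have fin: "emeasure lborel \<Omega> < \<infinity>" by (rule emeasure_bounded_finite[OF \<Omega>(2)])
  have \<Omega>i: "integrable lborel (\<lambda>z. c * indicator \<Omega> z :: real)" for c
    using fin \<Omega>(1) by (intro integrable_mult_right integrable_real_indicator) auto
  have \<Omega>m: "(\<integral>z. c * indicator \<Omega> z \<partial>lborel) = c * M" for c unfolding M_def using \<Omega>(1) by simp
  define a where "a k = (\<integral>z. (norm (v k z))\<^sup>2 \<partial>lborel)" for k
  define d where "d k l = (\<integral>z. (norm (v k z - v l z))\<^sup>2 \<partial>lborel)" for k l
  have a_le: "a k \<le> M" for k
  proof -
    have "a k \<le> (\<integral>z. 1 * indicator \<Omega> z \<partial>lborel)" unfolding a_def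
    proof (rule integral_mono[OF Cc_infty_integrable_norm2[OF cc] \<Omega>i])
      show "(norm (v k z))\<^sup>2 \<le> 1 * indicator \<Omega> z" for z
        using v1[of k z] vout[of z k] by (cases "z \<in> \<Omega>") (auto simp: power_le_one)
    qed
    then show ?thesis unfolding \<Omega>m by simp
  qed
  have expand: "d l k = a l - a k - 2 * (\<integral>z. v k z \<bullet> (v l z - v k z) \<partial>lborel)" for k l
  proof -
    have "(\<lambda>z. (norm (v l z - v k z))\<^sup>2) = (\<lambda>z. (norm (v l z))\<^sup>2 - (norm (v k z))\<^sup>2 - 2 * (v k z \<bullet> (v l z - v k z)))"
      by (simp add: fun_eq_iff power2_norm_eq_inner inner_diff_left inner_diff_right inner_commute algebra_simps)
    then show ?thesis unfolding d_def a_def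
      using Cc_infty_integrable_norm2[OF cc] Cc_infty_integrable_inner[OF cc dcc] by simp
  qed
  \<comment> \<open>the correction absorbs the cross terms in \<open>expand\<close> and makes the sequence increasing\<close>
  define b where "b k = a k - 4 * (1/2) ^ k" for k
  have step: "d (Suc k) k \<le> b (Suc k) - b k" for k
    using expand[of "Suc k" k] orth[of k k] unfolding b_def by (simp add: abs_le_iff)
  have d0: "d k l \<ge> 0" for k l unfolding d_def by (intro Bochner_Integration.integral_nonneg) auto
  have inc: "incseq b" by (rule incseq_SucI) (use step d0 in \<open>smt (verit)\<close>)
  have bM: "b k \<le> M" for k using a_le[of k] unfolding b_def by (smt (verit) zero_le_power divide_nonneg_nonneg)
  obtain B where B: "b \<longlonglongrightarrow> B" using incseq_convergent[OF inc] bM by blast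
  have dSuc: "(\<lambda>k. d (Suc k) k) \<longlonglongrightarrow> 0"
  proof (rule tendsto_sandwich[OF _ _ tendsto_const])
    show "(\<lambda>k. b (Suc k) - b k) \<longlonglongrightarrow> 0" using tendsto_diff[OF LIMSEQ_Suc[OF B] B] by simp
  qed (use step d0 in auto)
  have half: "(\<lambda>k. (1/2::real) ^ k) \<longlonglongrightarrow> 0" by (rule LIMSEQ_realpow_zero) auto
  let ?\<kappa> = "gain_const TYPE('n)"
  have \<kappa>: "?\<kappa> > 0" by (rule gain_const_pos)
  have F0: "total_defect \<Omega> (v k) \<ge> 0" for k
    unfolding total_defect_def defect_def by (intro Bochner_Integration.integral_nonneg) auto
  have F: "(\<lambda>k. total_defect \<Omega> (v k)) \<longlonglongrightarrow> 0"
  proof (rule tendsto_sandwich[OF _ _ tendsto_const])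
    have "(\<lambda>k. (d (Suc k) k + (1/2) ^ k) / ?\<kappa>) \<longlonglongrightarrow> (0 + 0) / ?\<kappa>"
      using \<kappa> by (intro tendsto_intros dSuc half) auto
    then show "(\<lambda>k. (d (Suc k) k + (1/2) ^ k) / ?\<kappa>) \<longlonglongrightarrow> 0" by simp
    \<comment> \<open>The gain inequality read backwards: increments tending to 0 in L2 leave no
      room for a persistent defect.\<close>
    have "total_defect \<Omega> (v k) \<le> (d (Suc k) k + (1/2) ^ k) / ?\<kappa>" for k
      using gain[of k] \<kappa> unfolding d_def by (simp add: field_simps)
    then show "\<forall>\<^sub>F k in sequentially. total_defect \<Omega> (v k) \<le> (d (Suc k) k + (1/2) ^ k) / ?\<kappa>" by simp
  qed (use F0 in auto)
  \<comment> \<open>The increments from \<open>k\<close> to \<open>k + m\<close> are summed against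
    the fixed velocity \<open>v k\<close>. This is where orthogonality to all earlier velocities is
    required; the bound is the corresponding geometric sum.\<close>
  have inner_low: "(\<integral>z. v k z \<bullet> (v (k + m) z - v k z) \<partial>lborel) \<ge> - (2 * (1/2) ^ k - 2 * (1/2) ^ (k + m))" for k m
  proof (induction m)
    case (Suc m)
    have "(\<lambda>z. v k z \<bullet> (v (k + Suc m) z - v k z))
       = (\<lambda>z. v k z \<bullet> (v (k + m) z - v k z) + v k z \<bullet> (v (Suc (k + m)) z - v (k + m) z))"
      by (simp add: fun_eq_iff inner_diff_right)
    then have "(\<integral>z. v k z \<bullet> (v (k + Suc m) z - v k z) \<partial>lborel)
       = (\<integral>z. v k z \<bullet> (v (k + m) z - v k z) \<partial>lborel) + (\<integral>z. v k z \<bullet> (v (Suc (k + m)) z - v (k + m) z) \<partial>lborel)"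
      using Cc_infty_integrable_inner[OF cc dcc] by simp
    then show ?case using Suc.IH orth[of k "k + m"] by (simp add: abs_le_iff)
  qed simp
  have d_le: "d l k \<le> b l - b k + 4 * (1/2) ^ l" if "k \<le> l" for k l
  proof -
    obtain m where l: "l = k + m" using \<open>k \<le> l\<close> le_Suc_ex by blast
    have "(1/2::real) ^ (k + m) \<ge> 0" by simp
    then show ?thesis using expand[where l=l and k=k] inner_low[of k m] unfolding b_def l by linarith
  qed
  have L1: "\<exists>N. \<forall>i\<ge>N. \<forall>j\<ge>N. (\<integral>z. norm (v i z - v j z) \<partial>lborel) < e" if e: "e > 0" for e
  proof -
    have M0: "M \<ge> 0" unfolding M_def by simp
    \<comment> \<open>Once \<open>d l k < s * e\<close>, both terms of the splitting by
      \<open>norm_le_AM_GM\<close> are at most \<open>e / 2\<close>.\<close>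
    define s where "s = e / (M + 1)"
    have s: "s > 0" "s * M \<le> e" using e M0 unfolding s_def by (auto simp: field_simps)
    have "s * e / 4 > 0" using s e by simp
    then obtain N1 where N1: "\<And>k. k \<ge> N1 \<Longrightarrow> \<bar>b k - B\<bar> < s * e / 4"
      using B unfolding LIMSEQ_iff real_norm_def by blast
    have "s * e / 16 > 0" using s e by simp
    then obtain N2 where N2: "\<And>k. k \<ge> N2 \<Longrightarrow> \<bar>(1/2::real) ^ k - 0\<bar> < s * e / 16"
      using half unfolding LIMSEQ_iff real_norm_def by blast
    have main: "(\<integral>z. norm (v l z - v k z) \<partial>lborel) < e" if "k \<ge> max N1 N2" "k \<le> l" for k l
    proof -
      have "d l k < s * e"
      proof -
        have "\<bar>b k - B\<bar> < s * e / 4" "\<bar>b l - B\<bar> < s * e / 4" "(1/2::real) ^ l < s * e / 16"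
          using N1[of k] N1[of l] N2[of l] that by auto
        then show ?thesis using d_le[OF that(2)] \<open>s * e / 4 > 0\<close> unfolding abs_less_iff by linarith
      qed
      have "(\<integral>z. norm (v l z - v k z) \<partial>lborel) \<le> (\<integral>z. s / 2 * indicator \<Omega> z + (norm (v l z - v k z))\<^sup>2 / (2 * s) \<partial>lborel)"
      proof (rule integral_mono)
        show "integrable lborel (\<lambda>z. norm (v l z - v k z))"
          using Cc_infty_integrable[OF dcc] by (rule integrable_norm)
        show "integrable lborel (\<lambda>z. s / 2 * indicator \<Omega> z + (norm (v l z - v k z))\<^sup>2 / (2 * s))"
          by (intro Bochner_Integration.integrable_add \<Omega>i integrable_divide Cc_infty_integrable_norm2[OF dcc])
        show "norm (v l z - v k z) \<le> s / 2 * indicator \<Omega> z + (norm (v l z - v k z))\<^sup>2 / (2 * s)" for z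
          using norm_le_AM_GM[OF s(1), of "v l z - v k z"] vout[of z] by (cases "z \<in> \<Omega>") auto
      qed
      also have "\<dots> = (s * M) / 2 + d l k / (2 * s)"
        using \<Omega>i \<Omega>m Cc_infty_integrable_norm2[OF dcc] unfolding d_def by simp
      also have "d l k / (2 * s) < (s * e) / (2 * s)" using \<open>d l k < s * e\<close> s(1) by (intro divide_strict_right_mono) auto
      also have "(s * M) / 2 + (s * e) / (2 * s) \<le> e" using s by (simp add: field_simps)
      finally show ?thesis by simp
    qed
    show ?thesis
    proof (intro exI[of _ "max N1 N2"] allI impI)
      fix i j assume "i \<ge> max N1 N2" "j \<ge> max N1 N2"
      then show "(\<integral>z. norm (v i z - v j z) \<partial>lborel) < e"
        using main[of i j] main[of j i] by (cases "i \<le> j") (auto simp: norm_minus_commute)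
    qed
  qed
  obtain r where r: "strict_mono r" "AE z in lborel. Cauchy (\<lambda>i. v (r i) z)"
    using cauchy_L1_AE_cauchy_subseq[of lborel v, OF Cc_infty_integrable[OF cc] L1] by blast
  show ?thesis
  proof (rule that[of "\<lambda>k. v (r k)" "\<lambda>k. W (r k)"])
    show "\<bar>trace (W (r k) z)\<bar> \<le> 2" for k z using trb[of "r k" z] by (smt (verit) zero_le_power divide_nonneg_nonneg)
    show "convergent (\<lambda>k. trace (W (r k) z))" for z
      using convergent_subseq_convergent[OF trc r(1)] by (simp add: o_def)
    show "AE z in lborel. convergent (\<lambda>k. v (r k) z)" using r(2) by (simp add: Cauchy_convergent_iff)
    show "(\<lambda>k. total_defect \<Omega> (v (r k))) \<longlonglongrightarrow> 0"
      using LIMSEQ_subseq_LIMSEQ[OF F r(1)] by (simp add: o_def)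
  qed (rule ad)
qed

section \<open>The Reynolds term and the limit\<close>

lemma Cc_infty_div_x: "Cc_infty S w \<Longrightarrow> Cc_infty S (div_x w)"
  unfolding div_x_def[abs_def] by (intro Cc_infty_sum Cc_infty_dird Cc_infty_vec_nth)

lemma Cc_infty_Div_x: "Cc_infty S M \<Longrightarrow> Cc_infty S (Div_x M)"
  unfolding Div_x_def[abs_def] by (intro Cc_infty_vec_lambda Cc_infty_div_x Cc_infty_vec_nth)

lemma Cc_infty_otimes:
  assumes "Cc_infty S v" shows "Cc_infty S (\<lambda>z. otimes (v z) (v z))"
  unfolding otimes_def using assms Cc_infty_smooth[OF assms]
  by (intro Cc_infty_vec_lambda Cc_infty_mult_left Cc_infty_vec_nth smooth_vec_nth)

lemma Cc_infty_bounded_linear: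
  assumes "bounded_linear T" "Cc_infty S f" shows "Cc_infty S (\<lambda>z. T (f z))"
  by (rule Cc_infty_smooth_comb[OF assms(2) smooth_bounded_linear[OF assms(1) Cc_infty_smooth[OF assms(2)]]])
    (simp add: linear_0[OF bounded_linear.linear[OF assms(1)]])

text \<open>This is the pressure for which \<open>reynolds v W z\<close> is trace-free.\<close>

definition pressure :: "(('n::finite) spacetime \<Rightarrow> real ^ 'n) \<Rightarrow> ('n spacetime \<Rightarrow> real ^ 'n ^ 'n) \<Rightarrow> 'n spacetime \<Rightarrow> real"
  where "pressure v W z = (trace (W z) - (norm (v z))\<^sup>2) * (1 / CARD('n))"

definition reynolds :: "(('n::finite) spacetime \<Rightarrow> real ^ 'n) \<Rightarrow> ('n spacetime \<Rightarrow> real ^ 'n ^ 'n) \<Rightarrow> 'n spacetime \<Rightarrow> real ^ 'n ^ 'n"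
  where "reynolds v W z = otimes (v z) (v z) + pressure v W z *\<^sub>R mat 1 - W z"

lemma Cc_infty_pressure:
  assumes "Cc_infty S v" "Cc_infty S W" shows "Cc_infty S (pressure v W)"
  unfolding pressure_def[abs_def] power2_norm_eq_inner using assms Cc_infty_smooth[OF assms(1)]
  by (intro Cc_infty_mult_left Cc_infty_diff Cc_infty_inner Cc_infty_bounded_linear[OF trace_bounded_linear] smooth_const)

lemma Cc_infty_reynolds:
  assumes "Cc_infty S v" "Cc_infty S W" shows "Cc_infty S (reynolds v W)"
  unfolding reynolds_def[abs_def] using assms
  by (intro Cc_infty_add Cc_infty_diff Cc_infty_otimes Cc_infty_scaleR Cc_infty_pressure smooth_const)

lemma reynolds_entry:
  "reynolds v W z $ i $ j = v z $ i * v z $ j + (if i = j then pressure v W z else 0) - W z $ i $ j"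
  unfolding reynolds_def by (simp add: otimes_def mat_def)

text \<open>With this pressure the Reynolds matrix is (1 - |v|^2)/n times the identity minus the
  matrix of the gap form. Each of the two has entries of size at most 1 - |v|^2.\<close>

lemma reynolds_bound:
  assumes "admissible \<Omega> v W"
  shows "\<bar>reynolds v W z $ i $ j\<bar> \<le> 2 * (1 - (norm (v z))\<^sup>2)"
proof -
  let ?n = "real CARD('a)" and ?T = "1 - (norm (v z))\<^sup>2"
  have U: "(v z, W z) \<in> subsol" and sym: "transpose (W z) = W z"
    using assms unfolding admissible_def lin_sol_def by blast+
  have T: "?T \<ge> 0" using admissible_norm_le[OF assms, of z] by (simp add: power_le_one)
  have "reynolds v W z $ i $ j = (if i = j then ?T * (1 / ?n) else 0) - gap_form (v z) (W z) (axis i 1) (axis j 1)"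
    unfolding reynolds_entry gap_form_axis pressure_def by (simp add: field_simps)
  moreover have "?T * (1 / ?n) \<le> ?T" using T by (intro mult_left_le) auto
  moreover have "0 \<le> ?T * (1 / ?n)" using T by simp
  ultimately obtain c where "reynolds v W z $ i $ j = c - gap_form (v z) (W z) (axis i 1) (axis j 1)" "0 \<le> c" "c \<le> ?T"
    using T by (intro that[of "if i = j then ?T * (1 / ?n) else 0"]) simp_all
  then have "\<bar>reynolds v W z $ i $ j\<bar> \<le> c + \<bar>gap_form (v z) (W z) (axis i 1) (axis j 1)\<bar>"
    using abs_triangle_ineq4[of c "gap_form (v z) (W z) (axis i 1) (axis j 1)"] by simp
  also have "\<dots> \<le> ?T + ?T" by (intro add_mono \<open>c \<le> ?T\<close> gap_form_entry_bound[OF U sym])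
  finally show ?thesis by simp
qed

text \<open>The linear equation is subtracted from the Euler expression, so the force is the
  divergence of a matrix that is small in L2. This yields convergence in the negative norm without
  any bound on derivatives.\<close>

lemma reynolds_force:
  assumes "admissible \<Omega> v W"
  shows "dird e_t v z + Div_x (\<lambda>y. otimes (v y) (v y)) z + grad_x (pressure v W) z = Div_x (reynolds v W) z"
proof -
  note cc = admissible_Cc[OF assms]
  have s: "smooth (\<lambda>y. otimes (v y) (v y))" "smooth (pressure v W)" "smooth W"
    using Cc_infty_smooth Cc_infty_otimes Cc_infty_pressure cc by blast+
  have "Div_x (\<lambda>y. pressure v W y *\<^sub>R mat 1) z = grad_x (pressure v W) z"
    by (simp add: vec_eq_iff Div_x_eq smooth_scaleR s dird_scaleR_const smooth_differentiable grad_x_def mat_def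
      if_distrib sum.delta' cong: if_cong)
  then have "Div_x (reynolds v W) z = Div_x (\<lambda>y. otimes (v y) (v y)) z + grad_x (pressure v W) z - Div_x W z"
    unfolding reynolds_def[abs_def] using s by (simp add: Div_x_diff Div_x_add smooth_add smooth_scaleR)
  moreover have "dird e_t v z + Div_x W z = 0"
    using assms unfolding admissible_def lin_sol_def by blast
  then have "dird e_t v z = - Div_x W z" by (simp add: eq_neg_iff_add_eq_0)
  ultimately show ?thesis by simp
qed

lemma weak_div_x:
  assumes w: "Cc_infty S w" and \<phi>: "smooth \<phi>"
  shows "(\<integral>z. div_x w z * \<phi> z \<partial>lborel) = - (\<Sum>j\<in>UNIV. \<integral>z. w z $ j * dird (e_x j) \<phi> z \<partial>lborel)"
proof -
  have "(\<integral>z. div_x w z * \<phi> z \<partial>lborel) = (\<Sum>j\<in>UNIV. \<integral>z. dird (e_x j) (\<lambda>y. w y $ j) z * \<phi> z \<partial>lborel)"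
    unfolding div_x_def sum_distrib_right using w \<phi>
    by (intro Bochner_Integration.integral_sum Cc_infty_integrable[of S] Cc_infty_mult_left Cc_infty_dird Cc_infty_vec_nth)
  also have "\<dots> = (\<Sum>j\<in>UNIV. - (\<integral>z. w z $ j * dird (e_x j) \<phi> z \<partial>lborel))"
    using integral_by_parts[OF Cc_infty_vec_nth[OF w] \<phi>] by simp
  finally show ?thesis by (simp add: sum_negf)
qed

text \<open>This identity is linear in \<open>(v, W)\<close> and passes to the limit termwise; the
  quadratic term of the Euler equations appears only through the identified limit of
  \<open>W\<close>.\<close>

lemma weak_momentum:
  assumes "lin_sol S v W" and \<phi>: "smooth \<phi>"
  shows "(\<integral>z. v z $ i * dird e_t \<phi> z \<partial>lborel) + (\<Sum>j\<in>UNIV. \<integral>z. W z $ i $ j * dird (e_x j) \<phi> z \<partial>lborel) = 0"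
proof -
  have cc: "Cc_infty S v" "Cc_infty S W" and eq: "\<And>z. dird e_t v z + Div_x W z = 0"
    using assms(1) unfolding lin_sol_def by auto
  have sv: "smooth v" using Cc_infty_smooth[OF cc(1)] .
  have "div_x (\<lambda>y. W y $ i) z = - dird e_t (\<lambda>y. v y $ i) z" for z
    using eq[of z] by (simp add: vec_eq_iff Div_x_def dird_vec_nth smooth_differentiable[OF sv] eq_neg_iff_add_eq_0 add.commute)
  then have "(\<integral>z. div_x (\<lambda>y. W y $ i) z * \<phi> z \<partial>lborel) = - (\<integral>z. dird e_t (\<lambda>y. v y $ i) z * \<phi> z \<partial>lborel)"
    by simp
  then show ?thesis
    using weak_div_x[OF Cc_infty_vec_nth[OF cc(2)] \<phi>, of i] integral_by_parts[OF Cc_infty_vec_nth[OF cc(1)] \<phi>, of e_t i]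
    by simp
qed

section \<open>The Reynolds force in the dual of H^1\<close>

lemma borel_measurable_vec_nth [measurable (raw)]:
  fixes f :: "'a \<Rightarrow> ('b::euclidean_space) ^ 'n"
  assumes "f \<in> borel_measurable M" shows "(\<lambda>x. f x $ i) \<in> borel_measurable M"
  by (rule measurable_compose[OF assms borel_measurable_continuous_onI]) (intro continuous_intros)

lemma Lr2_integrable: "Lr 2 f \<Longrightarrow> f \<in> borel_measurable borel \<and> integrable lborel (\<lambda>z. (norm (f z))\<^sup>2)"
  unfolding Lr_def by simp

lemma Lr_norm_2_power2: "(Lr_norm 2 f)\<^sup>2 = (\<integral>z. (norm (f z))\<^sup>2 \<partial>lborel)"
proof -
  have "(\<integral>z. (norm (f z))\<^sup>2 \<partial>lborel) \<ge> 0" by (intro Bochner_Integration.integral_nonneg) auto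
  then show ?thesis unfolding Lr_norm_def by (simp add: powr_half_sqrt)
qed

lemma abs_mult_AM_GM:
  fixes x y s :: real
  assumes "0 < s" shows "\<bar>x * y\<bar> \<le> s / 2 * x\<^sup>2 + y\<^sup>2 / (2 * s)"
proof -
  have "0 \<le> (s * \<bar>x\<bar> - \<bar>y\<bar>)\<^sup>2" by simp
  then have "2 * s * \<bar>x * y\<bar> \<le> s * s * x\<^sup>2 + y\<^sup>2"
    by (simp add: power2_diff power_mult_distrib abs_mult power2_eq_square algebra_simps)
  then show ?thesis using assms by (simp add: field_simps power2_eq_square)
qed

lemma integrable_mult_L2:
  fixes f g :: "'a::euclidean_space \<Rightarrow> real"
  assumes [measurable]: "f \<in> borel_measurable borel" "g \<in> borel_measurable borel"
    and "integrable lborel (\<lambda>z. (f z)\<^sup>2)" "integrable lborel (\<lambda>z. (g z)\<^sup>2)"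
  shows "integrable lborel (\<lambda>z. f z * g z)"
proof (rule Bochner_Integration.integrable_bound)
  show "integrable lborel (\<lambda>z. (f z)\<^sup>2 + (g z)\<^sup>2)" using assms by simp
  show "AE z in lborel. norm (f z * g z) \<le> norm ((f z)\<^sup>2 + (g z)\<^sup>2)"
  proof (rule AE_I2)
    fix z
    have "\<bar>f z * g z\<bar> \<le> 1 / 2 * (f z)\<^sup>2 + (g z)\<^sup>2 / 2" using abs_mult_AM_GM[of 1 "f z" "g z"] by simp
    then show "norm (f z * g z) \<le> norm ((f z)\<^sup>2 + (g z)\<^sup>2)" by simp
  qed
qed measurable

text \<open>Young's inequality with a free parameter \<open>s\<close> stands in for Cauchy-Schwarz; below \<open>s\<close> is
  chosen of the order of the square root of the total defect.\<close>

lemma Hm1_norm_reynolds: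
  fixes v :: "('n::finite) spacetime \<Rightarrow> real ^ 'n"
  assumes ad: "admissible \<Omega> v W" and \<Omega>: "open \<Omega>" "bounded \<Omega>" and s: "s > 0"
  shows "Hm1_norm (Div_x (reynolds v W)) \<le> ennreal ((real CARD('n))\<^sup>2 * (s / 2 + 2 * total_defect \<Omega> v / s))"
  unfolding Hm1_norm_def
proof (rule Sup_least, clarify)
  fix u :: "'n spacetime \<Rightarrow> real ^ 'n" and g assume H: "H1 u g" "H1_norm u g \<le> 1"
  let ?R = "reynolds v W"
  note cc = admissible_Cc[OF ad]
  have Rc: "Cc_infty \<Omega> ?R" by (rule Cc_infty_reynolds[OF cc])
  have Rij: "Cc_infty \<Omega> (\<lambda>z. ?R z $ i $ j)" for i j by (intro Cc_infty_vec_nth Rc)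
  have um[measurable]: "u \<in> borel_measurable borel" and u2: "integrable lborel (\<lambda>z. (norm (u z))\<^sup>2)"
    using H(1) Lr2_integrable unfolding H1_def by blast+
  have bB: "e_x j \<in> Basis" for j :: 'n by (simp add: Basis_prod_def)
  have aB: "axis i 1 \<in> (Basis :: (real ^ 'n) set)" for i by simp
  have gm[measurable]: "g (e_x j) \<in> borel_measurable borel" and g2: "integrable lborel (\<lambda>z. (norm (g (e_x j) z))\<^sup>2)" for j
    using H(1) Lr2_integrable bB unfolding H1_def by blast+
  have weak: "(\<integral>z. (g (e_x j) z \<bullet> axis i 1) * \<phi> z \<partial>lborel) = - (\<integral>z. (u z \<bullet> axis i 1) * dird (e_x j) \<phi> z \<partial>lborel)"
    if "Cc_infty UNIV \<phi>" for i j \<phi>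
    using H(1) bB aB that unfolding H1_def distr_dird_def by blast
  have comp2: "integrable lborel (\<lambda>z. (f z $ i)\<^sup>2)"
    if [measurable]: "f \<in> borel_measurable borel" and "integrable lborel (\<lambda>z. (norm (f z))\<^sup>2)" for f :: "'n spacetime \<Rightarrow> real ^ 'n" and i
  proof (rule Bochner_Integration.integrable_bound[OF that(2)])
    show "AE z in lborel. norm ((f z $ i)\<^sup>2) \<le> norm ((norm (f z))\<^sup>2)"
      using component_le_norm_cart[of "f _" i] by (auto simp: abs_le_square_iff[symmetric])
  qed measurable
  have gnorm: "(\<integral>z. (norm (g (e_x j) z))\<^sup>2 \<partial>lborel) \<le> 1" for j
  proof -
    have "(Lr_norm 2 (g (e_x j)))\<^sup>2 \<le> (\<Sum>b\<in>Basis. (Lr_norm 2 (g b))\<^sup>2)"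
      using bB[of j] by (intro member_le_sum) auto
    also have "\<dots> \<le> (Lr_norm 2 u)\<^sup>2 + (\<Sum>b\<in>Basis. (Lr_norm 2 (g b))\<^sup>2)" by simp
    also have "\<dots> \<le> 1"
      using H(2) unfolding H1_norm_def by (simp add: real_sqrt_le_1_iff)
    finally show ?thesis unfolding Lr_norm_2_power2 .
  qed
  have R2: "(\<integral>z. (?R z $ i $ j)\<^sup>2 \<partial>lborel) \<le> 4 * total_defect \<Omega> v" and iR2: "integrable lborel (\<lambda>z. (?R z $ i $ j)\<^sup>2)" for i j
  proof -
    show i: "integrable lborel (\<lambda>z. (?R z $ i $ j)\<^sup>2)"
      using Cc_infty_integrable_norm2[OF Rij[of i j]] by simp
    have "smooth v" using cc Cc_infty_smooth by blast
    then have "integrable lborel (\<lambda>z. indicator \<Omega> z * defect v z)"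
      using \<Omega> admissible_norm_le[OF ad] by (intro integrable_indicator_defect smooth_borel) auto
    then have "(\<integral>z. (?R z $ i $ j)\<^sup>2 \<partial>lborel) \<le> (\<integral>z. 4 * (indicator \<Omega> z * defect v z) \<partial>lborel)"
    proof (intro integral_mono[OF i integrable_mult_right])
      fix z
      show "(?R z $ i $ j)\<^sup>2 \<le> 4 * (indicator \<Omega> z * defect v z)"
      proof (cases "z \<in> \<Omega>")
        case True
        have "\<bar>?R z $ i $ j\<bar>\<^sup>2 \<le> (2 * (1 - (norm (v z))\<^sup>2))\<^sup>2"
          using reynolds_bound[OF ad] by (intro power_mono) auto
        moreover have "(2 * (1 - (norm (v z))\<^sup>2))\<^sup>2 = 4 * defect v z"
          unfolding power_mult_distrib defect_def by simp
        ultimately show ?thesis using True by simp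
      next
        case False
        then show ?thesis using Cc_infty_outside[OF Rij] by simp
      qed
    qed
    then show "(\<integral>z. (?R z $ i $ j)\<^sup>2 \<partial>lborel) \<le> 4 * total_defect \<Omega> v" unfolding total_defect_def by simp
  qed
  have dR2: "integrable lborel (\<lambda>z. (dird b (\<lambda>y. ?R y $ i $ j) z)\<^sup>2)" for b i j
    using Cc_infty_integrable_norm2[OF Cc_infty_dird[OF Rij[of i j]]] by simp
  have dRm[measurable]: "dird b (\<lambda>y. ?R y $ i $ j) \<in> borel_measurable borel" for b i j
    using smooth_borel[OF Cc_infty_smooth[OF Cc_infty_dird[OF Rij]]] .
  have Rm[measurable]: "(\<lambda>y. ?R y $ i $ j) \<in> borel_measurable borel" for i j
    using smooth_borel[OF Cc_infty_smooth[OF Rij]] .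
  have entry: "\<bar>\<integral>z. dird (e_x j) (\<lambda>y. ?R y $ i $ j) z * u z $ i \<partial>lborel\<bar> \<le> s / 2 + 2 * total_defect \<Omega> v / s" for i j
  proof -
    \<comment> \<open>An entry of the Reynolds matrix is itself a test function, so the definition
      of the weak derivative moves the derivative onto \<open>u\<close>, and only the L2 norm of the
      entry enters.\<close>
    have "(\<integral>z. dird (e_x j) (\<lambda>y. ?R y $ i $ j) z * u z $ i \<partial>lborel) = - (\<integral>z. g (e_x j) z $ i * ?R z $ i $ j \<partial>lborel)"
      using weak[OF Cc_infty_mono[OF Rij subset_UNIV], of j i i j] by (simp add: inner_axis mult.commute)
    then have "\<bar>\<integral>z. dird (e_x j) (\<lambda>y. ?R y $ i $ j) z * u z $ i \<partial>lborel\<bar> = \<bar>\<integral>z. g (e_x j) z $ i * ?R z $ i $ j \<partial>lborel\<bar>" by simp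
    also have "\<dots> \<le> (\<integral>z. \<bar>g (e_x j) z $ i * ?R z $ i $ j\<bar> \<partial>lborel)" by (rule integral_abs_bound)
    also have "\<dots> \<le> (\<integral>z. s / 2 * (norm (g (e_x j) z))\<^sup>2 + (?R z $ i $ j)\<^sup>2 / (2 * s) \<partial>lborel)"
    proof (rule integral_mono)
      show "integrable lborel (\<lambda>z. \<bar>g (e_x j) z $ i * ?R z $ i $ j\<bar>)"
        by (intro integrable_abs integrable_mult_L2 comp2 gm g2 iR2) measurable
      show "integrable lborel (\<lambda>z. s / 2 * (norm (g (e_x j) z))\<^sup>2 + (?R z $ i $ j)\<^sup>2 / (2 * s))"
        using g2 iR2 by simp
      fix z
      have "(g (e_x j) z $ i)\<^sup>2 \<le> (norm (g (e_x j) z))\<^sup>2"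
        using component_le_norm_cart[of "g (e_x j) z" i] by (simp add: abs_le_square_iff[symmetric])
      then have "s / 2 * (g (e_x j) z $ i)\<^sup>2 \<le> s / 2 * (norm (g (e_x j) z))\<^sup>2" using s by simp
      then show "\<bar>g (e_x j) z $ i * ?R z $ i $ j\<bar> \<le> s / 2 * (norm (g (e_x j) z))\<^sup>2 + (?R z $ i $ j)\<^sup>2 / (2 * s)"
        using abs_mult_AM_GM[OF s, of "g (e_x j) z $ i" "?R z $ i $ j"] by linarith
    qed
    also have "\<dots> = s / 2 * (\<integral>z. (norm (g (e_x j) z))\<^sup>2 \<partial>lborel) + (\<integral>z. (?R z $ i $ j)\<^sup>2 \<partial>lborel) / (2 * s)"
      using g2 iR2 by simp
    also have "\<dots> \<le> s / 2 * 1 + (4 * total_defect \<Omega> v) / (2 * s)"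
      using gnorm[of j] R2[of i j] s by (intro add_mono mult_left_mono divide_right_mono) auto
    finally show ?thesis by simp
  qed
  have int: "integrable lborel (\<lambda>z. dird (e_x j) (\<lambda>y. ?R y $ i $ j) z * u z $ i)" for i j
    by (intro integrable_mult_L2 dR2 comp2 um u2) measurable
  have "(\<integral>z. Div_x ?R z \<bullet> u z \<partial>lborel) = (\<integral>z. (\<Sum>i\<in>UNIV. \<Sum>j\<in>UNIV. dird (e_x j) (\<lambda>y. ?R y $ i $ j) z * u z $ i) \<partial>lborel)"
    by (simp add: inner_vec_def Div_x_def div_x_def sum_distrib_right)
  also have "\<dots> = (\<Sum>i\<in>UNIV. \<Sum>j\<in>UNIV. \<integral>z. dird (e_x j) (\<lambda>y. ?R y $ i $ j) z * u z $ i \<partial>lborel)"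
    using int by (simp add: Bochner_Integration.integral_sum Bochner_Integration.integrable_sum)
  also have "\<bar>\<dots>\<bar> \<le> (\<Sum>i\<in>(UNIV::'n set). \<Sum>j\<in>(UNIV::'n set). s / 2 + 2 * total_defect \<Omega> v / s)"
    by (intro order_trans[OF sum_abs] sum_mono entry)
  also have "\<dots> = (real CARD('n))\<^sup>2 * (s / 2 + 2 * total_defect \<Omega> v / s)"
    by (simp add: power2_eq_square)
  finally show "ennreal \<bar>\<integral>z. Div_x ?R z \<bullet> u z \<partial>lborel\<bar> \<le> ennreal ((real CARD('n))\<^sup>2 * (s / 2 + 2 * total_defect \<Omega> v / s))"
    by (rule ennreal_leI)
qed

lemma total_defect_nonneg: "total_defect \<Omega> v \<ge> 0"
  unfolding total_defect_def defect_def by (intro Bochner_Integration.integral_nonneg) auto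

lemma Hm1_norm_reynolds_tendsto_0:
  fixes v :: "nat \<Rightarrow> ('n::finite) spacetime \<Rightarrow> real ^ 'n"
  assumes ad: "\<And>k. admissible \<Omega> (v k) (W k)" and \<Omega>: "open \<Omega>" "bounded \<Omega>"
    and F: "(\<lambda>k. total_defect \<Omega> (v k)) \<longlonglongrightarrow> 0"
  shows "(\<lambda>k. Hm1_norm (Div_x (reynolds (v k) (W k)))) \<longlonglongrightarrow> 0"
proof -
  \<comment> \<open>The term \<open>1 / real (Suc k)\<close> keeps the Young parameter positive even
    where the defect vanishes, and disappears in the limit.\<close>
  define s where "s k = sqrt (total_defect \<Omega> (v k) + 1 / real (Suc k))" for k
  have pos: "total_defect \<Omega> (v k) + 1 / real (Suc k) > 0" for k
    by (intro add_nonneg_pos total_defect_nonneg) simp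
  have s: "s k > 0" "(s k)\<^sup>2 = total_defect \<Omega> (v k) + 1 / real (Suc k)" for k
    unfolding s_def using pos[of k] by auto
  have s0: "s \<longlonglongrightarrow> 0"
    unfolding s_def using tendsto_real_sqrt[OF tendsto_add[OF F LIMSEQ_Suc[OF lim_1_over_n]]] by simp
  have le: "Hm1_norm (Div_x (reynolds (v k) (W k))) \<le> ennreal ((real CARD('n))\<^sup>2 * (5 / 2 * s k))" for k
  proof -
    have "total_defect \<Omega> (v k) \<le> s k * s k" using s(2)[of k] by (simp add: power2_eq_square)
    then have "total_defect \<Omega> (v k) / s k \<le> s k" using s(1)[of k] by (simp add: pos_divide_le_eq)
    then have "s k / 2 + 2 * total_defect \<Omega> (v k) / s k \<le> 5 / 2 * s k" by simp
    then have "(real CARD('n))\<^sup>2 * (s k / 2 + 2 * total_defect \<Omega> (v k) / s k) \<le> (real CARD('n))\<^sup>2 * (5 / 2 * s k)"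
      by (intro mult_left_mono) auto
    then show ?thesis using Hm1_norm_reynolds[OF ad \<Omega> s(1)] ennreal_leI order_trans by blast
  qed
  have "(\<lambda>k. ennreal ((real CARD('n))\<^sup>2 * (5 / 2 * s k))) \<longlonglongrightarrow> ennreal ((real CARD('n))\<^sup>2 * (5 / 2 * 0))"
    by (intro tendsto_ennrealI tendsto_intros s0)
  then have lim: "(\<lambda>k. ennreal ((real CARD('n))\<^sup>2 * (5 / 2 * s k))) \<longlonglongrightarrow> 0" by simp
  show ?thesis
    by (rule tendsto_sandwich[OF _ _ tendsto_const lim]) (use le in auto)
qed

section \<open>Dominated convergence on a bounded domain\<close>

lemma bounded_convergence:
  fixes u :: "nat \<Rightarrow> 'a::euclidean_space \<Rightarrow> real"
  assumes \<Omega>: "open \<Omega>" "bounded \<Omega>" and "\<And>k. u k \<in> borel_measurable borel" "f \<in> borel_measurable borel"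
    and "\<And>k z. \<bar>u k z\<bar> \<le> C * indicator \<Omega> z" and "AE z in lborel. (\<lambda>k. u k z) \<longlonglongrightarrow> f z"
  shows "(\<lambda>k. \<integral>z. u k z \<partial>lborel) \<longlonglongrightarrow> (\<integral>z. f z \<partial>lborel)" "integrable lborel f"
proof -
  have i: "integrable lborel (\<lambda>z. C * indicator \<Omega> z)"
    using emeasure_bounded_finite[OF \<Omega>(2)] \<Omega>(1) by (intro integrable_mult_right integrable_real_indicator) auto
  show "(\<lambda>k. \<integral>z. u k z \<partial>lborel) \<longlonglongrightarrow> (\<integral>z. f z \<partial>lborel)"
    by (rule integral_dominated_convergence[OF _ _ i]) (use assms in auto)
  show "integrable lborel f"
    by (rule integrable_dominated_convergence[OF _ _ i, where s=u]) (use assms in auto)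
qed

lemma bounded_convergence_Lr:
  fixes u :: "nat \<Rightarrow> 'a::euclidean_space \<Rightarrow> 'b::euclidean_space"
  assumes \<Omega>: "open \<Omega>" "bounded \<Omega>" and [measurable]: "\<And>k. u k \<in> borel_measurable borel" "f \<in> borel_measurable borel"
    and b: "\<And>k z. norm (u k z) \<le> C" "\<And>k z. z \<notin> \<Omega> \<Longrightarrow> u k z = 0" "\<And>z. z \<notin> \<Omega> \<Longrightarrow> f z = 0"
    and "AE z in lborel. norm (f z) \<le> C" "AE z in lborel. (\<lambda>k. u k z) \<longlonglongrightarrow> f z" and r: "r \<ge> 1"
  shows "tendsto_Lr r u f"
proof -
  have C: "C \<ge> 0" using b(1)[of 0 0] norm_ge_zero order_trans by blast
  have i: "integrable lborel (\<lambda>z. c * indicator \<Omega> z)" for c :: real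
    using emeasure_bounded_finite[OF \<Omega>(2)] \<Omega>(1) by (intro integrable_mult_right integrable_real_indicator) auto
  have Lr: "Lr r h" if [measurable]: "h \<in> borel_measurable borel" and "\<And>z. z \<notin> \<Omega> \<Longrightarrow> h z = 0" "AE z in lborel. norm (h z) \<le> C"
    for h :: "'a \<Rightarrow> 'b"
    unfolding Lr_def
  proof
    show "integrable lborel (\<lambda>z. norm (h z) powr r)"
    proof (rule Bochner_Integration.integrable_bound[OF i[of "C powr r"]])
      show "AE z in lborel. norm (norm (h z) powr r) \<le> norm (C powr r * indicator \<Omega> z)"
        using that(3)
      proof eventually_elim
        case (elim z)
        then show ?case using that(2)[of z] r by (cases "z \<in> \<Omega>") (auto intro!: powr_mono2)
      qed
    qed measurable
  qed measurable
  have "(\<lambda>k. \<integral>z. norm (u k z - f z) powr r \<partial>lborel) \<longlonglongrightarrow> integral\<^sup>L lborel (\<lambda>z::'a. 0)"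
  proof (rule integral_dominated_convergence[OF _ _ i[of "(2 * C) powr r"]])
    show "AE z in lborel. (\<lambda>k. norm (u k z - f z) powr r) \<longlonglongrightarrow> 0"
      using assms(9)
    proof eventually_elim
      case (elim z)
      then have "(\<lambda>k. norm (u k z - f z)) \<longlonglongrightarrow> 0" using LIM_zero tendsto_norm_zero by blast
      then show ?case using r by (intro tendsto_zero_powrI[OF _ tendsto_const]) auto
    qed
    show "AE z in lborel. norm (norm (u k z - f z) powr r) \<le> (2 * C) powr r * indicator \<Omega> z" for k
      using assms(8)
    proof eventually_elim
      case (elim z)
      have "norm (u k z - f z) \<le> 2 * C" using norm_triangle_ineq4[of "u k z" "f z"] b(1)[of k z] elim by linarith
      then show ?case using b(2,3)[of z] r by (cases "z \<in> \<Omega>") (auto intro!: powr_mono2)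
    qed
  qed measurable
  then have "(\<lambda>k. Lr_norm r (\<lambda>z. u k z - f z)) \<longlonglongrightarrow> 0"
    unfolding Lr_norm_def using r
    by (intro tendsto_zero_powrI[OF _ tendsto_const]) (auto intro!: always_eventually Bochner_Integration.integral_nonneg)
  then show ?thesis unfolding tendsto_Lr_def using Lr b assms(8) by auto
qed

theorem theorem4p1:
  fixes \<Omega> :: "((real ^ 'n) \<times> real) set"
  assumes "CARD('n) \<ge> 2"
    and "open \<Omega>" and "bounded \<Omega>"
  shows "\<exists>(v :: (real ^ 'n) \<times> real \<Rightarrow> real ^ 'n) (p :: (real ^ 'n) \<times> real \<Rightarrow> real).
    Linf (\<lambda>z. (v z, p z)) \<and>
    euler_distr v p \<and>
    (AE z in lborel. z \<in> \<Omega> \<longrightarrow> norm (v z) = 1) \<and>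
    (AE z in lborel. z \<notin> \<Omega> \<longrightarrow> v z = 0 \<and> p z = 0) \<and>
    (\<exists>(vk :: nat \<Rightarrow> (real ^ 'n) \<times> real \<Rightarrow> real ^ 'n)
      (pk :: nat \<Rightarrow> (real ^ 'n) \<times> real \<Rightarrow> real)
      (fk :: nat \<Rightarrow> (real ^ 'n) \<times> real \<Rightarrow> real ^ 'n).
      (\<forall>k. Cc_infty \<Omega> (\<lambda>z. (vk k z, pk k z, fk k z))) \<and>
      (\<forall>k z. dird e_t (vk k) z + Div_x (\<lambda>y. otimes (vk k y) (vk k y)) z + grad_x (pk k) z
              = fk k z) \<and>
      (\<forall>k z. div_x (vk k) z = 0) \<and>
      (\<lambda>k. Hm1_norm (fk k)) \<longlonglongrightarrow> 0 \<and>
      (\<exists>C::real. \<forall>k. Linf_norm (vk k) + Linf_norm (pk k) \<le> ereal C) \<and>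
      (\<forall>r\<ge>1. tendsto_Lr r (\<lambda>k z. (vk k z, pk k z)) (\<lambda>z. (v z, p z))))"
proof -
  note \<Omega> = assms(2,3)
  let ?n = "real CARD('n)"
  obtain v W where ad: "\<And>k. admissible \<Omega> (v k) (W k)" and trb: "\<And>k z. \<bar>trace (W k z)\<bar> \<le> 2"
    and trc: "\<And>z. convergent (\<lambda>k. trace (W k z))" and vc: "AE z in lborel. convergent (\<lambda>k. v k z)"
    and F0: "(\<lambda>k. total_defect \<Omega> (v k)) \<longlonglongrightarrow> 0"
    by (rule approximating_sequence[OF assms]) (rule that)
  have lin: "lin_sol \<Omega> (v k) (W k)" for k using ad unfolding admissible_def by blast
  have cc: "Cc_infty \<Omega> (v k)" "Cc_infty \<Omega> (W k)" for k using admissible_Cc[OF ad] by auto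
  let ?pk = "\<lambda>k. pressure (v k) (W k)"
  have pc: "Cc_infty \<Omega> (?pk k)" for k using Cc_infty_pressure[OF cc] .
  have v1: "norm (v k z) \<le> 1" for k z using admissible_norm_le[OF ad] .
  have vout: "v k z = 0" "W k z = 0" "?pk k z = 0" if "z \<notin> \<Omega>" for k z
    using Cc_infty_outside[OF cc(1) that] Cc_infty_outside[OF cc(2) that] Cc_infty_outside[OF pc that] by auto
  have vm[measurable]: "v k \<in> borel_measurable borel" and Wm[measurable]: "W k \<in> borel_measurable borel"
    and pm[measurable]: "?pk k \<in> borel_measurable borel" for k
    using smooth_borel Cc_infty_smooth cc pc by blast+
  have trm[measurable]: "(\<lambda>z. trace (W k z)) \<in> borel_measurable borel" for k
    using smooth_borel[OF Cc_infty_smooth[OF Cc_infty_bounded_linear[OF trace_bounded_linear cc(2)]]] .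
  \<comment> \<open>\<open>lim\<close> is total, so \<open>V\<close> is defined and Borel measurable
    everywhere, with an arbitrary value on the null set where the velocities do not
    converge.\<close>
  define V where "V z = lim (\<lambda>k. v k z)" for z
  define q where "q z = lim (\<lambda>k. trace (W k z))" for z
  define p where "p z = (q z - (norm (V z))\<^sup>2) * (1 / ?n)" for z
  have Vm[measurable]: "V \<in> borel_measurable borel" unfolding V_def[abs_def] by measurable
  have qm[measurable]: "q \<in> borel_measurable borel" unfolding q_def[abs_def] by measurable
  have pbm[measurable]: "p \<in> borel_measurable borel" unfolding p_def[abs_def] by measurable
  have Vlim: "AE z in lborel. (\<lambda>k. v k z) \<longlonglongrightarrow> V z"
    using vc by eventually_elim (simp add: V_def convergent_LIMSEQ_iff)
  have qlim: "(\<lambda>k. trace (W k z)) \<longlonglongrightarrow> q z" for z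
    using trc[of z] by (simp add: q_def convergent_LIMSEQ_iff)
  have plim: "AE z in lborel. (\<lambda>k. ?pk k z) \<longlonglongrightarrow> p z"
    using Vlim
  proof eventually_elim
    case (elim z)
    then show ?case unfolding pressure_def p_def by (intro tendsto_intros qlim)
  qed
  \<comment> \<open>Outside \<Omega> every term of the sequences is 0, so the limits vanish at every
    such point and not merely almost everywhere.\<close>
  have out: "V z = 0" "p z = 0" if "z \<notin> \<Omega>" for z
    unfolding V_def p_def q_def using vout[OF that] by (auto simp: trace_def)
  have pb: "\<bar>(t - x\<^sup>2) * (1 / ?n)\<bar> \<le> 3" if "\<bar>t\<bar> \<le> 2" "0 \<le> x" "x \<le> 1" for t x :: real
  proof -
    have x2: "0 \<le> x\<^sup>2" "x\<^sup>2 \<le> 1" using that(2,3) by (auto simp: power_le_one)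
    have "\<bar>t - x\<^sup>2\<bar> \<le> 3" using that(1) x2 by linarith
    then have "\<bar>(t - x\<^sup>2) * (1 / ?n)\<bar> \<le> 3 * 1"
      unfolding abs_mult by (intro mult_mono) auto
    then show ?thesis by simp
  qed
  have pk3: "\<bar>?pk k z\<bar> \<le> 3" for k z unfolding pressure_def using trb v1 by (intro pb) auto
  have V1: "AE z in lborel. norm (V z) \<le> 1"
    using Vlim
  proof eventually_elim
    case (elim z)
    show ?case by (rule tendsto_upperbound[OF tendsto_norm[OF elim]]) (use v1 in auto)
  qed
  have q2: "\<bar>q z\<bar> \<le> 2" for z
    by (rule tendsto_upperbound[OF tendsto_rabs[OF qlim]]) (use trb in auto)
  have p3: "AE z in lborel. \<bar>p z\<bar> \<le> 3"
    using V1
  proof eventually_elim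
    case (elim z)
    then show ?case unfolding p_def by (intro pb q2) auto
  qed
  \<comment> \<open>Almost everywhere convergence carries the vanishing of the total defect over to
    \<open>V\<close>; a nonnegative integrand with integral 0 is 0 almost everywhere.\<close>
  have sat: "AE z in lborel. z \<in> \<Omega> \<longrightarrow> norm (V z) = 1"
  proof -
    have m: "(\<lambda>z. indicator \<Omega> z * defect f z) \<in> borel_measurable borel"
      if "f \<in> borel_measurable borel" for f :: "'n spacetime \<Rightarrow> real ^ 'n"
      using \<Omega>(1) by (intro borel_measurable_times borel_measurable_indicator borel_defect that) auto
    have b: "\<bar>indicator \<Omega> z * defect (v k) z\<bar> \<le> 1 * indicator \<Omega> z" for k z
      using defect_bounds[of "v k" z, OF v1] by (auto simp: indicator_def)
    have l: "AE z in lborel. (\<lambda>k. indicator \<Omega> z * defect (v k) z) \<longlonglongrightarrow> indicator \<Omega> z * defect V z"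
      using Vlim by eventually_elim (auto simp: defect_def intro!: tendsto_intros)
    have 1: "(\<lambda>k. total_defect \<Omega> (v k)) \<longlonglongrightarrow> total_defect \<Omega> V" "integrable lborel (\<lambda>z. indicator \<Omega> z * defect V z)"
      unfolding total_defect_def by (rule bounded_convergence[OF \<Omega> m[OF vm] m[OF Vm] b l])+
    have "total_defect \<Omega> V = 0" using LIMSEQ_unique[OF 1(1) F0] .
    then have "AE z in lborel. indicator \<Omega> z * defect V z = 0"
      unfolding total_defect_def using integral_nonneg_eq_0_iff_AE[OF 1(2)] by (simp add: defect_def)
    then show ?thesis
    proof eventually_elim
      case (elim z)
      show ?case
      proof
        assume "z \<in> \<Omega>"
        then have "(norm (V z))\<^sup>2 = 1" using elim by (simp add: defect_def)
        then show "norm (V z) = 1" using power2_eq_imp_eq[of "norm (V z)" 1] by simp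
      qed
    qed
  qed
  \<comment> \<open>The nonlinear term is identified here. In \<Omega> the Reynolds entries are
    squeezed to 0 because |V| = 1, outside they vanish identically, so \<open>W k\<close> tends to V
    \<otimes> V + p I.\<close>
  have Rlim: "AE z in lborel. (\<lambda>k. W k z $ i $ j) \<longlonglongrightarrow> V z $ i * V z $ j + (if i = j then p z else 0)" for i j
    using Vlim plim sat
  proof eventually_elim
    case (elim z)
    have "(\<lambda>k. reynolds (v k) (W k) z $ i $ j) \<longlonglongrightarrow> 0"
    proof (cases "z \<in> \<Omega>")
      case True
      then have n1: "norm (V z) = 1" using elim by simp
      have "(\<lambda>k. 2 * (1 - (norm (v k z))\<^sup>2)) \<longlonglongrightarrow> 2 * (1 - (norm (V z))\<^sup>2)"
        by (intro tendsto_intros elim)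
      then have "(\<lambda>k. 2 * (1 - (norm (v k z))\<^sup>2)) \<longlonglongrightarrow> 0" unfolding n1 by simp
      then show ?thesis
        by (rule Lim_null_comparison[rotated]) (use reynolds_bound[OF ad] in auto)
    next
      case False
      then show ?thesis using Cc_infty_outside[OF Cc_infty_reynolds[OF cc]] by simp
    qed
    moreover have "W k z $ i $ j = v k z $ i * v k z $ j + (if i = j then ?pk k z else 0) - reynolds (v k) (W k) z $ i $ j" for k
      unfolding reynolds_entry by simp
    moreover have "(\<lambda>k. if i = j then ?pk k z else 0) \<longlonglongrightarrow> (if i = j then p z else 0)"
      using elim(2) by auto
    ultimately show ?case
      using tendsto_diff[OF tendsto_add[OF tendsto_mult[OF tendsto_vec_nth[OF elim(1), of i] tendsto_vec_nth[OF elim(1), of j]]], of _ _ "\<lambda>k. reynolds (v k) (W k) z $ i $ j" 0]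
      by simp
  qed
  have vi1: "\<bar>v k z $ i\<bar> \<le> indicator \<Omega> z" for k z i
    using component_le_norm_cart[of "v k z" i] v1[of k z] vout[of z k] by (cases "z \<in> \<Omega>") auto
  \<comment> \<open>\<open>subsol\<close> leaves the trace of \<open>W\<close> free, so a uniform
    bound is recovered from the Reynolds identity: 1 for the velocity product, 3 for the pressure, 2
    for the Reynolds entry.\<close>
  have Wij: "\<bar>W k z $ i $ j\<bar> \<le> 6 * indicator \<Omega> z" for k z i j
  proof (cases "z \<in> \<Omega>")
    case True
    have 1: "\<bar>v k z $ i * v k z $ j\<bar> \<le> 1 * 1" unfolding abs_mult using vi1[of k z i] vi1[of k z j] True by (intro mult_mono) auto
    have 2: "\<bar>reynolds (v k) (W k) z $ i $ j\<bar> \<le> 2"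
      by (rule order_trans[OF reynolds_bound[OF ad]]) simp
    have 3: "\<bar>if i = j then ?pk k z else 0\<bar> \<le> 3" using pk3[of k z] by simp
    have 4: "W k z $ i $ j = v k z $ i * v k z $ j + (if i = j then ?pk k z else 0) - reynolds (v k) (W k) z $ i $ j"
      unfolding reynolds_entry by simp
    have "\<bar>W k z $ i $ j\<bar> \<le> 1 * 1 + 3 + 2"
      unfolding 4 by (rule order_trans[OF abs_triangle_ineq4 add_mono[OF order_trans[OF abs_triangle_ineq add_mono[OF 1 3]] 2]])
    then show ?thesis using True by simp
  qed (use vout in simp)
  \<comment> \<open>The first part passes to the limit in the weak equations; the second supplies
    the integrability needed to split V \<otimes> V + p I under the integral.\<close>
  have conv: "(\<lambda>k. \<integral>z. u k z * dird b \<phi> z \<partial>lborel) \<longlonglongrightarrow> (\<integral>z. f z * dird b \<phi> z \<partial>lborel)"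
    "integrable lborel (\<lambda>z. f z * dird b \<phi> z)"
    if \<phi>: "Cc_infty UNIV \<phi>" and [measurable]: "\<And>k. u k \<in> borel_measurable borel" "f \<in> borel_measurable borel"
      and b: "\<And>k z. \<bar>u k z\<bar> \<le> C * indicator \<Omega> z" and l: "AE z in lborel. (\<lambda>k. u k z) \<longlonglongrightarrow> f z"
    for u :: "nat \<Rightarrow> 'n spacetime \<Rightarrow> real" and f \<phi> b C
  proof -
    obtain D where D: "D > 0" "\<And>z. norm (dird b \<phi> z) \<le> D" using Cc_infty_bounded[OF Cc_infty_dird[OF \<phi>]] by blast
    have [measurable]: "dird b \<phi> \<in> borel_measurable borel"
      using smooth_borel[OF Cc_infty_smooth[OF Cc_infty_dird[OF \<phi>]]] .
    have bd: "\<bar>u k z * dird b \<phi> z\<bar> \<le> (C * D) * indicator \<Omega> z" for k z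
    proof -
      have "\<bar>u k z * dird b \<phi> z\<bar> \<le> (C * indicator \<Omega> z) * D"
        unfolding abs_mult using b[of k z] D(2)[of z] order_trans[OF abs_ge_zero b[of k z]] by (intro mult_mono) auto
      then show ?thesis by (simp add: mult_ac)
    qed
    have ae: "AE z in lborel. (\<lambda>k. u k z * dird b \<phi> z) \<longlonglongrightarrow> f z * dird b \<phi> z"
      using l by eventually_elim (intro tendsto_intros)
    show "(\<lambda>k. \<integral>z. u k z * dird b \<phi> z \<partial>lborel) \<longlonglongrightarrow> (\<integral>z. f z * dird b \<phi> z \<partial>lborel)"
      "integrable lborel (\<lambda>z. f z * dird b \<phi> z)"
      by (rule bounded_convergence[OF \<Omega> _ _ bd ae]; measurable)+
  qed
  have Vi: "AE z in lborel. (\<lambda>k. v k z $ i) \<longlonglongrightarrow> V z $ i" for i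
    using Vlim by eventually_elim (rule tendsto_vec_nth)
  have euler: "euler_distr V p"
    unfolding euler_distr_def
  proof (intro allI impI conjI)
    fix \<phi> :: "'n spacetime \<Rightarrow> real" and i :: 'n
    assume \<phi>: "Cc_infty UNIV \<phi>"
    note s\<phi> = Cc_infty_smooth[OF \<phi>]
    have c1: "(\<lambda>k. \<integral>z. v k z $ i * dird e_t \<phi> z \<partial>lborel) \<longlonglongrightarrow> (\<integral>z. V z $ i * dird e_t \<phi> z \<partial>lborel)"
      by (rule conv(1)[OF \<phi>, where C=1]) (use vi1 Vi in \<open>simp_all\<close>)
    let ?L = "\<lambda>j z. V z $ i * V z $ j + (if i = j then p z else 0)"
    have c2: "(\<lambda>k. \<integral>z. W k z $ i $ j * dird (e_x j) \<phi> z \<partial>lborel) \<longlonglongrightarrow> (\<integral>z. ?L j z * dird (e_x j) \<phi> z \<partial>lborel)" for j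
    proof (rule conv(1)[OF \<phi> _ _ Wij Rlim])
      show "?L j \<in> borel_measurable borel" by (cases "i = j") (simp_all, measurable)
    qed measurable
    have "(\<lambda>k. (\<integral>z. v k z $ i * dird e_t \<phi> z \<partial>lborel) + (\<Sum>j\<in>UNIV. \<integral>z. W k z $ i $ j * dird (e_x j) \<phi> z \<partial>lborel))
       \<longlonglongrightarrow> (\<integral>z. V z $ i * dird e_t \<phi> z \<partial>lborel) + (\<Sum>j\<in>UNIV. \<integral>z. ?L j z * dird (e_x j) \<phi> z \<partial>lborel)"
      by (intro tendsto_intros c1 c2)
    then have eq: "(\<integral>z. V z $ i * dird e_t \<phi> z \<partial>lborel) + (\<Sum>j\<in>UNIV. \<integral>z. ?L j z * dird (e_x j) \<phi> z \<partial>lborel) = 0"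
      unfolding weak_momentum[OF lin s\<phi>] by (simp add: LIMSEQ_const_iff)
    have i1: "integrable lborel (\<lambda>z. p z * dird (e_x i) \<phi> z)"
      by (rule conv(2)[OF \<phi>, where u="?pk" and C=3]) (use pk3 vout plim in \<open>auto simp: indicator_def\<close>)
    have i2: "integrable lborel (\<lambda>z. V z $ i * V z $ j * dird (e_x j) \<phi> z)" for j
    proof (rule conv(2)[OF \<phi>, where u="\<lambda>k z. v k z $ i * v k z $ j" and C=1])
      show "\<bar>v k z $ i * v k z $ j\<bar> \<le> 1 * indicator \<Omega> z" for k z
        using mult_mono[OF vi1[of k z i] vi1[of k z j]] by (cases "z \<in> \<Omega>") (auto simp: abs_mult vout)
      show "AE z in lborel. (\<lambda>k. v k z $ i * v k z $ j) \<longlonglongrightarrow> V z $ i * V z $ j"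
        using Vi[of i] Vi[of j] by eventually_elim (rule tendsto_mult)
    qed measurable
    have "(\<integral>z. ?L j z * dird (e_x j) \<phi> z \<partial>lborel) = (\<integral>z. V z $ i * V z $ j * dird (e_x j) \<phi> z \<partial>lborel)
       + (if i = j then (\<integral>z. p z * dird (e_x i) \<phi> z \<partial>lborel) else 0)" for j
      using i1 i2[of j] by (auto simp: distrib_right)
    then have "(\<Sum>j\<in>UNIV. \<integral>z. ?L j z * dird (e_x j) \<phi> z \<partial>lborel) = (\<Sum>j\<in>UNIV. \<integral>z. V z $ i * V z $ j * dird (e_x j) \<phi> z \<partial>lborel)
       + (\<integral>z. p z * dird (e_x i) \<phi> z \<partial>lborel)"
      by (simp add: sum.distrib)
    then show "distr_dird e_t (\<lambda>z. V z $ i) \<phi> + (\<Sum>j\<in>UNIV. distr_dird (e_x j) (\<lambda>z. otimes (V z) (V z) $ i $ j) \<phi>)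
       + distr_dird (e_x i) p \<phi> = 0"
      using eq unfolding distr_dird_def otimes_def by (simp add: sum_negf)
  next
    fix \<phi> :: "'n spacetime \<Rightarrow> real"
    assume \<phi>: "Cc_infty UNIV \<phi>"
    have c: "(\<lambda>k. \<integral>z. v k z $ j * dird (e_x j) \<phi> z \<partial>lborel) \<longlonglongrightarrow> (\<integral>z. V z $ j * dird (e_x j) \<phi> z \<partial>lborel)" for j
      by (rule conv(1)[OF \<phi>, where C=1]) (use vi1 Vi in \<open>simp_all\<close>)
    have "(\<lambda>k. \<Sum>j\<in>UNIV. \<integral>z. v k z $ j * dird (e_x j) \<phi> z \<partial>lborel) \<longlonglongrightarrow> (\<Sum>j\<in>UNIV. \<integral>z. V z $ j * dird (e_x j) \<phi> z \<partial>lborel)"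
      by (intro tendsto_intros c)
    moreover have "(\<Sum>j\<in>UNIV. \<integral>z. v k z $ j * dird (e_x j) \<phi> z \<partial>lborel) = 0" for k
      using weak_div_x[OF cc(1)[of k] Cc_infty_smooth[OF \<phi>]] lin[of k] unfolding lin_sol_def by simp
    ultimately show "(\<Sum>j\<in>UNIV. distr_dird (e_x j) (\<lambda>z. V z $ j) \<phi>) = 0"
      unfolding distr_dird_def by (simp add: sum_negf LIMSEQ_const_iff)
  qed
  have n4: "norm (x, y) \<le> 4" if "norm x \<le> 1" "\<bar>y\<bar> \<le> 3" for x :: "real ^ 'n" and y :: real
    using norm_Pair_triangle[of x y] that by simp
  have VP: "AE z in lborel. norm (V z, p z) \<le> 4" using V1 p3 by eventually_elim (rule n4)
  have linf: "Linf (\<lambda>z. (V z, p z))"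
  proof -
    have "Linf_norm (\<lambda>z. (V z, p z)) \<le> ereal 4"
      unfolding Linf_norm_def by (rule esssup_I) (use VP in auto)
    then show ?thesis unfolding Linf_def using le_less_trans[of _ "ereal 4" \<infinity>] by auto
  qed
  define fk where "fk k = Div_x (reynolds (v k) (W k))" for k
  have fc: "Cc_infty \<Omega> (fk k)" for k unfolding fk_def by (intro Cc_infty_Div_x Cc_infty_reynolds cc)
  have "Linf_norm (v k) + Linf_norm (?pk k) \<le> ereal 4" for k
  proof -
    have "Linf_norm (v k) \<le> ereal 1" unfolding Linf_norm_def by (rule esssup_I) (use v1 in auto)
    moreover have "Linf_norm (?pk k) \<le> ereal 3" unfolding Linf_norm_def by (rule esssup_I) (use pk3 in auto)
    ultimately have "Linf_norm (v k) + Linf_norm (?pk k) \<le> ereal 1 + ereal 3" by (rule add_mono)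
    then show ?thesis by simp
  qed
  then have bound: "\<exists>C::real. \<forall>k. Linf_norm (v k) + Linf_norm (?pk k) \<le> ereal C" by blast
  have Lr: "tendsto_Lr r (\<lambda>k z. (v k z, ?pk k z)) (\<lambda>z. (V z, p z))" if r: "r \<ge> 1" for r
  proof (rule bounded_convergence_Lr[OF \<Omega> _ _ _ _ _ VP _ r])
    show "norm (v k z, ?pk k z) \<le> 4" for k z by (rule n4[OF v1 pk3])
    show "AE z in lborel. (\<lambda>k. (v k z, ?pk k z)) \<longlonglongrightarrow> (V z, p z)"
      using Vlim plim by eventually_elim (rule tendsto_Pair)
  qed (use vout out in \<open>auto simp: zero_prod_def\<close>)
  have "\<forall>k z. div_x (v k) z = 0" using lin unfolding lin_sol_def by blast
  moreover have "\<forall>k z. dird e_t (v k) z + Div_x (\<lambda>y. otimes (v k y) (v k y)) z + grad_x (?pk k) z = fk k z"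
    unfolding fk_def using reynolds_force[OF ad] by blast
  moreover have "\<forall>k. Cc_infty \<Omega> (\<lambda>z. (v k z, ?pk k z, fk k z))" by (intro allI Cc_infty_Pair cc pc fc)
  moreover have "(\<lambda>k. Hm1_norm (fk k)) \<longlonglongrightarrow> 0"
    unfolding fk_def by (rule Hm1_norm_reynolds_tendsto_0[OF ad \<Omega> F0])
  ultimately show ?thesis
    using linf euler sat out bound Lr by (intro exI[of _ V] exI[of _ p] conjI exI[of _ v] exI[of _ ?pk] exI[of _ fk]) auto
qed

end
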